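(* Let $\mathfrak g$ be the complex simple Lie algebra of type $G_2$ with Chevalley generators $e_i,f_i,h_i$ ($i=1,2$), $\alpha_1$ being the short simple root and $\alpha_2$ the long one. Put $x_1=e_1$, $x_3=[e_1,e_2]$, $x_4=[e_1,x_3]$, $x_5=[e_1,x_4]$, and let $\mathfrak h\subset\mathfrak g$ be the coisotropic subalgebra spanned by $$h_1+h_2,\quad x_1,\quad x_4,\quad x_5 .$$ Let $B_h$ be the subalgebra of $U_q(\mathfrak g)$ (identified with $U_h(\mathfrak g)$) generated by $$K_1K_2,\quad E_1,\quad X=[[E_1,E_2]_{q^3},E_1]_{q^{-1}},\quad Y=[[[E_1,E_2]_{q^3},E_1]_{q^{-1}},E_1]_q .$$ Then $B_h$ is a quantization of $\mathfrak h$.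
   Context: Quantum group. For a finite-dimensional complex semisimple Lie algebra $\mathfrak g$ with Cartan matrix $(a_{ij})_{1\le i,j\le n}$ and symmetrizing positive integers $d_i$ (so $(d_ia_{ij})$ is symmetric), $U_q(\mathfrak g)$ is the associative algebra over $\mathbb Q(q)$ with generators $X_i^+,X_i^-,K_i,K_i^{-1}$ ($1\le i\le n$) and relations $K_iK_j=K_jK_i$, $K_iK_i^{-1}=K_i^{-1}K_i=1$, $K_iX_j^{\pm}=q^{\pm d_ia_{ij}}X_j^{\pm}K_i$, $X_i^+X_j^--X_j^-X_i^+=\delta_{ij}\frac{K_i-K_i^{-1}}{q^{d_i}-q^{-d_i}}$, and the quantum Serre relations $\sum_{r=0}^{1-a_{ij}}(-1)^r\binom{1-a_{ij}}{r}_{q^{d_i}}(X_i^{\pm})^{1-a_{ij}-r}X_j^{\pm}(X_i^{\pm})^r=0$ for $i\ne j$. Its comultiplication is $\Delta(K_i)=K_i\otimes K_i$, $\Delta(X_i^+)=X_i^+\otimes K_i+1\otimes X_i^+$, $\Delta(X_i^-)=X_i^-\otimes1+K_i^{-1}\otimes X_i^-$. Write $E_i=X_i^+$ and $[A,B]_{q^k}=AB-q^kBA$, $[A,B]=AB-BA$. $U_q(\mathfrak g)$ is identified with the Drinfeld–Jimbo algebra $U_h(\mathfrak g)$ over $\mathbb C[[h]]$ by $q=e^{h}$, $K_i=e^{d_ihH_i}$; $U_h(\mathfrak g)/hU_h(\mathfrak g)\cong U(\mathfrak g)$, and $\pi_{U_h}:U_h(\mathfrak g)\to U(\mathfrak g)$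 is the specialization at $h=0$. For $G_2$: $a_{12}=-3$, $a_{21}=-1$, $d_1=1$, $d_2=3$. Coisotropic subalgebra. A coisotropic subalgebra of a Lie bialgebra $(\mathfrak g,[\,,],\delta)$ is a Lie subalgebra $\mathfrak h$ with $\delta(\mathfrak h)\subset\mathfrak h\wedge\mathfrak g$. Here $\mathfrak g$ carries the standard Lie bialgebra structure given by the $r$-matrix $\pi=\sum_{\alpha>0}\lambda_\alpha e_\alpha\wedge f_\alpha$, $\lambda_\alpha=1/K(e_\alpha,f_\alpha)$, $K$ the Killing form and $e_\alpha,f_\alpha$ root vectors for $\alpha$, $-\alpha$. Quantization. A quantization of a coisotropic subalgebra $\mathfrak h$ of $\mathfrak g$ is a subalgebra $B_h$ of $U_h(\mathfrak g)$ which is a left (or right) coideal ($\Delta(B_h)\subset B_h\otimes U_h(\mathfrak g)$ for left) such that $B_h/hB_h\cong\pi_{U_h}(B_h)=U(\mathfrak h)$; that is, the map $B_h/hB_h\to U(\mathfrak g)$ induced by $\pi_{U_h}$ is injective with image $U(\mathfrak h)$ (equivalently $B_h\cap hU_h(\mathfrak g)=hB_h$ and $\pi_{U_h}(B_h)=U(\mathfrak h)$).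
   Formalization: B_h is taken h-adically closed and also contains log(K_1K_2)/h as a generator, since K_1K_2 alone specializes to 1 and h_1+h_2 is missed; h_i means d_i times the coroot, since K_1K_2=exp(h(H_1+3H_2)) and the claim fails for plain coroots. *)

theory Defs
  imports Complex_Main
    "HOL-Library.Poly_Mapping"
    "HOL-Library.Product_Plus"
    "HOL-Computational_Algebra.Formal_Power_Series"
begin

section \<open>Ideals, subalgebras and adic closure in noncommutative rings\<close>

inductive_set ideal_gen :: "'a::{ring,monoid_mult} set \<Rightarrow> 'a set" for R where
  zero: "0 \<in> ideal_gen R"
| gen: "r \<in> R \<Longrightarrow> a * r * b \<in> ideal_gen R"
| add: "x \<in> ideal_gen R \<Longrightarrow> y \<in> ideal_gen R \<Longrightarrow> x + y \<in> ideal_gen R"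

text \<open>The smallest unital subring containing \<open>S\<close>. Algebras over a commutative ring are handled by
  putting the scalars into \<open>S\<close>.\<close>

inductive_set ring_hull :: "'a::{ring,monoid_mult} set \<Rightarrow> 'a set" for S where
  base: "s \<in> S \<Longrightarrow> s \<in> ring_hull S"
| one: "1 \<in> ring_hull S"
| diff: "x \<in> ring_hull S \<Longrightarrow> y \<in> ring_hull S \<Longrightarrow> x - y \<in> ring_hull S"
| mult: "x \<in> ring_hull S \<Longrightarrow> y \<in> ring_hull S \<Longrightarrow> x * y \<in> ring_hull S"

inductive_set additive_hull :: "'a::ab_group_add set \<Rightarrow> 'a set" for S where
  zero: "0 \<in> additive_hull S"
| base: "s \<in> S \<Longrightarrow> s \<in> additive_hull S"
| diff: "x \<in> additive_hull S \<Longrightarrow> y \<in> additive_hull S \<Longrightarrow> x - y \<in> additive_hull S"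

text \<open>Closure in the \<open>t\<close>-adic topology, for a central element \<open>t\<close>.\<close>

definition adic_closure :: "'a::{ring,monoid_mult} \<Rightarrow> 'a set \<Rightarrow> 'a set" where
  "adic_closure t S = {x. \<forall>n. \<exists>s\<in>S. \<exists>y. x - s = t ^ n * y}"

definition commutator :: "'a::ring \<Rightarrow> 'a \<Rightarrow> 'a" where
  "commutator x y = x * y - y * x"

locale two_sided_ideal =
  fixes I :: "'a::{ring,monoid_mult} set"
  assumes zero_mem: "0 \<in> I"
    and add_mem: "x \<in> I \<Longrightarrow> y \<in> I \<Longrightarrow> x + y \<in> I"
    and mult_mem: "x \<in> I \<Longrightarrow> a * x * b \<in> I"
begin

lemma left_mem: "x \<in> I \<Longrightarrow> a * x \<in> I"
  using mult_mem[of x a 1] by simp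

lemma right_mem: "x \<in> I \<Longrightarrow> x * b \<in> I"
  using mult_mem[of x 1 b] by simp

lemma minus_mem: "x \<in> I \<Longrightarrow> - x \<in> I"
  using left_mem[of x "- 1"] by simp

lemma diff_mem: "x \<in> I \<Longrightarrow> y \<in> I \<Longrightarrow> x - y \<in> I"
  using add_mem[of x "- y"] minus_mem by simp

lemma cong_equivp: "equivp (\<lambda>x y. x - y \<in> I)"
proof (rule equivpI)
  show "reflp (\<lambda>x y. x - y \<in> I)" by (simp add: reflp_def zero_mem)
  show "symp (\<lambda>x y. x - y \<in> I)"
    by (rule sympI) (metis minus_diff_eq minus_mem)
  show "transp (\<lambda>x y. x - y \<in> I)"
    by (rule transpI) (metis add_mem diff_add_cancel add_diff_eq)
qed

lemma cong_add: "x - x' \<in> I \<Longrightarrow> y - y' \<in> I \<Longrightarrow> (x + y) - (x' + y') \<in> I"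
  using add_mem[of "x - x'" "y - y'"] by (simp add: algebra_simps)

lemma cong_diff: "x - x' \<in> I \<Longrightarrow> y - y' \<in> I \<Longrightarrow> (x - y) - (x' - y') \<in> I"
  using diff_mem[of "x - x'" "y - y'"] by (simp add: algebra_simps)

lemma cong_minus: "x - x' \<in> I \<Longrightarrow> - x - - x' \<in> I"
  using minus_mem[of "x - x'"] by (simp add: algebra_simps)

lemma cong_mult:
  assumes "x - x' \<in> I" "y - y' \<in> I"
  shows "x * y - x' * y' \<in> I"
proof -
  have "x * y - x' * y' = (x - x') * y + x' * (y - y')" by (simp add: algebra_simps)
  then show ?thesis using assms by (simp add: add_mem left_mem right_mem)
qed

end

lemma two_sided_ideal_ideal_gen: "two_sided_ideal (ideal_gen R)"
proof
  fix x a b :: 'a assume "x \<in> ideal_gen R"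
  then show "a * x * b \<in> ideal_gen R"
  proof induction
    case (gen r a' b')
    then show ?case using ideal_gen.gen[of r R "a * a'" "b' * b"] by (simp add: mult.assoc)
  next
    case (add x y)
    then show ?case using ideal_gen.add by (simp add: distrib_left distrib_right)
  qed (simp add: ideal_gen.zero)
qed (auto intro: ideal_gen.intros)

lemma two_sided_ideal_adic_closure:
  assumes "two_sided_ideal I" and central: "\<And>a. t * a = a * t"
  shows "two_sided_ideal (adic_closure t I)"
proof -
  interpret two_sided_ideal I by fact
  have pow: "a * t ^ n = t ^ n * a" for a n
    by (induction n) (simp, metis central mult.assoc power_Suc)
  show ?thesis
  proof
    show "0 \<in> adic_closure t I"
      unfolding adic_closure_def using zero_mem by (auto intro!: bexI[of _ 0] exI[of _ 0])
  next
    fix x y assume xy: "x \<in> adic_closure t I" "y \<in> adic_closure t I"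
    show "x + y \<in> adic_closure t I"
      unfolding adic_closure_def
    proof (intro CollectI allI)
      fix n
      obtain r s k l where "r \<in> I" "s \<in> I" "x - r = t ^ n * k" "y - s = t ^ n * l"
        using xy unfolding adic_closure_def by blast
      moreover from this have "x + y - (r + s) = t ^ n * (k + l)" by (simp add: algebra_simps)
      ultimately show "\<exists>u\<in>I. \<exists>z. x + y - u = t ^ n * z" using add_mem by blast
    qed
  next
    fix x a b assume x: "x \<in> adic_closure t I"
    show "a * x * b \<in> adic_closure t I"
      unfolding adic_closure_def
    proof (intro CollectI allI)
      fix n
      obtain r k where r: "r \<in> I" and "x - r = t ^ n * k"
        using x unfolding adic_closure_def by blast
      then have "a * (x - r) * b = a * t ^ n * k * b" by (simp add: mult.assoc)
      then have "a * x * b - a * r * b = t ^ n * (a * k * b)"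
        by (simp add: pow algebra_simps)
      then show "\<exists>u\<in>I. \<exists>z. a * x * b - u = t ^ n * z" using r mult_mem by blast
    qed
  qed
qed


section \<open>Free algebras\<close>

text \<open>The Dynkin diagram of type \<open>G\<^sub>2\<close>: \<open>Node1\<close> is the short simple root, \<open>Node2\<close> the long one.\<close>

datatype node = Node1 | Node2

fun cartan :: "node \<Rightarrow> node \<Rightarrow> int" where
  "cartan Node1 Node1 = 2"
| "cartan Node1 Node2 = -3"
| "cartan Node2 Node1 = -1"
| "cartan Node2 Node2 = 2"

fun symm :: "node \<Rightarrow> nat" where
  "symm Node1 = 1"
| "symm Node2 = 3"

datatype letter = XP node | XM node | HH node

datatype word = Word "letter list"

instantiation word :: monoid_add
begin

definition zero_word :: word where "zero_word = Word []"

fun plus_word :: "word \<Rightarrow> word \<Rightarrow> word" where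
  "plus_word (Word u) (Word v) = Word (u @ v)"

instance
proof
  fix a b c :: word
  show "a + b + c = a + (b + c)" by (cases a; cases b; cases c) simp
  show "0 + a = a" "a + 0 = a" by (cases a; simp add: zero_word_def)+
qed

end

text \<open>\<open>free\<close> is the free algebra on the letters (the monoid algebra of words) and \<open>free2\<close> is
  \<open>free \<otimes> free\<close>. Power series over them (in the variable \<open>h\<close>) are the \<open>h\<close>-adically
  completed free \<open>\<complex>[[h]]\<close>-algebra and its completed tensor square.\<close>

type_synonym free = "word \<Rightarrow>\<^sub>0 complex"
type_synonym free2 = "(word \<times> word) \<Rightarrow>\<^sub>0 complex"

abbreviation cst :: "complex \<Rightarrow> 'm::monoid_add \<Rightarrow>\<^sub>0 complex" where
  "cst c \<equiv> Poly_Mapping.single 0 c"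

definition scal :: "complex fps \<Rightarrow> ('m::monoid_add \<Rightarrow>\<^sub>0 complex) fps" where
  "scal c = Abs_fps (\<lambda>n. cst (fps_nth c n))"

definition lt :: "letter \<Rightarrow> free" where
  "lt g = Poly_Mapping.single (Word [g]) 1"

lift_definition tens :: "free \<Rightarrow> free \<Rightarrow> free2" is
  "\<lambda>a b (v, w). a v * b w"
proof -
  fix a b :: "word \<Rightarrow> complex" assume "finite {x. a x \<noteq> 0}" "finite {x. b x \<noteq> 0}"
  then have "finite ({x. a x \<noteq> 0} \<times> {x. b x \<noteq> 0})" by simp
  then show "finite {x. (case x of (v, w) \<Rightarrow> a v * b w) \<noteq> 0}" by (rule rev_finite_subset) auto
qed

definition ftens :: "free fps \<Rightarrow> free fps \<Rightarrow> free2 fps" where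
  "ftens p r = Abs_fps (\<lambda>n. \<Sum>k\<le>n. tens (fps_nth p k) (fps_nth r (n - k)))"


section \<open>The quantized enveloping algebra over \<open>\<complex>[[h]]\<close>\<close>

definition qpow :: "int \<Rightarrow> complex fps" where
  "qpow k = fps_exp (of_int k)"

text \<open>\<open>qint d m\<close> is the symmetric \<open>q\<^sup>d\<close>-integer \<open>[m]\<close>; the quotients below are exact.\<close>

definition qint :: "nat \<Rightarrow> nat \<Rightarrow> complex fps" where
  "qint d m = (qpow (int (d * m)) - qpow (- int (d * m))) div (qpow (int d) - qpow (- int d))"

definition qbinom :: "nat \<Rightarrow> nat \<Rightarrow> nat \<Rightarrow> complex fps" where
  "qbinom d m r = (\<Prod>j=1..m. qint d j) div ((\<Prod>j=1..r. qint d j) * (\<Prod>j=1..m-r. qint d j))"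

text \<open>\<open>hexp a\<close> is the series \<open>e\<^bsup>ha\<^esup>\<close>.\<close>

definition hexp :: "free \<Rightarrow> free fps" where
  "hexp a = Abs_fps (\<lambda>n. cst (1 / fact n) * a ^ n)"

definition fK :: "node \<Rightarrow> free fps" where
  "fK i = hexp (cst (of_nat (symm i)) * lt (HH i))"

definition fKinv :: "node \<Rightarrow> free fps" where
  "fKinv i = hexp (- (cst (of_nat (symm i)) * lt (HH i)))"

abbreviation flt :: "letter \<Rightarrow> free fps" where
  "flt g \<equiv> fps_const (lt g)"

text \<open>\<open>(K\<^sub>i - K\<^sub>i\<^sup>-\<^sup>1) / (q\<^bsup>d\<^sub>i\<^esup> - q\<^bsup>-d\<^sub>i\<^esup>)\<close>: numerator and denominator are divided by \<open>h\<close> first,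
  which makes the denominator a unit.\<close>

definition fKquot :: "node \<Rightarrow> free fps" where
  "fKquot i =
     scal (inverse (fps_shift 1 (qpow (int (symm i)) - qpow (- int (symm i)))))
     * fps_shift 1 (fK i - fKinv i)"

definition serre :: "node \<Rightarrow> node \<Rightarrow> free fps \<Rightarrow> free fps \<Rightarrow> free fps" where
  "serre i j x y =
     (let m = nat (1 - cartan i j) in
      \<Sum>r\<le>m. scal ((-1) ^ r * qbinom (symm i) m r) * x ^ (m - r) * y * x ^ r)"

text \<open>The relations \<open>K\<^sub>i X\<^sub>j\<^sup>\<plusminus> = q\<^bsup>\<plusminus>d\<^sub>ia\<^sub>i\<^sub>j\<^esup> X\<^sub>j\<^sup>\<plusminus> K\<^sub>i\<close> are replaced by their
  infinitesimal form \<open>[H\<^sub>i, X\<^sub>j\<^sup>\<plusminus>] = \<plusminus>a\<^sub>i\<^sub>j X\<^sub>j\<^sup>\<plusminus>\<close>, as usual over \<open>\<complex>[[h]]\<close>.\<close>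

inductive_set Uh_rels :: "free fps set" where
  "commutator (flt (HH i)) (flt (HH j)) \<in> Uh_rels"
| "commutator (flt (HH i)) (flt (XP j)) - of_int (cartan i j) * flt (XP j) \<in> Uh_rels"
| "commutator (flt (HH i)) (flt (XM j)) + of_int (cartan i j) * flt (XM j) \<in> Uh_rels"
| "commutator (flt (XP i)) (flt (XM j)) - (if i = j then fKquot i else 0) \<in> Uh_rels"
| "i \<noteq> j \<Longrightarrow> serre i j (flt (XP i)) (flt (XP j)) \<in> Uh_rels"
| "i \<noteq> j \<Longrightarrow> serre i j (flt (XM i)) (flt (XM j)) \<in> Uh_rels"

definition Uh_ideal :: "free fps set" where
  "Uh_ideal = adic_closure fps_X (ideal_gen Uh_rels)"

definition Uh2_ideal :: "free2 fps set" where
  "Uh2_ideal = adic_closure fps_X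
     (ideal_gen ((\<lambda>r. ftens r 1) ` Uh_rels \<union> (\<lambda>r. ftens 1 r) ` Uh_rels))"

lemma two_sided_ideal_Uh: "two_sided_ideal Uh_ideal"
  unfolding Uh_ideal_def
  by (intro two_sided_ideal_adic_closure two_sided_ideal_ideal_gen fps_mult_fps_X_commute)

lemma two_sided_ideal_Uh2: "two_sided_ideal Uh2_ideal"
  unfolding Uh2_ideal_def
  by (intro two_sided_ideal_adic_closure two_sided_ideal_ideal_gen fps_mult_fps_X_commute)

text \<open>\<open>Uh\<close> is \<open>U\<^sub>h(\<gg>)\<close> and \<open>Uh2\<close> is the completed tensor square of \<open>U\<^sub>h(\<gg>)\<close>. Dividing by the
  closure of the ideal of relations makes both \<open>h\<close>-adically separated and complete.\<close>

quotient_type Uh = "free fps" / "\<lambda>x y. x - y \<in> Uh_ideal"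
  by (rule two_sided_ideal.cong_equivp[OF two_sided_ideal_Uh])

instantiation Uh :: "{ring,monoid_mult}"
begin

lift_definition zero_Uh :: Uh is 0 .
lift_definition one_Uh :: Uh is 1 .
lift_definition plus_Uh :: "Uh \<Rightarrow> Uh \<Rightarrow> Uh" is "(+)"
  by (rule two_sided_ideal.cong_add[OF two_sided_ideal_Uh])
lift_definition minus_Uh :: "Uh \<Rightarrow> Uh \<Rightarrow> Uh" is "(-)"
  by (rule two_sided_ideal.cong_diff[OF two_sided_ideal_Uh])
lift_definition uminus_Uh :: "Uh \<Rightarrow> Uh" is uminus
  by (rule two_sided_ideal.cong_minus[OF two_sided_ideal_Uh])
lift_definition times_Uh :: "Uh \<Rightarrow> Uh \<Rightarrow> Uh" is "(*)"
  by (rule two_sided_ideal.cong_mult[OF two_sided_ideal_Uh])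

instance
  by standard
    (transfer; simp add: algebra_simps two_sided_ideal.zero_mem[OF two_sided_ideal_Uh])+

end

quotient_type Uh2 = "free2 fps" / "\<lambda>x y. x - y \<in> Uh2_ideal"
  by (rule two_sided_ideal.cong_equivp[OF two_sided_ideal_Uh2])

instantiation Uh2 :: "{ring,monoid_mult}"
begin

lift_definition zero_Uh2 :: Uh2 is 0 .
lift_definition one_Uh2 :: Uh2 is 1 .
lift_definition plus_Uh2 :: "Uh2 \<Rightarrow> Uh2 \<Rightarrow> Uh2" is "(+)"
  by (rule two_sided_ideal.cong_add[OF two_sided_ideal_Uh2])
lift_definition minus_Uh2 :: "Uh2 \<Rightarrow> Uh2 \<Rightarrow> Uh2" is "(-)"
  by (rule two_sided_ideal.cong_diff[OF two_sided_ideal_Uh2])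
lift_definition uminus_Uh2 :: "Uh2 \<Rightarrow> Uh2" is uminus
  by (rule two_sided_ideal.cong_minus[OF two_sided_ideal_Uh2])
lift_definition times_Uh2 :: "Uh2 \<Rightarrow> Uh2 \<Rightarrow> Uh2" is "(*)"
  by (rule two_sided_ideal.cong_mult[OF two_sided_ideal_Uh2])

instance
  by standard
    (transfer; simp add: algebra_simps two_sided_ideal.zero_mem[OF two_sided_ideal_Uh2])+

end

definition Uh_h :: Uh where "Uh_h = abs_Uh fps_X"

definition Uh2_h :: Uh2 where "Uh2_h = abs_Uh2 fps_X"

definition Uh_scal :: "complex fps \<Rightarrow> Uh" where "Uh_scal c = abs_Uh (scal c)"

definition Uh_H :: "node \<Rightarrow> Uh" where "Uh_H i = abs_Uh (flt (HH i))"

definition Uh_E :: "node \<Rightarrow> Uh" where "Uh_E i = abs_Uh (flt (XP i))"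

definition Uh_K :: "node \<Rightarrow> Uh" where "Uh_K i = abs_Uh (fK i)"

definition qcomm :: "int \<Rightarrow> Uh \<Rightarrow> Uh \<Rightarrow> Uh" where
  "qcomm k A B = A * B - Uh_scal (qpow k) * B * A"

lemma lookup_tens:
  "Poly_Mapping.lookup (tens a b) u = Poly_Mapping.lookup a (fst u) * Poly_Mapping.lookup b (snd u)"
  by transfer (simp add: case_prod_unfold)

lemma tens_simps:
  "tens (a + a') b = tens a b + tens a' b" "tens a (b + b') = tens a b + tens a b'"
  "tens 0 b = 0" "tens a 0 = 0"
  by (rule poly_mapping_eqI; simp add: lookup_tens lookup_add algebra_simps)+

lemma tens_diff: "tens (a - a') b = tens a b - tens a' b" "tens a (b - b') = tens a b - tens a b'"
  by (rule poly_mapping_eqI; simp add: lookup_tens lookup_minus algebra_simps)+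

lemma tens_single:
  "tens (Poly_Mapping.single v a) (Poly_Mapping.single w b) = Poly_Mapping.single (v, w) (a * b)"
  by (rule poly_mapping_eqI) (auto simp: lookup_tens lookup_single when_def)

lemma free_induct:
  fixes P :: "('m::type \<Rightarrow>\<^sub>0 complex) \<Rightarrow> bool"
  assumes "P 0" "\<And>v c. P (Poly_Mapping.single v c)" "\<And>a b. P a \<Longrightarrow> P b \<Longrightarrow> P (a + b)"
  shows "P a"
proof (induction a rule: update_induct)
  case const
  show ?case by (rule assms(1))
next
  case (update f v c)
  have "Poly_Mapping.update v c f = Poly_Mapping.single v c + f"
    using update(1,2) by (intro poly_mapping_eqI)
      (auto simp: lookup_update lookup_add lookup_single when_def in_keys_iff)
  moreover have "P (Poly_Mapping.single v c + f)"
    by (rule assms(3)[OF assms(2) update(3)])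
  ultimately show ?case by simp
qed

lemma tens_mult: "tens (a * c) (b * d) = tens a b * tens c d"
proof (induction a rule: free_induct)
  case (2 v x)
  show ?case
  proof (induction b rule: free_induct)
    case (2 w y)
    show ?case
    proof (induction c rule: free_induct)
      case (2 v' x')
      show ?case
        by (induction d rule: free_induct) (simp_all add: tens_simps tens_single mult_single algebra_simps)
    qed (simp_all add: tens_simps algebra_simps)
  qed (simp_all add: tens_simps algebra_simps)
qed (simp_all add: tens_simps algebra_simps)

lemma tens_1: "tens 1 1 = 1"
  by (simp flip: single_one add: tens_single zero_prod_def)

lemma tens_sum: "tens (sum f A) b = (\<Sum>i\<in>A. tens (f i) b)" "tens b (sum f A) = (\<Sum>i\<in>A. tens b (f i))"
  by (induction A rule: infinite_finite_induct) (simp_all add: tens_simps)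

lemma ftens_1_nth: "fps_nth (ftens p 1) n = tens (fps_nth p n) 1"
  "fps_nth (ftens 1 p) n = tens 1 (fps_nth p n)"
proof -
  have "fps_nth (ftens p 1) n = (\<Sum>k\<le>n. if k = n then tens (fps_nth p n) 1 else 0)"
    unfolding ftens_def fps_nth_Abs_fps by (rule sum.cong) (auto simp: tens_simps)
  then show "fps_nth (ftens p 1) n = tens (fps_nth p n) 1" by simp
  have "fps_nth (ftens 1 p) n = (\<Sum>k\<le>n. if k = 0 then tens 1 (fps_nth p n) else 0)"
    unfolding ftens_def fps_nth_Abs_fps by (rule sum.cong) (auto simp: tens_simps)
  then show "fps_nth (ftens 1 p) n = tens 1 (fps_nth p n)" by simp
qed

lemma ftens_split: "ftens p r = ftens p 1 * ftens 1 r"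
  by (rule fps_ext) (simp add: fps_mult_nth ftens_1_nth flip: tens_mult atLeast0AtMost, simp add: ftens_def atLeast0AtMost)

lemma ftens_1_mult: "ftens (p * r) 1 = ftens p 1 * ftens r 1" "ftens 1 (p * r) = ftens 1 p * ftens 1 r"
  by (rule fps_ext; simp add: fps_mult_nth ftens_1_nth tens_sum flip: tens_mult)+

lemma ftens_add: "ftens (p + p') r = ftens p r + ftens p' r" "ftens p (r + r') = ftens p r + ftens p r'"
  by (rule fps_ext; simp add: ftens_def tens_simps sum.distrib)+

lemma ftens_diff: "ftens (p - p') r = ftens p r - ftens p' r" "ftens p (r - r') = ftens p r - ftens p r'"
  by (rule fps_ext; simp add: ftens_def tens_diff sum_subtractf)+

lemma ftens_0: "ftens 0 r = 0" "ftens p 0 = 0"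
  by (rule fps_ext; simp add: ftens_def tens_simps)+

lemma ftens_X: "ftens (fps_X ^ n) 1 = fps_X ^ n" "ftens 1 (fps_X ^ n) = fps_X ^ n"
  by (rule fps_ext; simp add: ftens_1_nth tens_1 tens_simps)+

lemma ftens_Uh_ideal:
  assumes "p \<in> Uh_ideal"
  shows "ftens p 1 \<in> Uh2_ideal" "ftens 1 p \<in> Uh2_ideal"
proof -
  let ?R = "(\<lambda>r. ftens r 1) ` Uh_rels \<union> (\<lambda>r. ftens 1 r) ` Uh_rels"
  have *: "ftens s 1 \<in> ideal_gen ?R \<and> ftens 1 s \<in> ideal_gen ?R" if "s \<in> ideal_gen Uh_rels" for s
    using that
  proof induction
    case zero
    show ?case by (simp add: ftens_0 ideal_gen.zero)
  next
    case (gen r a b)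
    then show ?case by (auto simp: ftens_1_mult intro!: ideal_gen.gen)
  next
    case (add x y)
    then show ?case by (simp add: ftens_add ideal_gen.add)
  qed
  have "\<exists>s\<in>ideal_gen ?R. \<exists>y. ftens p 1 - s = fps_X ^ n * y"
    "\<exists>s\<in>ideal_gen ?R. \<exists>y. ftens 1 p - s = fps_X ^ n * y" for n
  proof -
    obtain s y where s: "s \<in> ideal_gen Uh_rels" and "p - s = fps_X ^ n * y"
      using assms unfolding Uh_ideal_def adic_closure_def by blast
    then have "ftens p 1 - ftens s 1 = fps_X ^ n * ftens y 1"
      "ftens 1 p - ftens 1 s = fps_X ^ n * ftens 1 y"
      by (metis ftens_diff ftens_1_mult ftens_X)+
    then show "\<exists>s\<in>ideal_gen ?R. \<exists>y. ftens p 1 - s = fps_X ^ n * y"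
      "\<exists>s\<in>ideal_gen ?R. \<exists>y. ftens 1 p - s = fps_X ^ n * y"
      using *[OF s] by blast+
  qed
  then show "ftens p 1 \<in> Uh2_ideal" "ftens 1 p \<in> Uh2_ideal"
    unfolding Uh2_ideal_def adic_closure_def by blast+
qed

lift_definition tensor_Uh :: "Uh \<Rightarrow> Uh \<Rightarrow> Uh2" is ftens
proof -
  interpret two_sided_ideal Uh2_ideal by (rule two_sided_ideal_Uh2)
  fix p p' r r' assume "p - p' \<in> Uh_ideal" "r - r' \<in> Uh_ideal"
  then have "ftens p 1 - ftens p' 1 \<in> Uh2_ideal" "ftens 1 r - ftens 1 r' \<in> Uh2_ideal"
    using ftens_Uh_ideal by (simp_all flip: ftens_diff)
  then show "ftens p r - ftens p' r' \<in> Uh2_ideal"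
    unfolding ftens_split[of p r] ftens_split[of p' r'] by (rule cong_mult)
qed

text \<open>The comultiplication, first on letters, then extended multiplicatively to words, linearly to the
  free algebra and continuously to power series. The images of \<open>H\<^sub>i\<close> are the logarithmic form of
  \<open>\<Delta>(K\<^sub>i) = K\<^sub>i \<otimes> K\<^sub>i\<close>.\<close>

fun comult_letter :: "letter \<Rightarrow> free2 fps" where
  "comult_letter (XP i) = ftens (flt (XP i)) (fK i) + ftens 1 (flt (XP i))"
| "comult_letter (XM i) = ftens (flt (XM i)) 1 + ftens (fKinv i) (flt (XM i))"
| "comult_letter (HH i) = ftens (flt (HH i)) 1 + ftens 1 (flt (HH i))"

fun comult_word :: "word \<Rightarrow> free2 fps" where
  "comult_word (Word gs) = prod_list (map comult_letter gs)"

definition comult_free :: "free \<Rightarrow> free2 fps" where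
  "comult_free a =
     (\<Sum>w\<in>Poly_Mapping.keys a. fps_const (cst (Poly_Mapping.lookup a w)) * comult_word w)"

definition comult_series :: "free fps \<Rightarrow> free2 fps" where
  "comult_series p = Abs_fps (\<lambda>n. \<Sum>k\<le>n. fps_nth (comult_free (fps_nth p k)) (n - k))"

text \<open>The relations are compatible with these formulas (\<open>comult_series\<close> maps \<open>Uh_ideal\<close> into
  \<open>Uh2_ideal\<close>), so the class does not depend on the representative chosen by \<open>rep_Uh\<close>. This
  standard fact is not proved here.\<close>

definition comult :: "Uh \<Rightarrow> Uh2" where
  "comult u = abs_Uh2 (comult_series (rep_Uh u))"


section \<open>The classical enveloping algebra and the Lie bialgebra\<close>

text \<open>The Chevalley--Serre presentation.\<close>

inductive_set U_rels :: "free set" where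
  "commutator (lt (HH i)) (lt (HH j)) \<in> U_rels"
| "commutator (lt (HH i)) (lt (XP j)) - of_int (cartan i j) * lt (XP j) \<in> U_rels"
| "commutator (lt (HH i)) (lt (XM j)) + of_int (cartan i j) * lt (XM j) \<in> U_rels"
| "commutator (lt (XP i)) (lt (XM j)) - (if i = j then lt (HH i) else 0) \<in> U_rels"
| "i \<noteq> j \<Longrightarrow> (commutator (lt (XP i)) ^^ nat (1 - cartan i j)) (lt (XP j)) \<in> U_rels"
| "i \<noteq> j \<Longrightarrow> (commutator (lt (XM i)) ^^ nat (1 - cartan i j)) (lt (XM j)) \<in> U_rels"

definition U_ideal :: "free set" where
  "U_ideal = ideal_gen U_rels"

definition U2_ideal :: "free2 set" where
  "U2_ideal = ideal_gen ((\<lambda>r. tens r 1) ` U_rels \<union> (\<lambda>r. tens 1 r) ` U_rels)"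

lemma two_sided_ideal_U: "two_sided_ideal U_ideal"
  unfolding U_ideal_def by (rule two_sided_ideal_ideal_gen)

lemma two_sided_ideal_U2: "two_sided_ideal U2_ideal"
  unfolding U2_ideal_def by (rule two_sided_ideal_ideal_gen)

text \<open>\<open>Ug\<close> is \<open>U(\<gg>)\<close> and \<open>Ug2\<close> is \<open>U(\<gg>) \<otimes> U(\<gg>)\<close>.\<close>

quotient_type Ug = "free" / "\<lambda>x y. x - y \<in> U_ideal"
  by (rule two_sided_ideal.cong_equivp[OF two_sided_ideal_U])

instantiation Ug :: "{ring,monoid_mult}"
begin

lift_definition zero_Ug :: Ug is 0 .
lift_definition one_Ug :: Ug is 1 .
lift_definition plus_Ug :: "Ug \<Rightarrow> Ug \<Rightarrow> Ug" is "(+)"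
  by (rule two_sided_ideal.cong_add[OF two_sided_ideal_U])
lift_definition minus_Ug :: "Ug \<Rightarrow> Ug \<Rightarrow> Ug" is "(-)"
  by (rule two_sided_ideal.cong_diff[OF two_sided_ideal_U])
lift_definition uminus_Ug :: "Ug \<Rightarrow> Ug" is uminus
  by (rule two_sided_ideal.cong_minus[OF two_sided_ideal_U])
lift_definition times_Ug :: "Ug \<Rightarrow> Ug \<Rightarrow> Ug" is "(*)"
  by (rule two_sided_ideal.cong_mult[OF two_sided_ideal_U])

instance
  by standard
    (transfer; simp add: algebra_simps two_sided_ideal.zero_mem[OF two_sided_ideal_U])+

end

quotient_type Ug2 = "free2" / "\<lambda>x y. x - y \<in> U2_ideal"
  by (rule two_sided_ideal.cong_equivp[OF two_sided_ideal_U2])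

instantiation Ug2 :: "{ring,monoid_mult}"
begin

lift_definition zero_Ug2 :: Ug2 is 0 .
lift_definition one_Ug2 :: Ug2 is 1 .
lift_definition plus_Ug2 :: "Ug2 \<Rightarrow> Ug2 \<Rightarrow> Ug2" is "(+)"
  by (rule two_sided_ideal.cong_add[OF two_sided_ideal_U2])
lift_definition minus_Ug2 :: "Ug2 \<Rightarrow> Ug2 \<Rightarrow> Ug2" is "(-)"
  by (rule two_sided_ideal.cong_diff[OF two_sided_ideal_U2])
lift_definition uminus_Ug2 :: "Ug2 \<Rightarrow> Ug2" is uminus
  by (rule two_sided_ideal.cong_minus[OF two_sided_ideal_U2])
lift_definition times_Ug2 :: "Ug2 \<Rightarrow> Ug2 \<Rightarrow> Ug2" is "(*)"
  by (rule two_sided_ideal.cong_mult[OF two_sided_ideal_U2])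

instance
  by standard
    (transfer; simp add: algebra_simps two_sided_ideal.zero_mem[OF two_sided_ideal_U2])+

end

lemma tens_U_ideal:
  assumes "p \<in> U_ideal"
  shows "tens p 1 \<in> U2_ideal" "tens 1 p \<in> U2_ideal"
proof -
  let ?R = "(\<lambda>r. tens r 1) ` U_rels \<union> (\<lambda>r. tens 1 r) ` U_rels"
  have *: "tens (a * b) 1 = tens a 1 * tens b 1" "tens 1 (a * b) = tens 1 a * tens 1 b" for a b
    using tens_mult[of a b 1 1] tens_mult[of 1 1 a b] by simp_all
  have "tens p 1 \<in> ideal_gen ?R \<and> tens 1 p \<in> ideal_gen ?R"
    using assms unfolding U_ideal_def
  proof induction
    case (gen r a b)
    then show ?case by (auto simp: * intro!: ideal_gen.gen)
  qed (simp_all add: tens_simps ideal_gen.zero ideal_gen.add)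
  then show "tens p 1 \<in> U2_ideal" "tens 1 p \<in> U2_ideal"
    by (simp_all add: U2_ideal_def)
qed

lift_definition tensor_Ug :: "Ug \<Rightarrow> Ug \<Rightarrow> Ug2" is tens
proof -
  interpret two_sided_ideal U2_ideal by (rule two_sided_ideal_U2)
  have split: "tens a b = tens a 1 * tens 1 b" for a b
    using tens_mult[of a 1 1 b] by simp
  fix p p' r r' assume "p - p' \<in> U_ideal" "r - r' \<in> U_ideal"
  then have "tens p 1 - tens p' 1 \<in> U2_ideal" "tens 1 r - tens 1 r' \<in> U2_ideal"
    using tens_U_ideal by (simp_all flip: tens_diff)
  then show "tens p r - tens p' r' \<in> U2_ideal"
    unfolding split[of p r] split[of p' r'] by (rule cong_mult)
qed

definition scale_Ug :: "complex \<Rightarrow> Ug \<Rightarrow> Ug" where "scale_Ug c u = abs_Ug (cst c) * u"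

definition scale_Ug2 :: "complex \<Rightarrow> Ug2 \<Rightarrow> Ug2" where "scale_Ug2 c u = abs_Ug2 (cst c) * u"

lemma cst_simps: "cst (a + b) = cst a + cst b" "cst (a * b) = cst a * cst b"
  by (simp_all add: single_add mult_single)

global_interpretation Ug: vector_space scale_Ug
  by standard
    (simp_all add: scale_Ug_def cst_simps algebra_simps
      flip: one_Ug_def plus_Ug.abs_eq times_Ug.abs_eq)

global_interpretation Ug2: vector_space scale_Ug2
  by standard
    (simp_all add: scale_Ug2_def cst_simps algebra_simps
      flip: one_Ug2_def plus_Ug2.abs_eq times_Ug2.abs_eq)

definition Ug_e :: "node \<Rightarrow> Ug" where "Ug_e i = abs_Ug (lt (XP i))"

definition Ug_f :: "node \<Rightarrow> Ug" where "Ug_f i = abs_Ug (lt (XM i))"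

definition Ug_coroot :: "node \<Rightarrow> Ug" where "Ug_coroot i = abs_Ug (lt (HH i))"

text \<open>\<open>d\<^sub>i\<close> times the coroot: the classical counterpart \<open>h\<^sub>i\<close> of \<open>K\<^sub>i = e\<^bsup>h d\<^sub>i H\<^sub>i\<^esup>\<close>, with
  \<open>[h\<^sub>i, e\<^sub>j] = d\<^sub>i a\<^sub>i\<^sub>j e\<^sub>j\<close>. In this normalization \<open>h\<^sub>1 + h\<^sub>2\<close> is the element of the Cartan
  subalgebra dual to the root \<open>\<alpha>\<^sub>1 + \<alpha>\<^sub>2\<close> and \<open>K\<^sub>1 K\<^sub>2 = e\<^bsup>h (h\<^sub>1 + h\<^sub>2)\<^esup>\<close>.\<close>

definition Ug_h :: "node \<Rightarrow> Ug" where "Ug_h i = scale_Ug (of_nat (symm i)) (Ug_coroot i)"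

text \<open>\<open>\<gg>\<close>, as the Lie subalgebra of \<open>U(\<gg>)\<close> generated by the Chevalley generators.\<close>

inductive_set gg :: "Ug set" where
  "Ug_e i \<in> gg"
| "Ug_f i \<in> gg"
| "Ug_coroot i \<in> gg"
| "0 \<in> gg"
| "x \<in> gg \<Longrightarrow> y \<in> gg \<Longrightarrow> x + y \<in> gg"
| "x \<in> gg \<Longrightarrow> scale_Ug c x \<in> gg"
| "x \<in> gg \<Longrightarrow> y \<in> gg \<Longrightarrow> commutator x y \<in> gg"

definition trace_on :: "Ug set \<Rightarrow> (Ug \<Rightarrow> Ug) \<Rightarrow> complex" where
  "trace_on V \<phi> =
     (let B = (SOME B. Ug.independent B \<and> Ug.span B = V)
      in \<Sum>b\<in>B. Ug.representation B (\<phi> b) b)"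

definition killing :: "Ug \<Rightarrow> Ug \<Rightarrow> complex" where
  "killing x y = trace_on gg (\<lambda>z. commutator x (commutator y z))"

text \<open>Roots are written in the basis of simple roots: \<open>\<beta>\<close> stands for \<open>\<beta> Node1 \<alpha>\<^sub>1 + \<beta> Node2 \<alpha>\<^sub>2\<close>.\<close>

definition root_space :: "(node \<Rightarrow> int) \<Rightarrow> Ug set" where
  "root_space \<beta> = {x \<in> gg. \<forall>i. commutator (Ug_coroot i) x =
     scale_Ug (of_int (\<beta> Node1 * cartan i Node1 + \<beta> Node2 * cartan i Node2)) x}"

definition positive_roots :: "(node \<Rightarrow> int) set" where
  "positive_roots = {\<beta>. \<beta> \<noteq> (\<lambda>_. 0) \<and> (\<forall>i. 0 \<le> \<beta> i) \<and> (\<exists>x\<in>root_space \<beta>. x \<noteq> 0)}"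

definition root_vector :: "(node \<Rightarrow> int) \<Rightarrow> Ug" where
  "root_vector \<beta> = (SOME x. x \<in> root_space \<beta> \<and> x \<noteq> 0)"

definition wedge :: "Ug \<Rightarrow> Ug \<Rightarrow> Ug2" where
  "wedge x y = tensor_Ug x y - tensor_Ug y x"

text \<open>The standard \<open>r\<close>-matrix; it does not depend on the choice of root vectors, since root spaces
  are lines.\<close>

definition r_matrix :: Ug2 where
  "r_matrix = (\<Sum>\<beta>\<in>positive_roots.
     let x = root_vector \<beta>; y = root_vector (\<lambda>i. - \<beta> i)
     in scale_Ug2 (1 / killing x y) (wedge x y))"

definition cobracket :: "Ug \<Rightarrow> Ug2" where
  "cobracket x = commutator (tensor_Ug x 1 + tensor_Ug 1 x) r_matrix"

definition lie_subalgebra :: "Ug set \<Rightarrow> bool" where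
  "lie_subalgebra \<hh> \<longleftrightarrow> Ug.subspace \<hh> \<and> \<hh> \<subseteq> gg \<and> (\<forall>x\<in>\<hh>. \<forall>y\<in>\<hh>. commutator x y \<in> \<hh>)"

definition coisotropic :: "Ug set \<Rightarrow> bool" where
  "coisotropic \<hh> \<longleftrightarrow> lie_subalgebra \<hh> \<and>
     cobracket ` \<hh> \<subseteq> Ug2.span {wedge x y | x y. x \<in> \<hh> \<and> y \<in> gg}"

text \<open>\<open>U(\<hh>)\<close>, as a subalgebra of \<open>U(\<gg>)\<close>.\<close>

definition env :: "Ug set \<Rightarrow> Ug set" where
  "env \<hh> = ring_hull (range (\<lambda>c. scale_Ug c 1) \<union> \<hh>)"


section \<open>Quantizations of coisotropic subalgebras\<close>

lemma qdiff_nth: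
  "fps_nth (qpow k - qpow (- k)) 0 = 0" "fps_nth (qpow k - qpow (- k)) 1 = 2 * of_int k"
  by (simp_all add: qpow_def fps_exp_def)

lemma qint_0:
  assumes "d > 0"
  shows "fps_nth (qint d m) 0 = of_nat m"
proof -
  have sd: "subdegree (qpow (int d) - qpow (- int d)) = 1"
    using assms qdiff_nth[of "int d"] by (intro subdegreeI) (auto simp del: fps_sub_nth)
  have "fps_nth (qint d m) 0 =
      fps_nth (qpow (int (d * m)) - qpow (- int (d * m))) 1 * inverse (2 * of_nat d)"
    unfolding qint_def fps_divide_def fps_shift_nth sd
    using qdiff_nth[of "int d"] qdiff_nth[of "int (d * m)"] sd
    by (simp add: fps_mult_nth_1 del: fps_sub_nth)
  then show ?thesis using assms qdiff_nth[of "int (d * m)"] by (simp add: field_simps del: fps_sub_nth)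
qed

lemma qbinom_0:
  assumes "d > 0" "r \<le> m"
  shows "fps_nth (qbinom d m r) 0 = of_nat (m choose r)"
proof -
  have *: "fps_nth (\<Prod>j=1..k. qint d j) 0 = fact k" for k
    by (induction k) (simp_all add: qint_0 assms)
  have "fps_nth (qbinom d m r) 0 = fact m / (fact r * fact (m - r))"
    unfolding qbinom_def using * by (subst fps_divide_nth_0) simp_all
  then show ?thesis using assms by (simp add: binomial_fact)
qed

lemma fps_nth_power_0_free: "fps_nth (x ^ n) 0 = fps_nth x 0 ^ n" for x :: "free fps"
  by (induction n) simp_all

lemma serre_0:
  assumes "i \<noteq> j"
  shows "fps_nth (serre i j (fps_const a) (fps_const b)) 0
    = (commutator a ^^ nat (1 - cartan i j)) b"
proof -
  define m where "m = nat (1 - cartan i j)"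
  have d: "symm i > 0" by (cases i) simp_all
  have coeff: "fps_nth (scal ((-1) ^ r * qbinom (symm i) m r)) 0 = cst ((-1) ^ r * of_nat (m choose r))"
    if "r \<le> m" for r
  proof -
    have "fps_nth ((-1) ^ r :: complex fps) 0 = (-1) ^ r" by (induction r) simp_all
    then show ?thesis by (simp only: scal_def fps_nth_Abs_fps fps_mult_nth_0 qbinom_0[OF d that])
  qed
  have "fps_nth (serre i j (fps_const a) (fps_const b)) 0
    = (\<Sum>r\<le>m. cst ((-1) ^ r * of_nat (m choose r)) * a ^ (m - r) * b * a ^ r)"
    unfolding serre_def Let_def m_def[symmetric] fps_sum_nth
    by (rule sum.cong) (simp_all only: fps_mult_nth_0 coeff atMost_iff fps_nth_power_0_free
      fps_nth_fps_const simp_thms if_True)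
  also have "\<dots> = (commutator a ^^ m) b"
  proof -
    consider "m = 2" | "m = 4" using assms unfolding m_def by (cases i; cases j) auto
    then show ?thesis
    proof cases
      case 1
      have "{..2::nat} = {0, 1, 2}" by auto
      then have sum: "(\<Sum>r\<le>2. cst ((-1) ^ r * of_nat (2 choose r)) * a ^ (2 - r) * b * a ^ r)
          = a * a * b + cst (- 2) * a * b * a + b * a * a"
        by (simp add: power2_eq_square mult.assoc)
      have c: "cst (- 2) = (- 2 :: free)" by (simp flip: single_uminus single_numeral)
      have ad: "(commutator a ^^ 2) b = commutator a (commutator a b)"
        by (simp add: numeral_2_eq_2)
      show ?thesis unfolding 1 sum c ad commutator_def by (simp add: mult_2 algebra_simps)
    next
      case 2
      have "{..4::nat} = {0, 1, 2, 3, 4}" by auto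
      moreover have "4 choose 2 = (6::nat)" "4 choose 3 = (4::nat)" by (simp_all add: eval_nat_numeral)
      ultimately have sum: "(\<Sum>r\<le>4. cst ((-1) ^ r * of_nat (4 choose r)) * a ^ (4 - r) * b * a ^ r)
          = a * a * a * a * b + cst (- 4) * a * a * a * b * a + cst 6 * a * a * b * a * a
            + cst (- 4) * a * b * a * a * a + b * a * a * a * a"
        by (simp add: power2_eq_square power3_eq_cube power4_eq_xxxx mult.assoc)
      have c: "cst (- 4) = (- 4 :: free)" "cst 6 = (6 :: free)"
        by (simp_all flip: single_uminus single_numeral)
      have ad: "(commutator a ^^ 4) b = commutator a (commutator a (commutator a (commutator a b)))"
        by (simp add: eval_nat_numeral)
      have "(4 :: free) = 1 + 1 + 1 + 1" "(6 :: free) = 1 + 1 + 1 + 1 + 1 + 1" by simp_all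
      then have num: "4 * x = x + x + x + x" "6 * x = x + x + x + x + x + x" for x :: free
        by (simp_all only: distrib_right mult_1_left)
      show ?thesis unfolding 2 sum c ad commutator_def by (simp add: num algebra_simps)
    qed
  qed
  finally show ?thesis unfolding m_def .
qed

lemma fKquot_0: "fps_nth (fKquot i) 0 = lt (HH i)"
proof -
  define d where "d = symm i"
  have d: "d > 0" unfolding d_def by (cases i) simp_all
  have "fps_nth (fK i - fKinv i) 1 = (cst (of_nat d) + cst (of_nat d)) * lt (HH i)"
    unfolding distrib_right by (simp add: fK_def fKinv_def hexp_def d_def)
  then have "fps_nth (fK i - fKinv i) 1 = cst (2 * of_nat d) * lt (HH i)"
    by (simp only: single_add[symmetric] mult_2)
  moreover have "fps_nth (inverse (fps_shift 1 (qpow (int d) - qpow (- int d)))) 0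
      = inverse (2 * of_nat d)"
    using qdiff_nth(2)[of "int d"] by (simp del: fps_sub_nth)
  moreover have "fps_nth (fKquot i) 0 =
      cst (fps_nth (inverse (fps_shift 1 (qpow (int d) - qpow (- int d)))) 0) * fps_nth (fK i - fKinv i) 1"
    unfolding fKquot_def scal_def d_def[symmetric] fps_mult_nth_0 fps_nth_Abs_fps fps_shift_nth by simp
  ultimately have "fps_nth (fKquot i) 0 = cst (inverse (2 * of_nat d)) * (cst (2 * of_nat d) * lt (HH i))"
    by (simp only:)
  also have "\<dots> = lt (HH i)" using d by (simp flip: mult.assoc add: mult_single)
  finally show ?thesis .
qed

lemma Uh_rels_0:
  assumes "r \<in> Uh_rels"
  shows "fps_nth r 0 \<in> U_rels"
proof -
  have if0: "fps_nth (if P then x else 0) 0 = (if P then fps_nth x 0 else 0)" for P and x :: "free fps"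
    by simp
  have int0: "fps_nth (of_int k :: free fps) 0 = of_int k" for k
    by (simp add: fps_of_int[symmetric])
  have comm0: "fps_nth (commutator x y) 0 = commutator (fps_nth x 0) (fps_nth y 0)" for x y :: "free fps"
    by (simp add: commutator_def)
  show ?thesis
    using assms by cases (simp_all only: serre_0 U_rels.intros comm0 int0 if0 fKquot_0
        fps_sub_nth fps_add_nth fps_mult_nth_0 fps_nth_fps_const if_True simp_thms)
qed

text \<open>\<open>\<pi>\<^bsub>U\<^sub>h\<^esub>\<close>.\<close>

lift_definition specialization :: "Uh \<Rightarrow> Ug" is "\<lambda>p. fps_nth p 0"
proof -
  have *: "fps_nth s 0 \<in> U_ideal" if "s \<in> ideal_gen Uh_rels" for s
    using that
  proof induction
    case (gen r a b)
    then show ?case unfolding U_ideal_def by (simp add: ideal_gen.gen Uh_rels_0)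
  qed (simp_all add: U_ideal_def ideal_gen.zero ideal_gen.add)
  fix p p' :: "free fps" assume "p - p' \<in> Uh_ideal"
  then obtain s y where "s \<in> ideal_gen Uh_rels" "(p - p') - s = fps_X ^ 1 * y"
    unfolding Uh_ideal_def adic_closure_def by blast
  moreover from this(2) have "fps_nth (p - p' - s) 0 = 0" by (simp only:) simp
  then have "fps_nth p 0 - fps_nth p' 0 = fps_nth s 0" by simp
  ultimately show "fps_nth p 0 - fps_nth p' 0 \<in> U_ideal" using * by simp
qed

text \<open>Subalgebras and tensor products are understood in the topological (\<open>h\<close>-adically closed) sense.\<close>

definition subalgebra_Uh :: "Uh set \<Rightarrow> bool" where
  "subalgebra_Uh B \<longleftrightarrow> range Uh_scal \<subseteq> B \<and>
     (\<forall>x\<in>B. \<forall>y\<in>B. x + y \<in> B \<and> x * y \<in> B) \<and> adic_closure Uh_h B = B"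

definition generated_Uh :: "Uh set \<Rightarrow> Uh set" where
  "generated_Uh S = adic_closure Uh_h (ring_hull (range Uh_scal \<union> S))"

definition tensor_closure :: "Uh set \<Rightarrow> Uh set \<Rightarrow> Uh2 set" where
  "tensor_closure A B =
     adic_closure Uh2_h (additive_hull {tensor_Uh a b | a b. a \<in> A \<and> b \<in> B})"

definition left_coideal :: "Uh set \<Rightarrow> bool" where
  "left_coideal B \<longleftrightarrow> comult ` B \<subseteq> tensor_closure B UNIV"

definition right_coideal :: "Uh set \<Rightarrow> bool" where
  "right_coideal B \<longleftrightarrow> comult ` B \<subseteq> tensor_closure UNIV B"

definition is_quantization :: "Uh set \<Rightarrow> Ug set \<Rightarrow> bool" where
  "is_quantization B \<hh> \<longleftrightarrow>
     coisotropic \<hh> \<and>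
     subalgebra_Uh B \<and>
     (left_coideal B \<or> right_coideal B) \<and>
     {b \<in> B. specialization b = 0} = (\<lambda>b. Uh_h * b) ` B \<and>
     specialization ` B = env \<hh>"

text \<open>\<open>d\<^sub>i H\<^sub>i\<close>, that is \<open>h\<^sup>-\<^sup>1 log K\<^sub>i\<close>. In \<open>U\<^sub>h(\<gg>)\<close> a torus
  element enters a set of generators through this logarithm: \<open>K\<^sub>i\<close> is a convergent power series in
  it, whereas \<open>K\<^sub>i\<close> alone specializes to \<open>1\<close> and generates a subalgebra that does not
  contain \<open>(K\<^sub>i - 1) / h\<close>.\<close>

definition Uh_logK :: "node \<Rightarrow> Uh" where
  "Uh_logK i = Uh_scal (of_nat (symm i)) * Uh_H i"

end

theory Submission
  imports Defs "HOL-Computational_Algebra.Polynomial"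
begin

text \<open>Put \<open>T = d\<^sub>1H\<^sub>1 + d\<^sub>2H\<^sub>2\<close>. The commutation relations among \<open>T\<close>, \<open>E\<^sub>1\<close>, \<open>Y\<close>, \<open>X\<close> show that their
  ordered monomials span \<open>B\<close> topologically. At \<open>h = 0\<close> these monomials are independent: let them act
  on the lowest weight vectors of the tensor powers of the seven-dimensional representation; the
  states with the largest number of excited factors determine the exponents of the root vectors, and
  varying the length of the tensor power determines that of \<open>T\<close>. The same representations,
  quantized, let one read off divisibility by powers of \<open>h\<close> in \<open>U\<^sub>h(\<gg>)\<close>, whence
  \<open>B \<inter> hU\<^sub>h(\<gg>) = hB\<close>. The coproducts of the generators make \<open>B\<close> a left coideal. Coisotropy of \<open>\<hh>\<close>
  is a computation with the cocycle \<open>\<delta>\<close>, whose values on the Chevalley generators follow from the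
  invariance of the Killing form.\<close>

text \<open>U_h is given only as an h-adically closed quotient of a free algebra. So no PBW basis
  and no torsion-freeness is at hand, and not even the nonvanishing of a generator: whatever has to
  be nonzero or independent is detected in representations, and h is cancelled only in power series
  with operator coefficients. In U_h itself, an equality such as b = h u comes from separatedness.
  The comultiplication and the representations rest on one algebraic fact: if two commuting families
  of elements satisfy the relations, then so do the combinations prescribed by Delta. Tensor
  products, iterated tensor powers and the well-definedness of Delta all follow from it. The
  exponents 3, -1, 1 in X and Y are not arbitrary. The quartic Serre element is an iterated
  q-commutator, and X, Y are its intermediate stages. With Delta(E_i) = E_i \<otimes> K_i + 1
  \<otimes> E_i, these exponents cancel exactly the cross terms of Delta(X) with E_2 or [E_1,E_2] in
  the left factor, which is why B is a left coideal.\<close>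

section \<open>Adic closures, limits and separatedness\<close>

lemma adic_closureI:
  assumes "\<And>n. \<exists>s\<in>S. \<exists>y. x - s = t ^ n * y"
  shows "x \<in> adic_closure t S"
  using assms unfolding adic_closure_def by blast

lemma adic_closureE:
  assumes "x \<in> adic_closure t S"
  obtains s y where "s \<in> S" "x = s + t ^ n * y"
proof -
  obtain s y where "s \<in> S" "x - s = t ^ n * y" using assms unfolding adic_closure_def by blast
  then have "x = s + t ^ n * y" by (simp add: algebra_simps)
  then show ?thesis using that \<open>s \<in> S\<close> by blast
qed

lemma subset_adic_closure: "S \<subseteq> adic_closure t S"
  by (auto intro!: adic_closureI bexI exI[of _ 0])

lemma adic_closure_mono: "S \<subseteq> S' \<Longrightarrow> adic_closure t S \<subseteq> adic_closure t S'"
  unfolding adic_closure_def by blast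

lemma adic_closure_idem: "adic_closure t (adic_closure t S) = adic_closure t S"
proof (rule antisym[OF subsetI subset_adic_closure])
  fix x assume x: "x \<in> adic_closure t (adic_closure t S)"
  show "x \<in> adic_closure t S"
  proof (rule adic_closureI)
    fix n
    obtain s y where s: "s \<in> adic_closure t S" "x = s + t ^ n * y" by (rule adic_closureE[OF x])
    obtain s' y' where "s' \<in> S" "s = s' + t ^ n * y'" by (rule adic_closureE[OF s(1)])
    then have "s' \<in> S \<and> x - s' = t ^ n * (y + y')" using s(2) by (simp add: algebra_simps)
    then show "\<exists>s\<in>S. \<exists>y. x - s = t ^ n * y" by blast
  qed
qed

lemma central_power:
  fixes t :: "'a::monoid_mult"
  assumes "\<And>a. t * a = a * t"
  shows "t ^ n * a = a * t ^ n"
  by (induction n) (simp, metis assms mult.assoc power_Suc)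

lemma adic_closure_diff:
  assumes "\<And>x y. x \<in> S \<Longrightarrow> y \<in> S \<Longrightarrow> x - y \<in> S"
    and "x \<in> adic_closure t S" "y \<in> adic_closure t S"
  shows "x - y \<in> adic_closure t S"
proof (rule adic_closureI)
  fix n
  obtain s u where s: "s \<in> S" "x = s + t ^ n * u" by (rule adic_closureE[OF assms(2)])
  obtain s' u' where s': "s' \<in> S" "y = s' + t ^ n * u'" by (rule adic_closureE[OF assms(3)])
  have "(x - y) - (s - s') = t ^ n * (u - u')" using s s' by (simp add: algebra_simps)
  then show "\<exists>s\<in>S. \<exists>z. (x - y) - s = t ^ n * z" using assms(1) s s' by blast
qed

lemma adic_closure_mult:
  assumes central: "\<And>a. t * a = a * t"
    and S: "\<And>x y. x \<in> S \<Longrightarrow> y \<in> S' \<Longrightarrow> x * y \<in> S'"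
    and "x \<in> adic_closure t S" "y \<in> adic_closure t S'"
  shows "x * y \<in> adic_closure t S'"
proof (rule adic_closureI)
  fix n
  obtain s u where s: "s \<in> S" "x = s + t ^ n * u" by (rule adic_closureE[OF assms(3)])
  obtain s' u' where s': "s' \<in> S'" "y = s' + t ^ n * u'" by (rule adic_closureE[OF assms(4)])
  have "s * (t ^ n * u') = t ^ n * (s * u')"
    by (metis central_power[of t, OF central] mult.assoc)
  then have "x * y - s * s' = t ^ n * (s * u' + u * s' + u * (t ^ n * u'))"
    using s s' by (simp add: algebra_simps)
  then show "\<exists>s\<in>S'. \<exists>z. x * y - s = t ^ n * z" using S s s' by blast
qed

text \<open>The generators need only be limits of elements of S. This admits \<open>K_1 K_2\<close>,
  an infinite series in T, among the generators of B, while S is the span of finitely many monomials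
  at a time.\<close>

lemma subalgebra_of_closure_subset:
  assumes central: "\<And>a. t * a = a * t"
    and "s \<in> ring_hull G" and "G \<subseteq> adic_closure t S" and "1 \<in> S"
    and "\<And>x y. x \<in> S \<Longrightarrow> y \<in> S \<Longrightarrow> x - y \<in> S"
    and "\<And>x y. x \<in> S \<Longrightarrow> y \<in> S \<Longrightarrow> x * y \<in> S"
  shows "s \<in> adic_closure t S"
  using assms(2)
proof induction
  case (base s)
  then show ?case using assms by blast
next
  case one
  show ?case using assms(4) subset_adic_closure by blast
next
  case (diff x y)
  then show ?case using adic_closure_diff[of S] assms by blast
next
  case (mult x y)
  then show ?case using adic_closure_mult[of t S S] assms by blast
qed

lemma closure_ring_hull_props:
  assumes central: "\<And>a. t * a = a * t"
    and "x \<in> adic_closure t (ring_hull G)" "y \<in> adic_closure t (ring_hull G)"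
  shows "x - y \<in> adic_closure t (ring_hull G)" "x * y \<in> adic_closure t (ring_hull G)"
  using adic_closure_diff[OF ring_hull.diff assms(2,3)]
    adic_closure_mult[OF central ring_hull.mult assms(2,3)] by auto

text \<open>Separatedness of the quotient by a closed ideal is idempotence of the closure.\<close>

lemma quotient_separated:
  assumes "\<And>n. \<exists>y. p - fps_X ^ n * y \<in> adic_closure fps_X I"
  shows "p \<in> adic_closure fps_X I"
proof -
  have "p \<in> adic_closure fps_X (adic_closure fps_X I)"
  proof (rule adic_closureI)
    fix n
    obtain y where y: "p - fps_X ^ n * y \<in> adic_closure fps_X I" using assms by blast
    show "\<exists>s\<in>adic_closure fps_X I. \<exists>z. p - s = fps_X ^ n * z"
      by (rule bexI[OF _ y]) (rule exI[of _ y], simp)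
  qed
  then show ?thesis by (simp add: adic_closure_idem)
qed

text \<open>Completeness: only the terms with k \<le> m contribute to the coefficient of h^m in the
  sum of all h^k w_k, so that coefficient is a finite sum.\<close>

lemma fps_adic_limit:
  fixes w :: "nat \<Rightarrow> 'a::ring_1 fps"
  shows "\<exists>u. \<forall>n. \<exists>y. u - (\<Sum>k<n. fps_X ^ k * w k) = fps_X ^ n * y"
proof -
  define u where "u = Abs_fps (\<lambda>m. \<Sum>k\<le>m. fps_nth (w k) (m - k))"
  have "\<exists>y. u - (\<Sum>k<n. fps_X ^ k * w k) = fps_X ^ n * y" for n
  proof (induction n)
    case 0
    show ?case by simp
  next
    case (Suc n)
    define v where "v = fps_shift (Suc n) (u - (\<Sum>k<Suc n. fps_X ^ k * w k))"
    have "fps_nth (u - (\<Sum>k<Suc n. fps_X ^ k * w k)) m = 0" if "m < Suc n" for m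
    proof -
      have "fps_nth (\<Sum>k<Suc n. fps_X ^ k * w k) m = (\<Sum>k<Suc n. if k \<le> m then fps_nth (w k) (m - k) else 0)"
        by (simp only: fps_sum_nth fps_X_power_mult_nth) (auto intro!: sum.cong)
      also have "\<dots> = (\<Sum>k\<le>m. fps_nth (w k) (m - k))"
        using that by (intro sum.mono_neutral_cong_right) auto
      finally show ?thesis unfolding u_def by (simp del: sum.lessThan_Suc)
    qed
    then have "u - (\<Sum>k<Suc n. fps_X ^ k * w k) = fps_X ^ Suc n * v"
      unfolding v_def by (intro fps_ext) (simp add: fps_X_power_mult_nth del: sum.lessThan_Suc power_Suc)
    then show ?case by blast
  qed
  then show ?thesis by blast
qed

section \<open>The quotients as separated, complete rings\<close>

lemma abs_Uh_eq_iff: "abs_Uh p = abs_Uh r \<longleftrightarrow> p - r \<in> Uh_ideal"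
  by (rule Uh.abs_eq_iff)

lemma abs_Uh2_eq_iff: "abs_Uh2 p = abs_Uh2 r \<longleftrightarrow> p - r \<in> Uh2_ideal"
  by (rule Uh2.abs_eq_iff)

lemma abs_Uh_0_iff: "abs_Uh p = 0 \<longleftrightarrow> p \<in> Uh_ideal"
  using abs_Uh_eq_iff[of p 0] by (simp add: zero_Uh_def)

lemma abs_Uh2_0_iff: "abs_Uh2 p = 0 \<longleftrightarrow> p \<in> Uh2_ideal"
  using abs_Uh2_eq_iff[of p 0] by (simp add: zero_Uh2_def)

lemmas abs_Uh_hom = plus_Uh.abs_eq[symmetric] minus_Uh.abs_eq[symmetric] uminus_Uh.abs_eq[symmetric]
  times_Uh.abs_eq[symmetric] zero_Uh_def[symmetric] one_Uh_def[symmetric]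

lemmas abs_Uh2_hom = plus_Uh2.abs_eq[symmetric] minus_Uh2.abs_eq[symmetric] uminus_Uh2.abs_eq[symmetric]
  times_Uh2.abs_eq[symmetric] zero_Uh2_def[symmetric] one_Uh2_def[symmetric]

lemma abs_Uh_power: "abs_Uh (p ^ n) = abs_Uh p ^ n"
  by (induction n) (simp_all add: abs_Uh_hom)

lemma abs_Uh2_power: "abs_Uh2 (p ^ n) = abs_Uh2 p ^ n"
  by (induction n) (simp_all add: abs_Uh2_hom)

lemma abs_Uh_sum: "abs_Uh (sum f A) = (\<Sum>i\<in>A. abs_Uh (f i))"
  by (induction A rule: infinite_finite_induct) (simp_all add: abs_Uh_hom)

lemma Uh_h_central: "Uh_h * a = a * Uh_h"
  unfolding Uh_h_def by (induct a rule: Uh.abs_induct) (simp add: times_Uh.abs_eq fps_mult_fps_X_commute)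

lemma Uh2_h_central: "Uh2_h * a = a * Uh2_h"
  unfolding Uh2_h_def by (induct a rule: Uh2.abs_induct) (simp add: times_Uh2.abs_eq fps_mult_fps_X_commute)

lemma Uh_h_power_mult: "Uh_h ^ n * abs_Uh p = abs_Uh (fps_X ^ n * p)"
  by (simp add: Uh_h_def abs_Uh_hom abs_Uh_power)

lemma Uh2_h_power_mult: "Uh2_h ^ n * abs_Uh2 p = abs_Uh2 (fps_X ^ n * p)"
  by (simp add: Uh2_h_def abs_Uh2_hom abs_Uh2_power)

lemma Uh_cases:
  obtains p where "x = abs_Uh p"
  by (induct x rule: Uh.abs_induct) auto

lemma Uh2_cases:
  obtains p where "x = abs_Uh2 p"
  by (induct x rule: Uh2.abs_induct) auto

lemma Uh_separated:
  assumes "\<And>n. \<exists>y. x = Uh_h ^ n * y"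
  shows "x = 0"
proof -
  obtain p where p: "x = abs_Uh p" by (rule Uh_cases)
  have "\<exists>r. p - fps_X ^ n * r \<in> adic_closure fps_X (ideal_gen Uh_rels)" for n
  proof -
    obtain y where y: "x = Uh_h ^ n * y" using assms by blast
    obtain r where "y = abs_Uh r" by (rule Uh_cases)
    then have "p - fps_X ^ n * r \<in> Uh_ideal"
      using p y by (simp add: Uh_h_power_mult flip: abs_Uh_eq_iff)
    then show ?thesis by (auto simp: Uh_ideal_def)
  qed
  then have "p \<in> Uh_ideal" unfolding Uh_ideal_def by (rule quotient_separated)
  then show ?thesis using p abs_Uh_0_iff by simp
qed

lemma Uh2_separated:
  assumes "\<And>n. \<exists>y. x = Uh2_h ^ n * y"
  shows "x = 0"
proof -
  obtain p where p: "x = abs_Uh2 p" by (rule Uh2_cases)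
  have "\<exists>r. p - fps_X ^ n * r \<in> Uh2_ideal" for n
  proof -
    obtain y where y: "x = Uh2_h ^ n * y" using assms by blast
    obtain r where "y = abs_Uh2 r" by (rule Uh2_cases)
    then have "p - fps_X ^ n * r \<in> Uh2_ideal"
      using p y by (simp add: Uh2_h_power_mult flip: abs_Uh2_eq_iff)
    then show ?thesis by blast
  qed
  then have "p \<in> Uh2_ideal" unfolding Uh2_ideal_def by (rule quotient_separated)
  then show ?thesis using p abs_Uh2_0_iff by simp
qed

text \<open>Completeness descends to the quotient by choosing representatives of the w_k;
  separatedness later takes care of uniqueness.\<close>

lemma Uh_adic_limit:
  fixes w :: "nat \<Rightarrow> Uh"
  obtains u where "\<And>n. \<exists>y. u - (\<Sum>k<n. Uh_h ^ k * w k) = Uh_h ^ n * y"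
proof -
  define p where "p k = rep_Uh (w k)" for k
  have p: "w k = abs_Uh (p k)" for k
    unfolding p_def by (simp add: Quotient_abs_rep[OF Quotient_Uh])
  obtain u where u: "\<And>n. \<exists>y. u - (\<Sum>k<n. fps_X ^ k * p k) = fps_X ^ n * y"
    using fps_adic_limit[of p] by blast
  have "\<exists>y. abs_Uh u - (\<Sum>k<n. Uh_h ^ k * w k) = Uh_h ^ n * y" for n
  proof -
    obtain y where "u - (\<Sum>k<n. fps_X ^ k * p k) = fps_X ^ n * y" using u by blast
    then have "abs_Uh (u - (\<Sum>k<n. fps_X ^ k * p k)) = abs_Uh (fps_X ^ n * y)" by simp
    then have "abs_Uh u - (\<Sum>k<n. Uh_h ^ k * w k) = Uh_h ^ n * abs_Uh y"
      by (simp add: p Uh_h_power_mult minus_Uh.abs_eq flip: abs_Uh_sum)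
    then show ?thesis by blast
  qed
  then show ?thesis using that by blast
qed

section \<open>Homomorphisms out of the completed free algebra\<close>

text \<open>A common frame for the three complex algebras over which power series are taken: the
  free algebra, its tensor square, and the operators on tensor powers. \<open>\<kappa>\<close> is
  the structure map.\<close>

locale scalar_algebra =
  fixes \<kappa> :: "complex \<Rightarrow> 'a::ring_1"
  assumes \<kappa>_add: "\<kappa> (c + d) = \<kappa> c + \<kappa> d"
    and \<kappa>_mult: "\<kappa> (c * d) = \<kappa> c * \<kappa> d"
    and \<kappa>_1: "\<kappa> 1 = 1"
    and \<kappa>_central: "\<kappa> c * x = x * \<kappa> c"
begin

lemma \<kappa>_0: "\<kappa> 0 = 0"
  using \<kappa>_add[of 0 0] by simp

lemma \<kappa>_minus: "\<kappa> (- c) = - \<kappa> c"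
  using \<kappa>_add[of c "- c"] by (simp add: \<kappa>_0 eq_neg_iff_add_eq_0 add.commute)

lemma \<kappa>_diff: "\<kappa> (c - d) = \<kappa> c - \<kappa> d"
  using \<kappa>_add[of c "- d"] by (simp add: \<kappa>_minus)

lemma \<kappa>_sum: "\<kappa> (sum f A) = (\<Sum>i\<in>A. \<kappa> (f i))"
  by (induction A rule: infinite_finite_induct) (simp_all add: \<kappa>_0 \<kappa>_add)

lemma \<kappa>_of_nat: "\<kappa> (of_nat n) = of_nat n"
  by (induction n) (simp_all add: \<kappa>_0 \<kappa>_1 \<kappa>_add)

lemma \<kappa>_of_int: "\<kappa> (of_int n) = of_int n"
  by (cases n rule: int_cases2) (simp_all add: \<kappa>_of_nat \<kappa>_minus)

lemma \<kappa>_left_commute: "x * (\<kappa> c * y) = \<kappa> c * (x * y)"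
  by (metis \<kappa>_central mult.assoc)

lemma of_nat_left_commute: "x * (of_nat n * y) = of_nat n * (x * (y :: 'a))"
  using \<kappa>_left_commute[of x "of_nat n" y] by (simp add: \<kappa>_of_nat)

lemma \<kappa>_power: "\<kappa> (c ^ n) = \<kappa> c ^ n"
  by (induction n) (simp_all add: \<kappa>_1 \<kappa>_mult)

definition fscal :: "complex fps \<Rightarrow> 'a fps" where
  "fscal c = Abs_fps (\<lambda>n. \<kappa> (fps_nth c n))"

lemma fscal_nth: "fps_nth (fscal c) n = \<kappa> (fps_nth c n)"
  by (simp add: fscal_def)

lemma fscal_hom:
  "fscal (c + d) = fscal c + fscal d" "fscal (c - d) = fscal c - fscal d" "fscal (- c) = - fscal c"
  "fscal 1 = 1" "fscal 0 = 0" "fscal (c * d) = fscal c * fscal d"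
  by (rule fps_ext; simp add: fscal_nth \<kappa>_add \<kappa>_diff \<kappa>_minus \<kappa>_1 \<kappa>_0 fps_mult_nth \<kappa>_sum \<kappa>_mult)+

lemma fscal_central: "fscal c * x = x * fscal c"
proof (rule fps_ext)
  fix n
  have "fps_nth (fscal c * x) n = (\<Sum>i\<le>n. fps_nth x (n - i) * \<kappa> (fps_nth c i))"
    by (simp add: fps_mult_nth fscal_nth \<kappa>_central atLeast0AtMost)
  also have "\<dots> = (\<Sum>i\<le>n. fps_nth x i * \<kappa> (fps_nth c (n - i)))"
    by (rule sum.reindex_bij_witness[of _ "\<lambda>i. n - i" "\<lambda>i. n - i"]) auto
  finally show "fps_nth (fscal c * x) n = fps_nth (x * fscal c) n"
    by (simp add: fps_mult_nth fscal_nth atLeast0AtMost)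
qed

lemma fscal_const: "fscal (fps_const c) = fps_const (\<kappa> c)"
  by (rule fps_ext) (simp add: fscal_nth \<kappa>_0)

lemma fscal_X: "fscal fps_X = fps_X"
  by (rule fps_ext) (simp add: fscal_nth \<kappa>_0 \<kappa>_1 fps_X_def)

lemma fscal_left_commute: "x * (fscal c * y) = fscal c * (x * y)"
  using arg_cong[OF fscal_central[of c x], of "\<lambda>z. z * y"] by (simp only: mult.assoc)

lemma const_\<kappa>_left_commute: "x * (fps_const (\<kappa> c) * y) = fps_const (\<kappa> c) * (x * y)"
  unfolding fscal_const[symmetric] by (rule fscal_left_commute)

lemma X_power_left_commute: "x * (fps_X ^ n * y) = fps_X ^ n * (x * (y :: 'a fps))"
  using arg_cong[OF fps_mult_fps_X_power_commute[of n x], of "\<lambda>z. z * y"] by (simp only: mult.assoc)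

definition exph :: "'a \<Rightarrow> 'a fps" where
  "exph a = Abs_fps (\<lambda>n. \<kappa> (1 / fact n) * a ^ n)"

lemma exph_nth_Suc: "of_nat (Suc n) * fps_nth (exph a) (Suc n) = a * fps_nth (exph a) n"
proof -
  have "of_nat (Suc n) * fps_nth (exph a) (Suc n) = \<kappa> (of_nat (Suc n) * (1 / fact (Suc n))) * a ^ Suc n"
    unfolding exph_def fps_nth_Abs_fps by (simp only: \<kappa>_mult \<kappa>_of_nat mult.assoc)
  also have "of_nat (Suc n) * (1 / fact (Suc n)) = (1 / fact n :: complex)"
    by (simp add: field_simps del: of_nat_Suc)
  finally show ?thesis unfolding exph_def fps_nth_Abs_fps by (simp add: \<kappa>_left_commute)
qed

lemma exph_nth_0 [simp]: "fps_nth (exph a) 0 = 1"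
  by (simp add: exph_def \<kappa>_1)

lemma of_nat_cancel:
  assumes "of_nat (Suc n) * x = of_nat (Suc n) * (y :: 'a)"
  shows "x = y"
proof -
  have *: "\<kappa> (1 / of_nat (Suc n)) * (of_nat (Suc n) * z) = z" for z
  proof -
    have "\<kappa> (1 / of_nat (Suc n)) * (of_nat (Suc n) * z) = \<kappa> (1 / of_nat (Suc n) * of_nat (Suc n)) * z"
      by (simp only: \<kappa>_mult \<kappa>_of_nat mult.assoc)
    then show ?thesis by (simp add: \<kappa>_1 del: of_nat_Suc)
  qed
  have "\<kappa> (1 / of_nat (Suc n)) * (of_nat (Suc n) * x) = \<kappa> (1 / of_nat (Suc n)) * (of_nat (Suc n) * y)"
    by (simp only: assms)
  then show ?thesis by (simp only: *)
qed

text \<open>The recursion is the differential equation f' = a f; together with f(0) = 1 it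
  determines e^{ha}, so the exponential law becomes a comparison of recursions.\<close>

lemma exph_unique:
  assumes "fps_nth f 0 = 1" "\<And>n. of_nat (Suc n) * fps_nth f (Suc n) = a * fps_nth f n"
  shows "f = exph a"
proof (rule fps_ext)
  fix n
  show "fps_nth f n = fps_nth (exph a) n"
  proof (induction n)
    case (Suc n)
    then show ?case by - (rule of_nat_cancel[of n], simp only: assms(2) exph_nth_Suc)
  qed (simp add: assms(1))
qed

lemma exph_nth_commute:
  assumes "a * b = b * a"
  shows "b * fps_nth (exph a) n = fps_nth (exph a) n * b"
proof -
  have "b * a ^ n = a ^ n * b" using assms by (rule power_commuting_commutes[symmetric])
  then show ?thesis by (simp add: exph_def \<kappa>_left_commute mult.assoc)
qed

lemma exph_add:
  assumes ab: "a * b = b * a"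
  shows "exph (a + b) = exph a * exph b"
proof (rule exph_unique[symmetric])
  show "fps_nth (exph a * exph b) 0 = 1" by simp
  fix n
  let ?A = "fps_nth (exph a)" and ?B = "fps_nth (exph b)"
  \<comment> \<open>Product rule: n + 1 is split as i + (n + 1 - i), and each part is absorbed by
    the recursion of one factor.\<close>
  have "of_nat (Suc n) * fps_nth (exph a * exph b) (Suc n)
      = (\<Sum>i\<le>Suc n. (of_nat i + of_nat (Suc n - i)) * (?A i * ?B (Suc n - i)))"
    unfolding fps_mult_nth atLeast0AtMost sum_distrib_left
    by (rule sum.cong) (simp_all flip: of_nat_add del: of_nat_Suc)
  also have "\<dots> = (\<Sum>i\<le>Suc n. of_nat i * ?A i * ?B (Suc n - i))
      + (\<Sum>i\<le>Suc n. ?A i * (of_nat (Suc n - i) * ?B (Suc n - i)))"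
    unfolding sum.distrib[symmetric] distrib_right
    by (intro sum.cong refl arg_cong2[where f = "(+)"]) (simp_all only: mult.assoc of_nat_left_commute)
  also have "(\<Sum>i\<le>Suc n. of_nat i * ?A i * ?B (Suc n - i)) = (\<Sum>i\<le>n. a * ?A i * ?B (n - i))"
    unfolding sum.atMost_Suc_shift by (simp add: exph_nth_Suc del: of_nat_Suc)
  also have "(\<Sum>i\<le>Suc n. ?A i * (of_nat (Suc n - i) * ?B (Suc n - i))) = (\<Sum>i\<le>n. b * ?A i * ?B (n - i))"
    unfolding sum.atMost_Suc
    by (simp add: Suc_diff_le exph_nth_Suc exph_nth_commute[OF ab] mult.assoc del: of_nat_Suc)
  also have "(\<Sum>i\<le>n. a * ?A i * ?B (n - i)) + (\<Sum>i\<le>n. b * ?A i * ?B (n - i))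
      = (a + b) * fps_nth (exph a * exph b) n"
    by (simp add: fps_mult_nth atLeast0AtMost sum_distrib_left distrib_right mult.assoc sum.distrib)
  finally show "of_nat (Suc n) * fps_nth (exph a * exph b) (Suc n) = (a + b) * fps_nth (exph a * exph b) n" .
qed

lemma exph_0: "exph 0 = 1"
  by (rule exph_unique[symmetric]) simp_all

lemma exph_minus: "exph a * exph (- a) = 1" "exph (- a) * exph a = 1"
  using exph_add[of a "- a", symmetric] exph_add[of "- a" a, symmetric] by (simp_all add: exph_0)

lemma exph_\<kappa>: "exph (\<kappa> c) = fscal (fps_exp c)"
  by (rule fps_ext) (simp add: exph_def fscal_nth flip: \<kappa>_power \<kappa>_mult)

lemma fscal_X_power: "fscal (fps_X ^ k * fps_const c) = fps_X ^ k * fps_const (\<kappa> c)"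
  by (rule fps_ext) (simp add: fscal_nth fps_X_power_mult_nth \<kappa>_0)

lemma exph_truncate: "\<exists>y. exph a = (\<Sum>k<n. fscal (fps_X ^ k * fps_const (1 / fact k)) * fps_const a ^ k) + fps_X ^ n * y"
proof -
  define y where "y = Abs_fps (\<lambda>k. \<kappa> (1 / fact (n + k)) * a ^ (n + k))"
  have "fps_nth (\<Sum>k<n. fscal (fps_X ^ k * fps_const (1 / fact k)) * fps_const a ^ k) m
      = (if m < n then \<kappa> (1 / fact m) * a ^ m else 0)" for m
  proof -
    have "fps_nth (\<Sum>k<n. fscal (fps_X ^ k * fps_const (1 / fact k)) * fps_const a ^ k) m
        = (\<Sum>k<n. if m = k then \<kappa> (1 / fact k) * a ^ k else 0)"
      unfolding fps_sum_nth
      by (rule sum.cong) (auto simp: fscal_X_power mult.assoc fps_X_power_mult_nth)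
    then show ?thesis by simp
  qed
  then have "exph a = (\<Sum>k<n. fscal (fps_X ^ k * fps_const (1 / fact k)) * fps_const a ^ k) + fps_X ^ n * y"
    by (intro fps_ext) (auto simp: exph_def y_def fps_X_power_mult_nth)
  then show ?thesis by blast
qed

text \<open>Intertwining modulo I passes from a, b to their powers and then to truncated
  exponentials; closedness of I allows the limit. In this way the relations for K_i follow from the
  infinitesimal ones for H_i.\<close>

lemma exph_intertwine:
  assumes I: "two_sided_ideal I" and closed: "adic_closure fps_X I = I"
    and ap: "fps_const a * p - p * fps_const b \<in> I"
  shows "exph a * p - p * exph b \<in> I"
proof -
  interpret two_sided_ideal I by fact
  have pow: "A ^ n * p - p * B ^ n \<in> I" if "A * p - p * B \<in> I" for A B n
  proof (induction n)
    case 0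
    show ?case by (simp add: zero_mem)
  next
    case (Suc n)
    have "A ^ Suc n * p - p * B ^ Suc n = A * (A ^ n * p - p * B ^ n) + (A * p - p * B) * B ^ n"
      by (simp add: algebra_simps)
    then show ?case using add_mem[OF left_mem[OF Suc] right_mem[OF that]] by (simp only:)
  qed
  have sum_mem: "sum f A \<in> I" if "\<And>i. i \<in> A \<Longrightarrow> f i \<in> I" for f and A :: "nat set"
    using that by (induction A rule: infinite_finite_induct) (auto simp: zero_mem add_mem)
  have "exph a * p - p * exph b \<in> adic_closure fps_X I"
  proof (rule adic_closureI)
    fix n
    obtain y z where
      y: "exph a = (\<Sum>k<n. fscal (fps_X ^ k * fps_const (1 / fact k)) * fps_const a ^ k) + fps_X ^ n * y" and
      z: "exph b = (\<Sum>k<n. fscal (fps_X ^ k * fps_const (1 / fact k)) * fps_const b ^ k) + fps_X ^ n * z"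
      using exph_truncate by meson
    define s where "s = (\<Sum>k<n. fscal (fps_X ^ k * fps_const (1 / fact k)) * (fps_const a ^ k * p - p * fps_const b ^ k))"
    have s: "s = (\<Sum>k<n. fscal (fps_X ^ k * fps_const (1 / fact k)) * fps_const a ^ k) * p
        - p * (\<Sum>k<n. fscal (fps_X ^ k * fps_const (1 / fact k)) * fps_const b ^ k)"
      by (simp only: s_def sum_distrib_left sum_distrib_right right_diff_distrib sum_subtractf mult.assoc
          fscal_left_commute)
    have "exph a * p - p * exph b - s = fps_X ^ n * (y * p) - p * (fps_X ^ n * z)"
    proof -
      have "(u + v) * p - p * (u' + v') - (u * p - p * u') = v * p - p * v'" for u v u' v' :: "'a fps"
        by (simp add: algebra_simps)
      from this[of _ "fps_X ^ n * y" _ "fps_X ^ n * z"] show ?thesis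
        unfolding y z s by (simp only: mult.assoc)
    qed
    also have "\<dots> = fps_X ^ n * (y * p - p * z)"
      by (simp only: X_power_left_commute right_diff_distrib)
    finally have "exph a * p - p * exph b - s = fps_X ^ n * (y * p - p * z)" .
    moreover have "s \<in> I" unfolding s_def by (rule sum_mem, rule left_mem, rule pow, rule ap)
    ultimately show "\<exists>s\<in>I. \<exists>y. exph a * p - p * exph b - s = fps_X ^ n * y" by blast
  qed
  then show ?thesis by (simp add: closed)
qed

lemma exph_add_\<kappa>: "exph (a + \<kappa> c) = fscal (fps_exp c) * exph a"
  unfolding exph_add[OF \<kappa>_central[symmetric]] exph_\<kappa> by (rule fscal_central[symmetric])

text \<open>The series (e^{ha} - e^{-ha}) / (q^d - q^{-d}), with the common factor h removed from
  numerator and denominator.\<close>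

definition kquot :: "nat \<Rightarrow> 'a \<Rightarrow> 'a fps" where
  "kquot d a = fscal (inverse (fps_shift 1 (qpow (int d) - qpow (- int d))))
     * fps_shift 1 (exph a - exph (- a))"

lemma fps_shift_X_mult: "fps_shift 1 (fps_X * f) = (f :: 'b::ring_1 fps)"
  by (rule fps_ext) simp

lemma fps_shift_mult_left:
  assumes "fps_nth f 0 = 0"
  shows "fps_shift 1 (f * g) = fps_shift 1 f * (g :: 'a fps)" "fps_shift 1 (g * f) = g * fps_shift 1 f"
proof -
  have f: "fps_X * fps_shift 1 f = f"
    using assms by (intro fps_ext) auto
  have "fps_X * (fps_shift 1 f * g) = f * g" unfolding mult.assoc[symmetric] f ..
  from arg_cong[OF this, of "fps_shift 1"] show "fps_shift 1 (f * g) = fps_shift 1 f * g"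
    by (simp only: fps_shift_X_mult)
  have "fps_X * (g * fps_shift 1 f) = g * f"
    using X_power_left_commute[of g 1 "fps_shift 1 f"] by (simp only: power_one_right f)
  from arg_cong[OF this, of "fps_shift 1"] show "fps_shift 1 (g * f) = g * fps_shift 1 f"
    by (simp only: fps_shift_X_mult)
qed

text \<open>From e^{a+b} - e^{-a-b} = (e^a - e^{-a}) e^b + e^{-a} (e^b - e^{-b}). Of the two
  possible splittings this is the one produced by commuting Delta(E_i) with Delta(F_i), namely Q
  \<otimes> K + K^{-1} \<otimes> Q.\<close>

lemma kquot_add:
  assumes "a * b = b * a"
  shows "kquot d (a + b) = kquot d a * exph b + exph (- a) * kquot d b"
proof -
  have "exph (a + b) - exph (- (a + b)) = (exph a - exph (- a)) * exph b + exph (- a) * (exph b - exph (- b))"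
    using exph_add[of a b] exph_add[of "- a" "- b"] assms by (simp add: algebra_simps)
  moreover have "fps_nth (exph c - exph (- c)) 0 = 0" for c by simp
  ultimately have "fps_shift 1 (exph (a + b) - exph (- (a + b)))
    = fps_shift 1 (exph a - exph (- a)) * exph b + exph (- a) * fps_shift 1 (exph b - exph (- b))"
    by (simp only: fps_shift_add fps_shift_mult_left)
  then show ?thesis
    unfolding kquot_def by (simp only: distrib_left mult.assoc fscal_left_commute)
qed

end

text \<open>The construction of \<open>comult_series\<close> with the target abstracted: a map on
  letters is extended to words, to the free algebra and continuously to power series.
  Comultiplication and representations are both instances.\<close>

locale letter_hom = scalar_algebra \<kappa> for \<kappa> :: "complex \<Rightarrow> 'a::ring_1" +
  fixes \<phi> :: "letter \<Rightarrow> 'a fps"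
begin

definition ext_word :: "word \<Rightarrow> 'a fps" where
  "ext_word w = (case w of Word gs \<Rightarrow> prod_list (map \<phi> gs))"

definition ext_free :: "free \<Rightarrow> 'a fps" where
  "ext_free a = (\<Sum>w\<in>Poly_Mapping.keys a. fps_const (\<kappa> (Poly_Mapping.lookup a w)) * ext_word w)"

definition ext_series :: "free fps \<Rightarrow> 'a fps" where
  "ext_series p = Abs_fps (\<lambda>n. \<Sum>k\<le>n. fps_nth (ext_free (fps_nth p k)) (n - k))"

lemma ext_free_superset:
  assumes "finite S" "Poly_Mapping.keys a \<subseteq> S"
  shows "ext_free a = (\<Sum>w\<in>S. fps_const (\<kappa> (Poly_Mapping.lookup a w)) * ext_word w)"
  unfolding ext_free_def using assms
  by (intro sum.mono_neutral_left) (auto simp: in_keys_iff \<kappa>_0)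

lemma ext_free_add: "ext_free (a + b) = ext_free a + ext_free b"
proof -
  let ?S = "Poly_Mapping.keys a \<union> Poly_Mapping.keys b"
  have "Poly_Mapping.keys (a + b) \<subseteq> ?S" by (rule Poly_Mapping.keys_add)
  then show ?thesis
    by (simp add: ext_free_superset[of ?S] lookup_add \<kappa>_add distrib_right sum.distrib flip: fps_const_add)
qed

lemma ext_free_0: "ext_free 0 = 0"
  by (simp add: ext_free_def)

lemma ext_free_diff: "ext_free (a - b) = ext_free a - ext_free b"
  using ext_free_add[of "a - b" b] by simp

lemma ext_free_single: "ext_free (Poly_Mapping.single w c) = fps_const (\<kappa> c) * ext_word w"
  by (cases "c = 0") (simp_all add: ext_free_def \<kappa>_0)

lemma ext_word_add: "ext_word (v + w) = ext_word v * ext_word w"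
  by (cases v; cases w) (simp add: ext_word_def)

lemma ext_free_mult: "ext_free (a * b) = ext_free a * ext_free b"
proof (induction a rule: free_induct)
  case (2 v c)
  show ?case
  proof (induction b rule: free_induct)
    case (2 w d)
    show ?case
      by (simp only: mult_single ext_free_single ext_word_add \<kappa>_mult fps_const_mult[symmetric]
          mult.assoc const_\<kappa>_left_commute[of "ext_word v"])
  qed (simp_all add: ext_free_0 ext_free_add distrib_left)
qed (simp_all add: ext_free_0 ext_free_add distrib_right)

lemma ext_free_cst: "ext_free (cst c) = fps_const (\<kappa> c)"
  by (simp add: ext_free_single zero_word_def ext_word_def)

lemma ext_free_lt: "ext_free (lt g) = \<phi> g"
  by (simp add: lt_def ext_free_single \<kappa>_1 ext_word_def)

lemma ext_series_add: "ext_series (p + r) = ext_series p + ext_series r"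
  by (rule fps_ext) (simp add: ext_series_def ext_free_add sum.distrib)

lemma ext_series_0: "ext_series 0 = 0"
  by (rule fps_ext) (simp add: ext_series_def ext_free_0)

lemma ext_series_diff: "ext_series (p - r) = ext_series p - ext_series r"
  using ext_series_add[of "p - r" r] by simp

lemma ext_series_const: "ext_series (fps_const a) = ext_free a"
proof (rule fps_ext)
  fix n
  have "fps_nth (ext_series (fps_const a)) n = (\<Sum>k\<le>n. if k = 0 then fps_nth (ext_free a) n else 0)"
    unfolding ext_series_def fps_nth_Abs_fps by (rule sum.cong) (auto simp: ext_free_0)
  then show "fps_nth (ext_series (fps_const a)) n = fps_nth (ext_free a) n" by simp
qed

lemma ext_series_X_mult: "ext_series (fps_X * p) = fps_X * ext_series p"
proof (rule fps_ext)
  fix n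
  show "fps_nth (ext_series (fps_X * p)) n = fps_nth (fps_X * ext_series p) n"
  proof (cases n)
    case 0
    then show ?thesis by (simp add: ext_series_def ext_free_0)
  next
    case (Suc m)
    have "fps_nth (ext_series (fps_X * p)) (Suc m)
        = (\<Sum>k\<le>Suc m. fps_nth (ext_free (if k = 0 then 0 else fps_nth p (k - 1))) (Suc m - k))"
      by (simp add: ext_series_def del: sum.atMost_Suc)
    also have "\<dots> = (\<Sum>k\<le>m. fps_nth (ext_free (fps_nth p k)) (m - k))"
      unfolding sum.atMost_Suc_shift by (simp add: ext_free_0)
    finally show ?thesis using Suc by (simp add: ext_series_def)
  qed
qed

lemma fps_split: "p = fps_const (fps_nth p 0) + fps_X * fps_shift 1 (p :: 'b::ring_1 fps)"
  by (rule fps_ext) auto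

text \<open>Both sides are bilinear over the power series in \<open>h\<close>, so splitting off the constant terms
  lowers the order of the coefficient.\<close>

lemma ext_series_mult: "ext_series (p * r) = ext_series p * ext_series r"
proof (rule fps_ext)
  fix n
  show "fps_nth (ext_series (p * r)) n = fps_nth (ext_series p * ext_series r) n"
  proof (induction n arbitrary: p r rule: less_induct)
    case (less n)
    define p0 p' r0 r' where "p0 = fps_const (fps_nth p 0)" "p' = fps_shift 1 p"
      "r0 = fps_const (fps_nth r 0)" "r' = fps_shift 1 r"
    have p: "p = p0 + fps_X * p'" and r: "r = r0 + fps_X * r'"
      unfolding p0_p'_r0_r'_def by (rule fps_split)+
    have X: "fps_nth (ext_series (fps_X * (s * t))) n = fps_nth (fps_X * (ext_series s * ext_series t)) n" for s t
      using less[of "n - 1" s t] by (cases n) (simp_all add: ext_series_X_mult)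
    have "p * r = p0 * r0 + fps_X * (p0 * r') + fps_X * (p' * r)"
    proof -
      have "p0 * (fps_X * r') = fps_X * (p0 * r')"
        unfolding mult.assoc[symmetric] by (simp only: fps_mult_fps_X_commute)
      moreover have "p * r = p0 * r + fps_X * (p' * r)"
        using arg_cong[OF p, of "\<lambda>z. z * r"] by (simp only: distrib_right mult.assoc)
      moreover have "p0 * r = p0 * r0 + p0 * (fps_X * r')"
        using arg_cong[OF r, of "\<lambda>z. p0 * z"] by (simp only: distrib_left)
      ultimately show ?thesis by (simp only:)
    qed
    moreover have "ext_series (p0 * r0) = ext_series p0 * ext_series r0"
      unfolding p0_p'_r0_r'_def by (simp only: fps_const_mult ext_series_const ext_free_mult)
    ultimately have "fps_nth (ext_series (p * r)) n = fps_nth (ext_series p0 * ext_series r0) n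
        + fps_nth (fps_X * (ext_series p0 * ext_series r')) n + fps_nth (fps_X * (ext_series p' * ext_series r)) n"
      by (simp only: ext_series_add fps_add_nth X)
    also have "\<dots> = fps_nth (ext_series p * ext_series r) n"
    proof -
      have "ext_series p0 * (fps_X * ext_series r') = fps_X * (ext_series p0 * ext_series r')"
        unfolding mult.assoc[symmetric] by (simp only: fps_mult_fps_X_commute)
      moreover have "ext_series p = ext_series p0 + fps_X * ext_series p'"
        "ext_series r = ext_series r0 + fps_X * ext_series r'"
        using arg_cong[OF p, of ext_series] arg_cong[OF r, of ext_series]
        by (simp_all only: ext_series_add ext_series_X_mult)
      ultimately show ?thesis by (simp add: algebra_simps)
    qed
    finally show ?case .
  qed
qed

lemma ext_series_X_power_mult: "ext_series (fps_X ^ n * p) = fps_X ^ n * ext_series p"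
  by (induction n) (simp_all add: ext_series_X_mult mult.assoc)

lemma ext_series_scal: "ext_series (scal c) = fscal c"
proof (rule fps_ext)
  fix n
  have "fps_nth (ext_series (scal c)) n = (\<Sum>k\<le>n. if k = n then \<kappa> (fps_nth c n) else 0)"
    unfolding ext_series_def fps_nth_Abs_fps scal_def by (rule sum.cong) (auto simp: ext_free_cst)
  then show "fps_nth (ext_series (scal c)) n = fps_nth (fscal c) n" by (simp add: fscal_nth)
qed

lemma ext_series_1: "ext_series 1 = 1"
  using ext_series_const[of "cst 1"] ext_free_cst[of 1]
  by (simp only: \<kappa>_1 single_one fps_const_1_eq_1)

lemma ext_series_power: "ext_series (p ^ n) = ext_series p ^ n"
  by (induction n) (simp_all add: ext_series_1 ext_series_mult)

lemma ext_series_lt: "ext_series (flt g) = \<phi> g"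
  by (simp add: ext_series_const ext_free_lt)

lemma ext_free_power: "ext_free (a ^ n) = ext_free a ^ n"
  by (simp add: ext_series_power flip: ext_series_const fps_const_power)

lemma ext_series_hexp:
  assumes "ext_free a = fps_const b"
  shows "ext_series (hexp a) = exph b"
proof (rule fps_ext)
  fix n
  have "ext_free (cst (1 / fact k) * a ^ k) = fps_const (\<kappa> (1 / fact k) * b ^ k)" for k
    by (simp add: ext_free_mult ext_free_cst ext_free_power assms fps_const_power)
  then have "fps_nth (ext_series (hexp a)) n = (\<Sum>k\<le>n. if k = n then \<kappa> (1 / fact n) * b ^ n else 0)"
    unfolding ext_series_def fps_nth_Abs_fps hexp_def by (intro sum.cong) (simp_all del: fps_const_mult)
  then show "fps_nth (ext_series (hexp a)) n = fps_nth (exph b) n" by (simp add: exph_def)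
qed

lemma ext_series_shift:
  assumes "fps_nth p 0 = 0"
  shows "ext_series (fps_shift 1 p) = fps_shift 1 (ext_series p)"
proof -
  have "p = fps_X * fps_shift 1 p" by (rule fps_ext) (use assms in auto)
  from arg_cong[OF this, of ext_series] have "ext_series p = fps_X * ext_series (fps_shift 1 p)"
    by (simp only: ext_series_X_mult)
  from arg_cong[OF this, of "fps_shift 1"] show ?thesis by (simp only: fps_shift_X_mult)
qed

lemma ext_series_K:
  assumes "\<phi> (HH i) = fps_const a"
  shows "ext_series (fK i) = exph (\<kappa> (of_nat (symm i)) * a)"
    "ext_series (fKinv i) = exph (- (\<kappa> (of_nat (symm i)) * a))"
    "ext_series (fKquot i) = kquot (symm i) (\<kappa> (of_nat (symm i)) * a)"
proof -
  have *: "ext_free (cst (of_nat (symm i)) * lt (HH i)) = fps_const (\<kappa> (of_nat (symm i)) * a)"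
    by (simp only: ext_free_mult ext_free_cst ext_free_lt assms fps_const_mult)
  then have **: "ext_free (- (cst (of_nat (symm i)) * lt (HH i))) = fps_const (- (\<kappa> (of_nat (symm i)) * a))"
    using ext_free_diff[of 0 "cst (of_nat (symm i)) * lt (HH i)"]
    by (simp only: ext_free_0 diff_0 fps_const_neg)
  show K: "ext_series (fK i) = exph (\<kappa> (of_nat (symm i)) * a)"
    "ext_series (fKinv i) = exph (- (\<kappa> (of_nat (symm i)) * a))"
    unfolding fK_def fKinv_def by (rule ext_series_hexp, fact)+
  have "fps_nth (fK i - fKinv i) 0 = 0" by (simp add: fK_def fKinv_def hexp_def)
  then show "ext_series (fKquot i) = kquot (symm i) (\<kappa> (of_nat (symm i)) * a)"
    unfolding fKquot_def kquot_def ext_series_mult ext_series_scal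
    by (subst ext_series_shift) (simp_all only: ext_series_diff K)
qed

end

section \<open>The relations of the quantum group in a ring with scalars\<close>

lemma qpow_mult: "qpow a * qpow b = qpow (a + b)"
  by (simp add: qpow_def fps_exp_add_mult)

lemma qpow_0 [simp]: "qpow 0 = 1"
  by (simp add: qpow_def)

text \<open>A rewrite rule for x * y in the form that still applies inside products bracketed to the
  right; the q-commutation computations below normalize with such pairs of rules.\<close>

lemma mult_left_rule: "x * y = r \<Longrightarrow> x * (y * w) = r * (w :: 'a::semigroup_mult)"
  by (metis mult.assoc)

text \<open>\<open>\<sigma>\<close> is the structure map of a C[[h]]-algebra. The sort omits 0
  \<noteq> 1, which is not part of the instances for \<open>Uh\<close> and
  \<open>Uh2\<close>.\<close>

locale ring_scalars =
  fixes \<sigma> :: "complex fps \<Rightarrow> 'a::{ring,monoid_mult}"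
  assumes \<sigma>_add: "\<sigma> (c + d) = \<sigma> c + \<sigma> d"
    and \<sigma>_mult: "\<sigma> (c * d) = \<sigma> c * \<sigma> d"
    and \<sigma>_1: "\<sigma> 1 = 1"
    and \<sigma>_central: "\<sigma> c * x = x * \<sigma> c"
begin

lemma \<sigma>_0: "\<sigma> 0 = 0"
  using \<sigma>_add[of 0 0] by simp

lemma \<sigma>_minus: "\<sigma> (- c) = - \<sigma> c"
  using \<sigma>_add[of c "- c"] by (simp add: \<sigma>_0 eq_neg_iff_add_eq_0 add.commute)

lemma \<sigma>_diff: "\<sigma> (c - d) = \<sigma> c - \<sigma> d"
  using \<sigma>_add[of c "- d"] by (simp add: \<sigma>_minus)

lemma \<sigma>_left_commute: "x * (\<sigma> c * y) = \<sigma> c * (x * y)"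
  using arg_cong[OF \<sigma>_central[of c x], of "\<lambda>z. z * y"] by (simp only: mult.assoc)

definition q :: "int \<Rightarrow> 'a" where "q k = \<sigma> (qpow k)"

lemma q_simps: "q a * q b = q (a + b)" "q a * (q b * x) = q (a + b) * x" "q 0 = 1"
  by (simp_all add: q_def \<sigma>_1 flip: \<sigma>_mult qpow_mult mult.assoc)

lemma q_left_commute: "x * (q k * y) = q k * (x * y)"
  by (simp add: q_def \<sigma>_left_commute)

lemma q_cancel: "q k * x = q k * y \<longleftrightarrow> x = y"
proof
  assume "q k * x = q k * y"
  then have "q (- k) * (q k * x) = q (- k) * (q k * y)" by simp
  then show "x = y" by (simp add: q_simps)
qed simp

definition Zel :: "'a \<Rightarrow> 'a \<Rightarrow> 'a" where "Zel x y = x * y - q 3 * (y * x)"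

definition Xel :: "'a \<Rightarrow> 'a \<Rightarrow> 'a" where "Xel x y = Zel x y * x - q (- 1) * (x * Zel x y)"

definition Yel :: "'a \<Rightarrow> 'a \<Rightarrow> 'a" where "Yel x y = Xel x y * x - q 1 * (x * Xel x y)"

text \<open>Let L and R be left and right multiplication by x. By the q-binomial theorem the quartic
  Serre element is the product of the commuting factors R - q^k L, k = -3, -1, 1, 3, applied to y.
  \<open>Zel\<close>, \<open>Xel\<close>, \<open>Yel\<close> are its partial products up to the unit
  -q^3, and the last factor is written as a commutation rule. \<open>serre21\<close> treats y in the
  same way with k = 3, -3.\<close>

definition serre12 :: "'a \<Rightarrow> 'a \<Rightarrow> bool" where
  "serre12 x y \<longleftrightarrow> Yel x y * x = q 3 * (x * Yel x y)"

definition serre21 :: "'a \<Rightarrow> 'a \<Rightarrow> bool" where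
  "serre21 x y \<longleftrightarrow> Zel x y * y = q (- 3) * (y * Zel x y)"

text \<open>Factors commuting with x, y and each other can be pulled out of all q-commutators. This
  gives the Serre relations for the summands E_i \<otimes> K_i of Delta(E_i), whose factors K_i
  commute with everything in the left tensor slot.\<close>

lemma twist:
  assumes "k * l = l * k" and c: "k * x = x * k" "k * y = y * k" "l * x = x * l" "l * y = y * l"
  shows "Zel (x * k) (y * l) = Zel x y * (k * l)" (is ?Z)
    and "Xel (x * k) (y * l) = Xel x y * (k * (k * l))" (is ?X)
    and "Yel (x * k) (y * l) = Yel x y * (k * (k * (k * l)))" (is ?Y)
    and "serre12 x y \<Longrightarrow> serre12 (x * k) (y * l)"
    and "serre21 x y \<Longrightarrow> serre21 (x * k) (y * l)"
proof -
  have L: "l * k = k * l" by (simp only: assms(1))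
  note L' = L mult_left_rule[OF L]
  show Z: ?Z
    unfolding Zel_def
    by (simp add: algebra_simps c c[THEN mult_left_rule] L')
  have cZ: "k * Zel x y = Zel x y * k" "l * Zel x y = Zel x y * l"
    unfolding Zel_def
    by (simp_all add: algebra_simps c c[THEN mult_left_rule] q_left_commute[of k] q_left_commute[of l])
  show X: ?X
    unfolding Xel_def Z
    by (simp add: algebra_simps c c[THEN mult_left_rule] L' cZ cZ[THEN mult_left_rule])
  have cX: "k * Xel x y = Xel x y * k" "l * Xel x y = Xel x y * l"
    unfolding Xel_def
    by (simp_all add: algebra_simps c c[THEN mult_left_rule] cZ cZ[THEN mult_left_rule]
        q_left_commute[of k] q_left_commute[of l])
  show Y: ?Y
    unfolding Yel_def X
    by (simp add: algebra_simps c c[THEN mult_left_rule] L' cX cX[THEN mult_left_rule])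
  have cY: "k * Yel x y = Yel x y * k" "l * Yel x y = Yel x y * l"
    unfolding Yel_def
    by (simp_all add: algebra_simps c c[THEN mult_left_rule] cX cX[THEN mult_left_rule]
        q_left_commute[of k] q_left_commute[of l])
  {
    assume "serre12 x y"
    then have s: "Yel x y * x = q 3 * (x * Yel x y)" unfolding serre12_def .
    show "serre12 (x * k) (y * l)"
      unfolding serre12_def Y
      by (simp add: mult.assoc c c[THEN mult_left_rule] L' cY cY[THEN mult_left_rule] s[THEN mult_left_rule])
  next
    assume "serre21 x y"
    then have s: "Zel x y * y = q (- 3) * (y * Zel x y)" unfolding serre21_def .
    show "serre21 (x * k) (y * l)"
      unfolding serre21_def Z
      by (simp add: mult.assoc c c[THEN mult_left_rule] L' cZ cZ[THEN mult_left_rule] s[THEN mult_left_rule])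
  }
qed

text \<open>If \<open>a\<^sub>i\<close> and \<open>b\<^sub>i\<close> \<open>q\<close>-commute like the two summands of \<open>\<Delta>(E\<^sub>i)\<close>, the iterated
  \<open>q\<close>-commutators of \<open>a\<^sub>i + b\<^sub>i\<close> are those of the \<open>a\<^sub>i\<close> plus those of the \<open>b\<^sub>i\<close>, up to cross terms
  that cancel in the Serre relations.\<close>

context
  fixes a1 a2 b1 b2 :: 'a
  assumes ab: "a1 * b1 = q 2 * (b1 * a1)" "a1 * b2 = q (- 3) * (b2 * a1)"
    "a2 * b1 = q (- 3) * (b1 * a2)" "a2 * b2 = q 6 * (b2 * a2)"
begin

private abbreviation (input) "ZA \<equiv> Zel a1 a2"
private abbreviation (input) "ZB \<equiv> Zel b1 b2"
private abbreviation (input) "XA \<equiv> Xel a1 a2"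
private abbreviation (input) "XB \<equiv> Xel b1 b2"
private abbreviation (input) "YA \<equiv> Yel a1 a2"
private abbreviation (input) "YB \<equiv> Yel b1 b2"

lemmas ab_left = ab[THEN mult_left_rule]
lemmas qcomm_atoms = q_left_commute[of a1] q_left_commute[of a2] q_left_commute[of b1] q_left_commute[of b2]
  q_left_commute[of ZA] q_left_commute[of ZB] q_left_commute[of XA] q_left_commute[of XB]
  q_left_commute[of YA] q_left_commute[of YB]

private lemma Z_cross:
  "ZA * b1 = q (- 1) * (b1 * ZA)" "a1 * ZB = q (- 1) * (ZB * a1)"
  "ZA * b2 = q 3 * (b2 * ZA)" "a2 * ZB = q 3 * (ZB * a2)"
  unfolding Zel_def by (simp_all add: algebra_simps ab ab_left qcomm_atoms q_simps)

private lemmas Z_cross_left = Z_cross[THEN mult_left_rule]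

text \<open>The exponent 3 makes the two b1 a2 terms cancel, since a2 b1 = q^{-3} b1 a2; of the
  mixed terms only b2 a1 is left.\<close>

private lemma Z_sum: "Zel (a1 + b1) (a2 + b2) = ZA + ZB + q (- 3) * (b2 * a1) - q 3 * (b2 * a1)"
  unfolding Zel_def by (simp add: algebra_simps ab ab_left qcomm_atoms q_simps)

private lemma X_cross: "XA * b1 = q 1 * (b1 * XA)" "a1 * XB = q 1 * (XB * a1)"
  unfolding Xel_def by (simp_all add: algebra_simps ab ab_left Z_cross Z_cross_left qcomm_atoms q_simps)

private lemmas X_cross_left = X_cross[THEN mult_left_rule]

private lemma Y_cross: "YA * b1 = q 3 * (b1 * YA)" "a1 * YB = q 3 * (YB * a1)"
  unfolding Yel_def by (simp_all add: algebra_simps ab ab_left X_cross X_cross_left qcomm_atoms q_simps)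

private lemma Zb: "b1 * b2 = ZB + q 3 * (b2 * b1)"
  by (simp add: Zel_def)

private lemma Xb: "ZB * b1 = XB + q (- 1) * (b1 * ZB)" and Xa: "ZA * a1 = XA + q (- 1) * (a1 * ZA)"
  by (simp_all add: Xel_def)

private lemma Yb: "XB * b1 = YB + q 1 * (b1 * XB)" and Ya: "XA * a1 = YA + q 1 * (a1 * XA)"
  by (simp_all add: Yel_def)

private lemmas X_rules = ab ab_left Z_cross Z_cross_left Zb mult_left_rule[OF Zb] Xa Xb
  mult_left_rule[OF Xa] mult_left_rule[OF Xb]

text \<open>The exponent -1 removes the terms mixing Z_A and b1. In all surviving mixed terms the
  a-part is a1 or a1 a1. For a_i = E_i \<otimes> K_i and b_i = 1 \<otimes> E_i the left tensor
  factors of Delta(X) are thus built from X and E_1 alone, which is the coideal property for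
  X.\<close>

lemma X_sum: "Xel (a1 + b1) (a2 + b2) = XA + XB
    + (1 - q (- 2) - q (- 4) + q 2) * (ZB * a1)
    + (q (- 3) - q 3 - q (- 7) + q (- 1)) * (b2 * (a1 * a1))"
  unfolding Xel_def[of "a1 + b1"] Z_sum
  by (simp add: algebra_simps X_rules qcomm_atoms q_simps)

private lemmas Y_rules = X_rules X_cross X_cross_left Ya Yb mult_left_rule[OF Ya] mult_left_rule[OF Yb]

private lemma Y_sum: "Yel (a1 + b1) (a2 + b2) = YA + YB
    + (q 4 - q (- 2)) * (XB * a1)
    + (q 4 + q (- 6) - q (- 2) - 1) * (ZB * (a1 * a1))
    + (q 1 - q 3 + q (- 1) - q (- 5) - q (- 7) + q (- 9)) * (b2 * (a1 * (a1 * a1)))"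
  unfolding Yel_def[of "a1 + b1"] X_sum
  by (simp add: algebra_simps Y_rules qcomm_atoms q_simps)

lemma serre12_sum:
  assumes "serre12 a1 a2" "serre12 b1 b2"
  shows "serre12 (a1 + b1) (a2 + b2)"
proof -
  have s: "YA * a1 = q 3 * (a1 * YA)" "YB * b1 = q 3 * (b1 * YB)"
    using assms unfolding serre12_def by auto
  show ?thesis
    unfolding serre12_def Y_sum
    by (simp add: algebra_simps Y_rules Y_cross mult_left_rule[OF Y_cross(1)] mult_left_rule[OF Y_cross(2)]
        s s[THEN mult_left_rule] qcomm_atoms q_simps)
qed

lemma serre21_sum:
  assumes "serre21 a1 a2" "serre21 b1 b2"
  shows "serre21 (a1 + b1) (a2 + b2)"
proof -
  have s: "ZA * a2 = q (- 3) * (a2 * ZA)" "ZB * b2 = q (- 3) * (b2 * ZB)"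
    using assms unfolding serre21_def by auto
  have Za: "a1 * a2 = ZA + q 3 * (a2 * a1)" by (simp add: Zel_def)
  show ?thesis
    unfolding serre21_def Z_sum
    by (simp add: algebra_simps ab ab_left Z_cross Z_cross_left s s[THEN mult_left_rule]
        Za mult_left_rule[OF Za] qcomm_atoms q_simps)
qed

end

text \<open>Each of the auxiliary relations is the previous one multiplied by \<open>x\<close> on the right, with \<open>x\<close>
  then moved to the left.\<close>

lemma XY_commute:
  assumes "serre12 x y" "serre21 x y"
  shows "Xel x y * Yel x y = q 3 * (Yel x y * Xel x y)"
proof -
  define Z X Y where "Z = Zel x y" and "X = Xel x y" and "Y = Yel x y"
  have yx: "y * x = q (- 3) * (x * y) - q (- 3) * Z"
    by (simp add: Z_def Zel_def algebra_simps q_simps)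
  have Zx: "Z * x = q (- 1) * (x * Z) + X"
    by (simp add: Z_def X_def Xel_def)
  have Xx: "X * x = q 1 * (x * X) + Y"
    by (simp add: X_def Y_def Yel_def)
  have Yx: "Y * x = q 3 * (x * Y)"
    using assms(1) by (simp add: Y_def serre12_def)
  have r0: "Z * y = q (- 3) * (y * Z)"
    using assms(2) by (simp add: Z_def serre21_def)
  note base = yx Zx Xx Yx r0
  note atoms = q_left_commute[of x] q_left_commute[of y] q_left_commute[of X] q_left_commute[of Y]
    q_left_commute[of Z]
  have r1: "X * y = y * X + (1 - q (- 4)) * (Z * Z)"
  proof -
    have "q 3 * (Z * (y * x)) = q 3 * (q (- 3) * (y * Z) * x)" by (simp only: mult_left_rule[OF r0])
    then show ?thesis
      by (simp add: algebra_simps base base[THEN mult_left_rule] atoms q_simps)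
  qed
  have r2: "Y * y = q 3 * (y * Y) + (1 + q 2 - q (- 2)) * (X * Z) + (q 3 - q (- 1) - q 1) * (Z * X)"
  proof -
    have "q 3 * (X * (y * x)) = q 3 * ((y * X + (1 - q (- 4)) * (Z * Z)) * x)" by (simp only: mult_left_rule[OF r1])
    then show ?thesis
      by (simp add: algebra_simps base base[THEN mult_left_rule] r1 r1[THEN mult_left_rule] atoms q_simps)
  qed
  have r3: "(q (- 4) + q (- 2)) * (Z * Y - Y * Z) = (q 1 - q (- 5)) * (X * X)"
  proof -
    have "q (- 3) * (Y * (y * x)) = q (- 3) * ((q 3 * (y * Y) + (1 + q 2 - q (- 2)) * (X * Z)
        + (q 3 - q (- 1) - q 1) * (Z * X)) * x)" by (simp only: mult_left_rule[OF r2])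
    then show ?thesis
      by (simp add: algebra_simps base base[THEN mult_left_rule] r2 r2[THEN mult_left_rule] atoms q_simps)
  qed
  \<comment> \<open>The twist by q^2 cancels the terms that begin with x, because X X x = q^2 x X X
    + q Y X + X Y and (Z Y - Y Z) x = q^2 x (Z Y - Y Z) + q^3 X Y - Y X. What remains relates only X
    Y and Y X.\<close>
  have r4: "(q (- 1) + q (- 5)) * (X * Y) = (q 2 + q (- 2)) * (Y * X)"
  proof -
    let ?l = "(q (- 4) + q (- 2)) * (Z * Y - Y * Z)" and ?r = "(q 1 - q (- 5)) * (X * X)"
    have "?l * x - q 2 * (x * ?l) = ?r * x - q 2 * (x * ?r)" by (simp only: r3)
    then show ?thesis
      by (simp add: algebra_simps base base[THEN mult_left_rule] atoms q_simps)
  qed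
  \<comment> \<open>q^2 + q^{-2} has constant term 2, so it is a unit of C[[h]] and can be divided
    out in any algebra over it.\<close>
  define u where "u = inverse (qpow 2 + qpow (- 2))"
  have u: "u * (qpow 2 + qpow (- 2)) = 1"
    unfolding u_def by (rule inverse_mult_eq_1) (simp add: qpow_def)
  have "q (- 1) + q (- 5) = q (- 3) * \<sigma> (qpow 2 + qpow (- 2))"
    by (simp add: q_def \<sigma>_add distrib_left flip: \<sigma>_mult qpow_mult) (simp add: qpow_mult flip: \<sigma>_mult)
  with r4 have "q (- 3) * (\<sigma> (qpow 2 + qpow (- 2)) * (X * Y)) = \<sigma> (qpow 2 + qpow (- 2)) * (Y * X)"
    by (simp add: q_def \<sigma>_add mult.assoc)
  then have "\<sigma> u * (q (- 3) * (\<sigma> (qpow 2 + qpow (- 2)) * (X * Y)))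
      = \<sigma> u * (\<sigma> (qpow 2 + qpow (- 2)) * (Y * X))"
    by simp
  moreover have "\<sigma> u * (\<sigma> (qpow 2 + qpow (- 2)) * w) = w" for w
    unfolding mult.assoc[symmetric] \<sigma>_mult[symmetric] u \<sigma>_1 by simp
  ultimately have "q (- 3) * (X * Y) = Y * X"
    unfolding q_left_commute[of "\<sigma> u"] by simp
  then have "q 3 * (q (- 3) * (X * Y)) = q 3 * (Y * X)" by simp
  then show ?thesis by (simp add: q_simps X_def Y_def)
qed

end

section \<open>Families satisfying the relations, and their products\<close>

definition dot :: "node \<Rightarrow> node \<Rightarrow> int" where
  "dot i j = int (symm i) * cartan i j"

lemma dot_simps:
  "dot Node1 Node1 = 2" "dot Node1 Node2 = - 3" "dot Node2 Node1 = - 3" "dot Node2 Node2 = 6"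
  by (simp_all add: dot_def)

lemma dot_commute: "dot i j = dot j i"
  by (cases i; cases j) (simp_all add: dot_simps)

text \<open>K, its inverse L, and Q = [E_i, F_i] are independent data here; that they are
  exponentials in H is not recorded. This keeps the formation of products purely algebraic, and the
  exponential form is restored separately by \<open>exph_add\<close> and
  \<open>kquot_add\<close>.\<close>

locale g2_family = ring_scalars \<sigma> for \<sigma> :: "complex fps \<Rightarrow> 'a::{ring,monoid_mult}" +
  fixes E F H K L Q :: "node \<Rightarrow> 'a"
  assumes HH: "H i * H j = H j * H i"
    and HE: "H i * E j = E j * H i + \<sigma> (of_int (cartan i j)) * E j"
    and HF: "H i * F j = F j * H i - \<sigma> (of_int (cartan i j)) * F j"
    and HK: "H i * K j = K j * H i"
    and HL: "H i * L j = L j * H i"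
    and KK: "K i * K j = K j * K i"
    and KL: "K i * L i = 1"
    and LK: "L i * K i = 1"
    and LL: "L i * L j = L j * L i"
    and KE: "K i * E j = q (dot i j) * (E j * K i)"
    and KF: "K i * F j = q (- dot i j) * (F j * K i)"
    and EF: "E i * F j = F j * E i + (if i = j then Q i else 0)"
    and serreE: "serre12 (E Node1) (E Node2)" "serre21 (E Node1) (E Node2)"
    and serreF: "serre12 (F Node1) (F Node2)" "serre21 (F Node1) (F Node2)"
begin

definition gens :: "'a set" where
  "gens = range E \<union> range F \<union> range H \<union> range K \<union> range L \<union> range Q"

lemma gens_simps [simp]:
  "E i \<in> gens" "F i \<in> gens" "H i \<in> gens" "K i \<in> gens" "L i \<in> gens" "Q i \<in> gens"
  by (auto simp: gens_def)

lemma L_intertwine: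
  assumes "K i * x = q k * (x * K i)"
  shows "L i * x = q (- k) * (x * L i)"
proof -
  have "L i * (K i * x) * L i = q k * (L i * x)"
    unfolding assms by (simp add: mult.assoc KL q_left_commute)
  moreover have "L i * (K i * x) * L i = x * L i"
    by (simp add: LK flip: mult.assoc)
  ultimately show ?thesis by (simp add: q_simps)
qed

lemma LE: "L i * E j = q (- dot i j) * (E j * L i)"
  by (rule L_intertwine) (rule KE)

lemma LF: "L i * F j = q (dot i j) * (F j * L i)"
  using L_intertwine[OF KF] by simp

lemma image_family:
  assumes \<theta>: "\<And>x y. \<theta> (x + y) = \<theta> x + \<theta> y" "\<And>x y. \<theta> (x * y) = \<theta> x * \<theta> y" "\<theta> 1 = 1"
    and \<sigma>': "ring_scalars \<sigma>'" "\<And>c. \<theta> (\<sigma> c) = \<sigma>' c"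
  shows "g2_family \<sigma>' (\<theta> \<circ> E) (\<theta> \<circ> F) (\<theta> \<circ> H) (\<theta> \<circ> K) (\<theta> \<circ> L) (\<theta> \<circ> Q)"
proof -
  interpret r: ring_scalars \<sigma>' by fact
  have \<theta>0: "\<theta> 0 = 0" using \<theta>(1)[of 0 0] by simp
  have \<theta>d: "\<theta> (x - y) = \<theta> x - \<theta> y" for x y using \<theta>(1)[of "x - y" y] by simp
  have \<theta>q: "\<theta> (q k) = r.q k" for k by (simp add: q_def r.q_def \<sigma>')
  note hom = \<theta> \<theta>0 \<theta>d \<theta>q
  have Z: "\<theta> (Zel x y) = r.Zel (\<theta> x) (\<theta> y)" for x y by (simp add: Zel_def r.Zel_def hom)
  have X: "\<theta> (Xel x y) = r.Xel (\<theta> x) (\<theta> y)" for x y by (simp add: Xel_def r.Xel_def hom Z)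
  have Y: "\<theta> (Yel x y) = r.Yel (\<theta> x) (\<theta> y)" for x y by (simp add: Yel_def r.Yel_def hom X)
  have s: "r.serre12 (\<theta> x) (\<theta> y)" if "serre12 x y" for x y
  proof -
    have "\<theta> (Yel x y * x) = \<theta> (q 3 * (x * Yel x y))" using that by (simp add: serre12_def)
    then show ?thesis by (simp add: r.serre12_def hom Y)
  qed
  have s': "r.serre21 (\<theta> x) (\<theta> y)" if "serre21 x y" for x y
  proof -
    have "\<theta> (Zel x y * y) = \<theta> (q (- 3) * (y * Zel x y))" using that by (simp add: serre21_def)
    then show ?thesis by (simp add: r.serre21_def hom Z)
  qed
  show ?thesis
  proof
    fix i j
    show "(\<theta> \<circ> H) i * (\<theta> \<circ> H) j = (\<theta> \<circ> H) j * (\<theta> \<circ> H) i"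
      using arg_cong[OF HH[of i j], of \<theta>] by (simp add: hom \<sigma>' split: if_splits)
    show "(\<theta> \<circ> H) i * (\<theta> \<circ> E) j = (\<theta> \<circ> E) j * (\<theta> \<circ> H) i + \<sigma>' (of_int (cartan i j)) * (\<theta> \<circ> E) j"
      using arg_cong[OF HE[of i j], of \<theta>] by (simp add: hom \<sigma>' split: if_splits)
    show "(\<theta> \<circ> H) i * (\<theta> \<circ> F) j = (\<theta> \<circ> F) j * (\<theta> \<circ> H) i - \<sigma>' (of_int (cartan i j)) * (\<theta> \<circ> F) j"
      using arg_cong[OF HF[of i j], of \<theta>] by (simp add: hom \<sigma>' split: if_splits)
    show "(\<theta> \<circ> H) i * (\<theta> \<circ> K) j = (\<theta> \<circ> K) j * (\<theta> \<circ> H) i"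
      using arg_cong[OF HK[of i j], of \<theta>] by (simp add: hom \<sigma>' split: if_splits)
    show "(\<theta> \<circ> H) i * (\<theta> \<circ> L) j = (\<theta> \<circ> L) j * (\<theta> \<circ> H) i"
      using arg_cong[OF HL[of i j], of \<theta>] by (simp add: hom \<sigma>' split: if_splits)
    show "(\<theta> \<circ> K) i * (\<theta> \<circ> K) j = (\<theta> \<circ> K) j * (\<theta> \<circ> K) i"
      using arg_cong[OF KK[of i j], of \<theta>] by (simp add: hom \<sigma>' split: if_splits)
    show "(\<theta> \<circ> K) i * (\<theta> \<circ> L) i = 1"
      using arg_cong[OF KL[of i], of \<theta>] by (simp add: hom \<sigma>' split: if_splits)
    show "(\<theta> \<circ> L) i * (\<theta> \<circ> K) i = 1"
      using arg_cong[OF LK[of i], of \<theta>] by (simp add: hom \<sigma>' split: if_splits)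
    show "(\<theta> \<circ> L) i * (\<theta> \<circ> L) j = (\<theta> \<circ> L) j * (\<theta> \<circ> L) i"
      using arg_cong[OF LL[of i j], of \<theta>] by (simp add: hom \<sigma>' split: if_splits)
    show "(\<theta> \<circ> K) i * (\<theta> \<circ> E) j = r.q (dot i j) * ((\<theta> \<circ> E) j * (\<theta> \<circ> K) i)"
      using arg_cong[OF KE[of i j], of \<theta>] by (simp add: hom \<sigma>' split: if_splits)
    show "(\<theta> \<circ> K) i * (\<theta> \<circ> F) j = r.q (- dot i j) * ((\<theta> \<circ> F) j * (\<theta> \<circ> K) i)"
      using arg_cong[OF KF[of i j], of \<theta>] by (simp add: hom \<sigma>' split: if_splits)
    show "(\<theta> \<circ> E) i * (\<theta> \<circ> F) j = (\<theta> \<circ> F) j * (\<theta> \<circ> E) i + (if i = j then (\<theta> \<circ> Q) i else 0)"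
      using arg_cong[OF EF[of i j], of \<theta>] by (simp add: hom \<sigma>' split: if_splits)
  qed (use serreE serreF s s' in auto)
qed

end

text \<open>The two families stand for x \<otimes> 1 and 1 \<otimes> y. Commutation is all that is
  used of a tensor product, so the result covers both the completed square of U_h and operators
  acting on different tensor sites.\<close>

locale g2_pair = g2_family \<sigma> E F H K L Q + second: g2_family \<sigma> E' F' H' K' L' Q'
  for \<sigma> :: "complex fps \<Rightarrow> 'a::{ring,monoid_mult}"
    and E F H K L Q E' F' H' K' L' Q' :: "node \<Rightarrow> 'a" +
  assumes comm: "x \<in> gens \<Longrightarrow> y \<in> second.gens \<Longrightarrow> y * x = x * y"
begin

lemma cc:
  "E' i * E j = E j * E' i" "E' i * F j = F j * E' i" "E' i * H j = H j * E' i"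
  "E' i * K j = K j * E' i" "E' i * L j = L j * E' i" "E' i * Q j = Q j * E' i"
  "F' i * E j = E j * F' i" "F' i * F j = F j * F' i" "F' i * H j = H j * F' i"
  "F' i * K j = K j * F' i" "F' i * L j = L j * F' i" "F' i * Q j = Q j * F' i"
  "H' i * E j = E j * H' i" "H' i * F j = F j * H' i" "H' i * H j = H j * H' i"
  "H' i * K j = K j * H' i" "H' i * L j = L j * H' i" "H' i * Q j = Q j * H' i"
  "K' i * E j = E j * K' i" "K' i * F j = F j * K' i" "K' i * H j = H j * K' i"
  "K' i * K j = K j * K' i" "K' i * L j = L j * K' i" "K' i * Q j = Q j * K' i"
  "L' i * E j = E j * L' i" "L' i * F j = F j * L' i" "L' i * H j = H j * L' i"
  "L' i * K j = K j * L' i" "L' i * L j = L j * L' i" "L' i * Q j = Q j * L' i"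
  "Q' i * E j = E j * Q' i" "Q' i * F j = F j * Q' i" "Q' i * H j = H j * Q' i"
  "Q' i * K j = K j * Q' i" "Q' i * L j = L j * Q' i" "Q' i * Q j = Q j * Q' i"
  by (rule comm; simp)+

lemmas cc_left = cc[THEN mult_left_rule, unfolded mult.assoc]

lemma \<sigma>_left_gens:
  "x \<in> gens \<Longrightarrow> x * (\<sigma> c * w) = \<sigma> c * (x * w)" "x \<in> second.gens \<Longrightarrow> x * (\<sigma> c * w) = \<sigma> c * (x * w)"
  by (rule \<sigma>_left_commute)+

definition "Ep i = E i * K' i + E' i"
definition "Fp i = F i + L i * F' i"
definition "Hp i = H i + H' i"
definition "Kp i = K i * K' i"
definition "Lp i = L i * L' i"
definition "Qp i = Q i * K' i + L i * Q' i"

lemma q_left_gens: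
  "x \<in> gens \<Longrightarrow> x * (q k * w) = q k * (x * w)" "x \<in> second.gens \<Longrightarrow> x * (q k * w) = q k * (x * w)"
  by (rule q_left_commute)+

lemma serre_product:
  "serre12 (Ep Node1) (Ep Node2)" "serre21 (Ep Node1) (Ep Node2)"
  "serre12 (Fp Node1) (Fp Node2)" "serre21 (Fp Node1) (Fp Node2)"
proof -
  have ab: "(E i * K' i) * E' j = q (dot i j) * (E' j * (E i * K' i))" for i j
    by (simp add: mult.assoc second.KE cc cc_left q_left_gens)
  note abs = ab[of Node1 Node1, unfolded dot_simps] ab[of Node1 Node2, unfolded dot_simps]
    ab[of Node2 Node1, unfolded dot_simps] ab[of Node2 Node2, unfolded dot_simps]
  \<comment> \<open>For F the roles are exchanged: F_i' L_i takes the part of a_i and F_i that of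
    b_i, because moving L_i past F_j produces the positive exponent.\<close>
  have ab': "(F' i * L i) * F j = q (dot i j) * (F j * (F' i * L i))" for i j
    by (simp add: mult.assoc LF LF[THEN mult_left_rule] cc cc_left q_left_gens)
  note ab's = ab'[of Node1 Node1, unfolded dot_simps] ab'[of Node1 Node2, unfolded dot_simps]
    ab'[of Node2 Node1, unfolded dot_simps] ab'[of Node2 Node2, unfolded dot_simps]
  have t: "serre12 (E Node1 * K' Node1) (E Node2 * K' Node2)" "serre21 (E Node1 * K' Node1) (E Node2 * K' Node2)"
    by (rule twist; simp add: cc second.KK[of Node1 Node2] serreE)+
  have t': "serre12 (F' Node1 * L Node1) (F' Node2 * L Node2)" "serre21 (F' Node1 * L Node1) (F' Node2 * L Node2)"
    by (rule twist; simp add: cc LL[of Node1 Node2] second.serreF)+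
  show "serre12 (Ep Node1) (Ep Node2)" "serre21 (Ep Node1) (Ep Node2)"
    unfolding Ep_def
    using serre12_sum[OF abs] serre21_sum[OF abs] t second.serreE by simp_all
  have F: "Fp i = F' i * L i + F i" for i by (simp add: Fp_def cc add.commute)
  show "serre12 (Fp Node1) (Fp Node2)" "serre21 (Fp Node1) (Fp Node2)"
    unfolding F
    using serre12_sum[OF ab's] serre21_sum[OF ab's] t' serreF by simp_all
qed

text \<open>In the mixed term (E_i K_i')(L_j F_j') the factor q^{-d} from K_i' F_j' cancels the
  factor q^d from E_i L_j, where d = \<open>dot i j\<close>; this uses the symmetry of
  \<open>dot\<close>.\<close>

lemma EF_product: "Ep i * Fp j = Fp j * Ep i + (if i = j then Qp i else 0)"
proof -
  have 1: "E i * (F j * w) = F j * (E i * w) + (if i = j then Q i * w else 0)" for w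
    using arg_cong[OF EF[of i j], of "\<lambda>z. z * w"] by (simp add: algebra_simps split: if_splits)
  have 2: "K' i * F' j = q (- dot i j) * (F' j * K' i)" by (rule second.KF)
  have 3: "E i * L j = q (dot i j) * (L j * E i)"
    using LE[of j i] by (simp add: dot_commute[of j i] q_simps)
  note EL_left = mult_left_rule[OF 3, unfolded mult.assoc]
  show ?thesis
    unfolding Ep_def Fp_def Qp_def
    by (simp add: distrib_left distrib_right mult.assoc cc cc_left 1 2 EL_left second.EF q_left_gens q_simps
        add.assoc add.left_commute)
qed

lemma product_family: "g2_family \<sigma> Ep Fp Hp Kp Lp Qp"
proof
  fix i j
  note r = distrib_left distrib_right left_diff_distrib right_diff_distrib mult.assoc cc cc_left
    q_left_gens \<sigma>_left_gens q_simps
  show "Hp i * Hp j = Hp j * Hp i" by (simp add: Hp_def r HH[of i j] second.HH[of i j] add_ac)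
  show "Hp i * Ep j = Ep j * Hp i + \<sigma> (of_int (cartan i j)) * Ep j"
    by (simp add: Hp_def Ep_def r HE HE[THEN mult_left_rule] second.HE second.HK[of i] add_ac)
  show "Hp i * Fp j = Fp j * Hp i - \<sigma> (of_int (cartan i j)) * Fp j"
    by (simp add: Hp_def Fp_def r HF second.HF HL[of i] HL[of i, THEN mult_left_rule] algebra_simps)
  show "Hp i * Kp j = Kp j * Hp i"
    by (simp add: Hp_def Kp_def r HK[of i] HK[of i, THEN mult_left_rule] second.HK[of i])
  show "Hp i * Lp j = Lp j * Hp i"
    by (simp add: Hp_def Lp_def r HL[of i] HL[of i, THEN mult_left_rule] second.HL[of i])
  show "Kp i * Kp j = Kp j * Kp i"
    by (simp add: Kp_def r KK[of i j] KK[of i j, THEN mult_left_rule] second.KK[of i j])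
  show "Lp i * Lp j = Lp j * Lp i"
    by (simp add: Lp_def r LL[of i j] LL[of i j, THEN mult_left_rule] second.LL[of i j])
  show "Kp i * Lp i = 1" "Lp i * Kp i = 1"
    by (simp_all add: Kp_def Lp_def r KL LK KL[THEN mult_left_rule] LK[THEN mult_left_rule] second.KL second.LK)
  show "Kp i * Ep j = q (dot i j) * (Ep j * Kp i)"
    by (simp add: Kp_def Ep_def r KE KE[THEN mult_left_rule] second.KE second.KK[of i])
  show "Kp i * Fp j = q (- dot i j) * (Fp j * Kp i)"
  proof -
    have KL': "K i * L j = L j * K i"
      using L_intertwine[of j "K i" 0] KK[of j i] by (simp add: q_simps)
    show ?thesis
      by (simp add: Kp_def Fp_def r KF KF[THEN mult_left_rule] second.KF KL' KL'[THEN mult_left_rule])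
  qed
  show "Ep i * Fp j = Fp j * Ep i + (if i = j then Qp i else 0)" by (rule EF_product)
qed (rule serre_product)+

end

section \<open>Killing the defining relations\<close>

context ring_scalars
begin

lemma qdiff_nonzero: "d > 0 \<Longrightarrow> qpow (int d) - qpow (- int d) \<noteq> 0"
  using qdiff_nth(2)[of "int d"] by (metis fps_zero_nth mult_eq_0_iff of_int_eq_0_iff of_nat_0_less_iff
      order_less_irrefl zero_neq_numeral)

lemma qint_eqI:
  assumes "d > 0" "f * (qpow (int d) - qpow (- int d)) = qpow (int (d * m)) - qpow (- int (d * m))"
  shows "qint d m = f"
  unfolding qint_def assms(2)[symmetric] by (rule nonzero_mult_div_cancel_right) (rule qdiff_nonzero[OF assms(1)])

lemma qint_values:
  "d > 0 \<Longrightarrow> qint d 1 = 1"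
  "d > 0 \<Longrightarrow> qint d 2 = qpow (int d) + qpow (- int d)"
  "qint 1 3 = qpow 2 + 1 + qpow (- 2)"
  "qint 1 4 = qpow 3 + qpow 1 + qpow (- 1) + qpow (- 3)"
  by (rule qint_eqI; simp add: algebra_simps qpow_mult)+

lemma qint_nonzero: "d > 0 \<Longrightarrow> m > 0 \<Longrightarrow> qint d m \<noteq> 0"
  using qint_0[of d m] by (metis fps_zero_nth of_nat_eq_0_iff not_gr_zero)

text \<open>The divisions in the definition are exact, so a proposed value is confirmed by
  multiplying back; nonvanishing of the q-factorials makes the quotient unique.\<close>

lemma qbinom_eqI:
  assumes "d > 0" "f * ((\<Prod>j=1..r. qint d j) * (\<Prod>j=1..m-r. qint d j)) = (\<Prod>j=1..m. qint d j)"
  shows "qbinom d m r = f"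
proof -
  have "(\<Prod>j=1..k. qint d j) \<noteq> 0" for k
    using qint_nonzero[OF assms(1)] by (simp add: prod_zero_iff Suc_le_eq)
  then show ?thesis
    unfolding qbinom_def assms(2)[symmetric] by (intro nonzero_mult_div_cancel_right no_zero_divisors)
qed

lemma prod_qint: "(\<Prod>j=1..0. qint d j) = 1" "(\<Prod>j=1..1. qint d j) = qint d 1"
  "(\<Prod>j=1..2. qint d j) = qint d 1 * qint d 2" "(\<Prod>j=1..3. qint d j) = qint d 1 * qint d 2 * qint d 3"
  "(\<Prod>j=1..4. qint d j) = qint d 1 * qint d 2 * qint d 3 * qint d 4"
  by (simp_all add: numeral_eq_Suc prod.nat_ivl_Suc')

lemma qpow_times_2: "qpow a * (2 * x) = 2 * (qpow a * x)"
  by (simp add: algebra_simps)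

lemma qbinom_values:
  "qbinom 3 2 0 = 1" "qbinom 3 2 1 = qpow 3 + qpow (- 3)" "qbinom 3 2 2 = 1"
  "qbinom 1 4 0 = 1" "qbinom 1 4 1 = qpow 3 + qpow 1 + qpow (- 1) + qpow (- 3)"
  "qbinom 1 4 2 = qpow 4 + qpow 2 + 2 + qpow (- 2) + qpow (- 4)"
  "qbinom 1 4 3 = qpow 3 + qpow 1 + qpow (- 1) + qpow (- 3)" "qbinom 1 4 4 = 1"
  by (rule qbinom_eqI, simp, simp only: prod_qint diff_zero diff_self_eq_0 prod_qint arith_simps diff_numeral_special
      numeral_One, simp add: qint_values[unfolded One_nat_def] prod_qint[unfolded One_nat_def] algebra_simps qpow_mult mult_left_rule[OF qpow_mult] qpow_times_2)+

lemma serre12_iff: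
  "serre12 x y \<longleftrightarrow> (\<Sum>r\<le>4. \<sigma> ((-1) ^ r * qbinom 1 4 r) * x ^ (4 - r) * y * x ^ r) = 0"
proof -
  have two: "\<sigma> 2 = 1 + 1" using \<sigma>_add[of 1 1] by (simp add: \<sigma>_1)
  have sum: "(\<Sum>r\<le>4. f r) = f 0 + f 1 + f 2 + f 3 + f 4" for f :: "nat \<Rightarrow> 'a"
    by (simp add: eval_nat_numeral)
  \<comment> \<open>The unit -q^{-3} compensates for \<open>Zel\<close> being x y - q^3 y x rather
    than y x - q^{-3} x y.\<close>
  have "(\<Sum>r\<le>4. \<sigma> ((-1) ^ r * qbinom 1 4 r) * x ^ (4 - r) * y * x ^ r)
    = - (q (- 3) * (Yel x y * x - q 3 * (x * Yel x y)))"
    unfolding sum qbinom_values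
    by (simp add: \<sigma>_add \<sigma>_diff \<sigma>_minus \<sigma>_1 two Yel_def Xel_def Zel_def power4_eq_xxxx power3_eq_cube
        power2_eq_square mult.assoc flip: q_def) (simp add: algebra_simps q_simps q_left_commute[of x] q_left_commute[of y])
  moreover have "q (- 3) * w = 0 \<longleftrightarrow> w = 0" for w
    using q_cancel[of "- 3" w 0] by simp
  ultimately show ?thesis by (simp add: serre12_def)
qed

lemma serre21_iff:
  "serre21 y x \<longleftrightarrow> (\<Sum>r\<le>2. \<sigma> ((-1) ^ r * qbinom 3 2 r) * x ^ (2 - r) * y * x ^ r) = 0"
proof -
  have sum: "(\<Sum>r\<le>2. f r) = f 0 + f 1 + f 2" for f :: "nat \<Rightarrow> 'a"
    by (simp add: eval_nat_numeral)
  have "(\<Sum>r\<le>2. \<sigma> ((-1) ^ r * qbinom 3 2 r) * x ^ (2 - r) * y * x ^ r)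
    = Zel y x * x - q (- 3) * (x * Zel y x)"
    unfolding sum qbinom_values
    by (simp add: \<sigma>_add \<sigma>_diff \<sigma>_minus \<sigma>_1 Zel_def power2_eq_square mult.assoc flip: q_def) (simp add: algebra_simps q_simps q_left_commute[of x] q_left_commute[of y])
  then show ?thesis by (simp add: serre21_def)
qed

end

text \<open>In the applications \<open>\<psi>\<close> is the quotient map onto the completed tensor
  square or the identity. Separatedness of the target is what kills the closure of the ideal of
  relations, not just the ideal itself.\<close>

locale g2_hom = letter_hom \<kappa> \<phi> for \<kappa> :: "complex \<Rightarrow> 'a::ring_1" and \<phi> +
  fixes \<psi> :: "'a fps \<Rightarrow> 'b::{ring,monoid_mult}" and a :: "node \<Rightarrow> 'a"
  assumes \<psi>_add: "\<psi> (x + y) = \<psi> x + \<psi> y" and \<psi>_mult: "\<psi> (x * y) = \<psi> x * \<psi> y" and \<psi>_1: "\<psi> 1 = 1"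
    and \<phi>_H: "\<phi> (HH i) = fps_const (a i)"
    and family: "g2_family (\<lambda>c. \<psi> (fscal c)) (\<lambda>i. \<psi> (\<phi> (XP i))) (\<lambda>i. \<psi> (\<phi> (XM i))) (\<lambda>i. \<psi> (\<phi> (HH i)))
      (\<lambda>i. \<psi> (exph (\<kappa> (of_nat (symm i)) * a i))) (\<lambda>i. \<psi> (exph (- (\<kappa> (of_nat (symm i)) * a i))))
      (\<lambda>i. \<psi> (kquot (symm i) (\<kappa> (of_nat (symm i)) * a i)))"
    and separated: "(\<And>n. \<exists>y. (z :: 'b) = \<psi> fps_X ^ n * y) \<Longrightarrow> z = 0"
begin

sublocale fam: g2_family "\<lambda>c. \<psi> (fscal c)" "\<lambda>i. \<psi> (\<phi> (XP i))" "\<lambda>i. \<psi> (\<phi> (XM i))" "\<lambda>i. \<psi> (\<phi> (HH i))"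
  "\<lambda>i. \<psi> (exph (\<kappa> (of_nat (symm i)) * a i))" "\<lambda>i. \<psi> (exph (- (\<kappa> (of_nat (symm i)) * a i)))"
  "\<lambda>i. \<psi> (kquot (symm i) (\<kappa> (of_nat (symm i)) * a i))"
  by (rule family)

definition "\<Phi> p = \<psi> (ext_series p)"

lemma \<psi>_0: "\<psi> 0 = 0"
  using \<psi>_add[of 0 0] by simp

lemma \<psi>_diff: "\<psi> (x - y) = \<psi> x - \<psi> y"
  using \<psi>_add[of "x - y" y] by simp

lemma \<psi>_power: "\<psi> (x ^ n) = \<psi> x ^ n"
  by (induction n) (simp_all add: \<psi>_1 \<psi>_mult)

lemma \<Phi>_hom: "\<Phi> (p + r) = \<Phi> p + \<Phi> r" "\<Phi> (p - r) = \<Phi> p - \<Phi> r" "\<Phi> (p * r) = \<Phi> p * \<Phi> r"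
  "\<Phi> 1 = 1" "\<Phi> 0 = 0" "\<Phi> (p ^ n) = \<Phi> p ^ n"
  by (simp_all add: \<Phi>_def ext_series_add ext_series_diff ext_series_mult ext_series_1 ext_series_0
      ext_series_power \<psi>_add \<psi>_diff \<psi>_mult \<psi>_1 \<psi>_0 \<psi>_power)

lemma \<Phi>_sum: "\<Phi> (sum f A) = (\<Sum>i\<in>A. \<Phi> (f i))"
  by (induction A rule: infinite_finite_induct) (simp_all add: \<Phi>_hom)

lemma \<Phi>_gens: "\<Phi> (flt g) = \<psi> (\<phi> g)" "\<Phi> (scal c) = \<psi> (fscal c)" "\<Phi> (fps_X ^ n * p) = \<psi> fps_X ^ n * \<Phi> p"
  "\<Phi> (fK i) = \<psi> (exph (\<kappa> (of_nat (symm i)) * a i))"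
  "\<Phi> (fKinv i) = \<psi> (exph (- (\<kappa> (of_nat (symm i)) * a i)))"
  "\<Phi> (fKquot i) = \<psi> (kquot (symm i) (\<kappa> (of_nat (symm i)) * a i))"
  by (simp_all add: \<Phi>_def ext_series_lt ext_series_scal ext_series_X_power_mult ext_series_K[OF \<phi>_H]
      \<psi>_mult \<psi>_power)

lemma \<Phi>_of_int: "\<Phi> (of_int k) = \<psi> (fscal (of_int k))"
proof -
  have "scal (of_int k) = of_int k"
    by (rule fps_ext) (simp add: scal_def fps_of_int[symmetric])
  then show ?thesis by (metis \<Phi>_gens(2))
qed

lemma \<Phi>_serre:
  assumes "i \<noteq> j" and "fam.serre12 (\<Phi> (x Node1)) (\<Phi> (x Node2))" "fam.serre21 (\<Phi> (x Node1)) (\<Phi> (x Node2))"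
  shows "\<Phi> (serre i j (x i) (x j)) = 0"
proof -
  have *: "\<Phi> (serre i j (x i) (x j)) = (\<Sum>r\<le>nat (1 - cartan i j).
      \<psi> (fscal ((-1) ^ r * qbinom (symm i) (nat (1 - cartan i j)) r)) * \<Phi> (x i) ^ (nat (1 - cartan i j) - r) * \<Phi> (x j) * \<Phi> (x i) ^ r)"
    unfolding serre_def Let_def by (simp only: \<Phi>_sum \<Phi>_hom \<Phi>_gens)
  show ?thesis
    unfolding * using assms assms(2)[unfolded fam.serre12_iff] assms(3)[unfolded fam.serre21_iff]
    by (cases i; cases j) simp_all
qed

lemma \<Phi>_rels:
  assumes "r \<in> Uh_rels"
  shows "\<Phi> r = 0"
  using assms
proof cases
  case (1 i j)
  show ?thesis by (simp only: 1 commutator_def \<Phi>_hom \<Phi>_gens fam.HH[of i j] diff_self)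
next
  case (2 i j)
  show ?thesis by (simp only: 2 commutator_def \<Phi>_hom \<Phi>_gens \<Phi>_of_int fam.HE[of i j]) simp
next
  case (3 i j)
  show ?thesis by (simp only: 3 commutator_def \<Phi>_hom \<Phi>_gens \<Phi>_of_int fam.HF[of i j]) simp
next
  case (4 i j)
  have "\<Phi> (if i = j then fKquot i else 0) = (if i = j then \<Phi> (fKquot i) else 0)" by (simp add: \<Phi>_hom)
  then show ?thesis by (simp only: 4 commutator_def \<Phi>_hom \<Phi>_gens fam.EF[of i j]) simp
next
  case (5 i j)
  then show ?thesis using \<Phi>_serre[of i j "\<lambda>i. flt (XP i)"] fam.serreE by (simp add: \<Phi>_gens)
next
  case (6 i j)
  then show ?thesis using \<Phi>_serre[of i j "\<lambda>i. flt (XM i)"] fam.serreF by (simp add: \<Phi>_gens)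
qed

lemma \<Phi>_ideal:
  assumes "p \<in> Uh_ideal"
  shows "\<Phi> p = 0"
proof (rule separated)
  fix n
  have *: "\<Phi> s = 0" if "s \<in> ideal_gen Uh_rels" for s
    using that by induction (simp_all add: \<Phi>_hom \<Phi>_rels)
  obtain s y where "s \<in> ideal_gen Uh_rels" "p = s + fps_X ^ n * y"
    using assms unfolding Uh_ideal_def by (rule adic_closureE)
  then have "\<Phi> p = \<psi> fps_X ^ n * \<Phi> y" by (simp only: \<Phi>_hom(1) * \<Phi>_gens(3) add_0)
  then show "\<exists>y. \<Phi> p = \<psi> fps_X ^ n * y" by blast
qed

lemma \<Phi>_cong: "abs_Uh p = abs_Uh r \<Longrightarrow> \<Phi> p = \<Phi> r"
  using \<Phi>_ideal[of "p - r"] by (simp add: abs_Uh_eq_iff \<Phi>_hom)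

definition Hom :: "Uh \<Rightarrow> 'b" where "Hom u = \<Phi> (rep_Uh u)"

lemma Hom_abs: "Hom (abs_Uh p) = \<Phi> p"
  unfolding Hom_def by (rule \<Phi>_cong) (simp add: Quotient_abs_rep[OF Quotient_Uh])

lemma Hom_hom: "Hom (x + y) = Hom x + Hom y" "Hom (x - y) = Hom x - Hom y" "Hom (x * y) = Hom x * Hom y"
  "Hom 1 = 1" "Hom 0 = 0"
proof -
  obtain p r where "x = abs_Uh p" "y = abs_Uh r" by (metis Uh_cases)
  then show "Hom (x + y) = Hom x + Hom y" "Hom (x - y) = Hom x - Hom y" "Hom (x * y) = Hom x * Hom y"
    by (simp_all add: plus_Uh.abs_eq minus_Uh.abs_eq times_Uh.abs_eq Hom_abs \<Phi>_hom)
qed (simp_all add: one_Uh_def zero_Uh_def Hom_abs \<Phi>_hom)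

lemma Hom_power: "Hom (x ^ n) = Hom x ^ n"
  by (induction n) (simp_all add: Hom_hom)

lemma Hom_sum: "Hom (sum f A) = (\<Sum>i\<in>A. Hom (f i))"
  by (induction A rule: infinite_finite_induct) (simp_all add: Hom_hom)

lemma Hom_gens: "Hom (Uh_scal c) = \<psi> (fscal c)" "Hom (Uh_h ^ n * x) = \<psi> fps_X ^ n * Hom x"
  "Hom (Uh_H i) = \<psi> (\<phi> (HH i))" "Hom (Uh_E i) = \<psi> (\<phi> (XP i))"
  "Hom (Uh_K i) = \<psi> (exph (\<kappa> (of_nat (symm i)) * a i))"
proof -
  obtain p where "x = abs_Uh p" by (metis Uh_cases)
  then show "Hom (Uh_h ^ n * x) = \<psi> fps_X ^ n * Hom x"
    by (simp add: Uh_h_power_mult Hom_abs \<Phi>_gens)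
qed (simp_all add: Uh_scal_def Uh_H_def Uh_E_def Uh_K_def Hom_abs \<Phi>_gens)

end

section \<open>The generators of U_h as a family\<close>

context scalar_algebra
begin

text \<open>If h p = p (h + c) modulo I, then e^{t d h} p = p e^{t d (h + c)} with t the series
  variable, and the central summand contributes the scalar e^{t d c}. With d = d_i and c = a_ij this
  is K_i E_j = q^{d_i a_ij} E_j K_i.\<close>

lemma exph_q_intertwine:
  assumes I: "two_sided_ideal I" and closed: "adic_closure fps_X I = I"
    and hp: "fps_const h * p - p * fps_const h - fps_const (\<kappa> c) * p \<in> I"
  shows "exph (\<kappa> d * h) * p - fscal (fps_exp (d * c)) * (p * exph (\<kappa> d * h)) \<in> I"
proof -
  interpret two_sided_ideal I by fact
  have "fps_const (\<kappa> d * h) * p - p * fps_const (\<kappa> d * h + \<kappa> (d * c))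
      = fps_const (\<kappa> d) * (fps_const h * p - p * fps_const h - fps_const (\<kappa> c) * p)"
  proof -
    have "p * fps_const (\<kappa> c) = fps_const (\<kappa> c) * p"
      by (metis fscal_const fscal_central)
    moreover have "fps_const (\<kappa> d * h + \<kappa> (d * c)) = fps_const (\<kappa> d) * (fps_const h + fps_const (\<kappa> c))"
      by (simp add: \<kappa>_mult distrib_left)
    ultimately show ?thesis
      by (simp only: const_\<kappa>_left_commute[of p] right_diff_distrib distrib_left fps_const_mult[symmetric] mult.assoc diff_diff_add)
  qed
  then have "fps_const (\<kappa> d * h) * p - p * fps_const (\<kappa> d * h + \<kappa> (d * c)) \<in> I"
    using left_mem[OF hp] by simp
  from exph_intertwine[OF I closed this] show ?thesis
    by (simp only: exph_add_\<kappa> fscal_left_commute)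
qed

end

interpretation cst_free: scalar_algebra "cst :: complex \<Rightarrow> free"
proof
  fix c and x :: free
  show "cst c * x = x * cst c"
    by (induction x rule: free_induct) (simp_all add: mult_single algebra_simps)
qed (simp_all add: cst_simps)

interpretation cst_free2: scalar_algebra "cst :: complex \<Rightarrow> free2"
proof
  fix c and x :: free2
  show "cst c * x = x * cst c"
    by (induction x rule: free_induct) (simp_all add: mult_single algebra_simps)
qed (simp_all add: cst_simps)

lemma fscal_cst: "cst_free.fscal = scal" "cst_free2.fscal = scal"
  by (rule ext; simp add: cst_free.fscal_def cst_free2.fscal_def scal_def)+

lemma K_exph: "fK i = cst_free.exph (cst (of_nat (symm i)) * lt (HH i))"
  "fKinv i = cst_free.exph (- (cst (of_nat (symm i)) * lt (HH i)))"
  "fKquot i = cst_free.kquot (symm i) (cst (of_nat (symm i)) * lt (HH i))"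
  by (simp_all add: fK_def fKinv_def fKquot_def cst_free.kquot_def hexp_def cst_free.exph_def fscal_cst)

definition "Uh_F i = abs_Uh (flt (XM i))"
definition "Uh_L i = abs_Uh (fKinv i)"
definition "Uh_Q i = abs_Uh (fKquot i)"

interpretation Uh: ring_scalars Uh_scal
proof
  fix c d x
  show "Uh_scal (c + d) = Uh_scal c + Uh_scal d" "Uh_scal (c * d) = Uh_scal c * Uh_scal d" "Uh_scal 1 = 1"
    using cst_free.fscal_hom by (simp_all add: Uh_scal_def abs_Uh_hom fscal_cst)
  obtain p where "x = abs_Uh p" by (metis Uh_cases)
  then show "Uh_scal c * x = x * Uh_scal c"
    using cst_free.fscal_central[of c p] by (simp add: Uh_scal_def times_Uh.abs_eq fscal_cst)
qed

lemma Uh_rel: "r \<in> Uh_rels \<Longrightarrow> abs_Uh r = 0"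
proof -
  assume "r \<in> Uh_rels"
  then have "1 * r * 1 \<in> ideal_gen Uh_rels" by (rule ideal_gen.gen)
  then have "r \<in> Uh_ideal" unfolding Uh_ideal_def using subset_adic_closure by auto
  then show ?thesis by (simp add: abs_Uh_0_iff)
qed

lemma scal_of_int: "scal (of_int k) = of_int k"
  by (rule fps_ext) (simp add: scal_def fps_of_int[symmetric])

interpretation Uh: g2_family Uh_scal Uh_E Uh_F Uh_H Uh_K Uh_L Uh_Q
proof -
  let ?n = "\<lambda>i. of_nat (symm i) :: complex"
  have I: "two_sided_ideal Uh_ideal" by (rule two_sided_ideal_Uh)
  have closed: "adic_closure fps_X Uh_ideal = Uh_ideal"
    by (simp add: Uh_ideal_def adic_closure_idem)
  note defs = Uh_E_def Uh_F_def Uh_H_def Uh_K_def Uh_L_def Uh_Q_def Uh_scal_def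
  have relE: "Uh_H i * Uh_E j = Uh_E j * Uh_H i + Uh_scal (of_int (cartan i j)) * Uh_E j" for i j
    using Uh_rel[OF Uh_rels.intros(2)[of i j]]
    by (simp only: commutator_def abs_Uh_hom defs scal_of_int) (simp add: algebra_simps)
  have relF: "Uh_H i * Uh_F j = Uh_F j * Uh_H i - Uh_scal (of_int (cartan i j)) * Uh_F j" for i j
    using Uh_rel[OF Uh_rels.intros(3)[of i j]]
    by (simp only: commutator_def abs_Uh_hom defs scal_of_int) (simp add: algebra_simps)
  have K: "Uh_K i * abs_Uh (flt g) = Uh.q (int (symm i) * k) * (abs_Uh (flt g) * Uh_K i)"
    if "abs_Uh (flt (HH i)) * abs_Uh (flt g) - abs_Uh (flt g) * abs_Uh (flt (HH i)) = Uh_scal (of_int k) * abs_Uh (flt g)" for i g k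
  proof -
    have "fps_const (cst (of_int k)) = (scal (of_int k) :: free fps)"
      by (rule cst_free.fscal_const[of "of_int k", unfolded fscal_cst fps_of_int, symmetric])
    then have "abs_Uh (flt (HH i) * flt g - flt g * flt (HH i) - fps_const (cst (of_int k)) * flt g) = 0"
      using that by (simp only: abs_Uh_hom Uh_scal_def diff_self)
    then have "flt (HH i) * flt g - flt g * flt (HH i) - fps_const (cst (of_int k)) * flt g \<in> Uh_ideal"
      by (simp only: abs_Uh_0_iff)
    from cst_free.exph_q_intertwine[OF I closed this, of "?n i"] show ?thesis
      by (simp only: Uh_K_def K_exph Uh.q_def Uh_scal_def qpow_def fscal_cst
          abs_Uh_eq_iff times_Uh.abs_eq of_int_mult of_int_of_nat_eq)
  qed
  have HH: "Uh_H i * Uh_H j = Uh_H j * Uh_H i" for i j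
    using Uh_rel[OF Uh_rels.intros(1)[of i j]] by (simp only: commutator_def abs_Uh_hom defs) simp
  \<comment> \<open>Commutation with an exponential is the case of weight 0 of the intertwining
    lemma.\<close>
  have Hexp: "Uh_H i * abs_Uh (cst_free.exph (cst c * lt (HH j))) = abs_Uh (cst_free.exph (cst c * lt (HH j))) * Uh_H i" for i j c
  proof -
    have "abs_Uh (flt (HH j) * flt (HH i) - flt (HH i) * flt (HH j) - fps_const (cst 0) * flt (HH i)) = 0"
      using HH[of i j] by (simp add: defs abs_Uh_hom del: fps_const_mult fps_const_sub)
    then have "flt (HH j) * flt (HH i) - flt (HH i) * flt (HH j) - fps_const (cst 0) * flt (HH i) \<in> Uh_ideal"
      by (simp only: abs_Uh_0_iff)
    from cst_free.exph_q_intertwine[OF I closed this, of c]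
    have "abs_Uh (cst_free.exph (cst c * lt (HH j)) * flt (HH i)) = abs_Uh (flt (HH i) * cst_free.exph (cst c * lt (HH j)))"
      by (simp only: abs_Uh_eq_iff mult_zero_right fps_exp_0 cst_free.fscal_hom mult_1_left)
    then show ?thesis by (simp only: Uh_H_def times_Uh.abs_eq)
  qed
  have expexp: "abs_Uh (cst_free.exph (cst c * lt (HH i))) * abs_Uh (cst_free.exph (cst d * lt (HH j)))
      = abs_Uh (cst_free.exph (cst d * lt (HH j))) * abs_Uh (cst_free.exph (cst c * lt (HH i)))" for c d i j
  proof -
    let ?p = "cst_free.exph (cst d * lt (HH j))"
    have "abs_Uh (flt (HH i) * ?p - ?p * flt (HH i) - fps_const (cst 0) * ?p) = 0"
      using Hexp[of i d j] by (simp add: defs abs_Uh_hom del: fps_const_mult fps_const_sub)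
    then have "flt (HH i) * ?p - ?p * flt (HH i) - fps_const (cst 0) * ?p \<in> Uh_ideal"
      by (simp only: abs_Uh_0_iff)
    from cst_free.exph_q_intertwine[OF I closed this, of c] show ?thesis
      by (simp only: abs_Uh_eq_iff mult_zero_right fps_exp_0 cst_free.fscal_hom mult_1_left times_Uh.abs_eq)
  qed
  have neg: "- (cst c * lt (HH i)) = cst (- c) * lt (HH i)" for c i
    by (simp add: single_uminus)
  show "g2_family Uh_scal Uh_E Uh_F Uh_H Uh_K Uh_L Uh_Q"
  proof
    fix i j
    show "Uh_H i * Uh_H j = Uh_H j * Uh_H i" by (rule HH)
    show "Uh_H i * Uh_E j = Uh_E j * Uh_H i + Uh_scal (of_int (cartan i j)) * Uh_E j" by (rule relE)
    show "Uh_H i * Uh_F j = Uh_F j * Uh_H i - Uh_scal (of_int (cartan i j)) * Uh_F j" by (rule relF)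
    show "Uh_H i * Uh_K j = Uh_K j * Uh_H i" "Uh_H i * Uh_L j = Uh_L j * Uh_H i"
      unfolding Uh_K_def Uh_L_def K_exph neg by (rule Hexp)+
    show "Uh_K i * Uh_K j = Uh_K j * Uh_K i" "Uh_L i * Uh_L j = Uh_L j * Uh_L i"
      unfolding Uh_K_def Uh_L_def K_exph neg by (rule expexp)+
    show "Uh_K i * Uh_L i = 1" "Uh_L i * Uh_K i = 1"
      unfolding Uh_K_def Uh_L_def K_exph times_Uh.abs_eq cst_free.exph_minus one_Uh_def by simp_all
    show "Uh_K i * Uh_E j = Uh.q (dot i j) * (Uh_E j * Uh_K i)"
      unfolding dot_def Uh_E_def using relE[of i j] by (intro K) (simp add: defs)
    show "Uh_K i * Uh_F j = Uh.q (- dot i j) * (Uh_F j * Uh_K i)"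
    proof -
      have "abs_Uh (flt (HH i)) * abs_Uh (flt (XM j)) - abs_Uh (flt (XM j)) * abs_Uh (flt (HH i))
          = Uh_scal (of_int (- cartan i j)) * abs_Uh (flt (XM j))"
        using relF[of i j] by (simp add: Uh_H_def Uh_F_def Uh.\<sigma>_minus)
      from K[OF this] show ?thesis by (simp add: dot_def Uh_F_def)
    qed
    show "Uh_E i * Uh_F j = Uh_F j * Uh_E i + (if i = j then Uh_Q i else 0)"
      using Uh_rel[OF Uh_rels.intros(4)[of i j]]
      by (cases "i = j") (simp_all only: commutator_def abs_Uh_hom defs if_True if_False simp_thms, simp_all add: algebra_simps)
  next
    have serre: "abs_Uh (serre i j (flt x) (flt y)) = (\<Sum>r\<le>nat (1 - cartan i j).
      Uh_scal ((-1) ^ r * qbinom (symm i) (nat (1 - cartan i j)) r) * abs_Uh (flt x) ^ (nat (1 - cartan i j) - r) * abs_Uh (flt y) * abs_Uh (flt x) ^ r)" for i j x y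
      unfolding serre_def Let_def Uh_scal_def by (simp only: abs_Uh_sum abs_Uh_hom abs_Uh_power)
    have s12: "Uh.serre12 x y" if "(\<Sum>r\<le>4. Uh_scal ((-1) ^ r * qbinom 1 4 r) * x ^ (4 - r) * y * x ^ r) = 0" for x y
      using that Uh.serre12_iff by simp
    have s21: "Uh.serre21 y x" if "(\<Sum>r\<le>2. Uh_scal ((-1) ^ r * qbinom 3 2 r) * x ^ (2 - r) * y * x ^ r) = 0" for x y
      using that Uh.serre21_iff by simp
    show "Uh.serre12 (Uh_E Node1) (Uh_E Node2)"
      by (rule s12) (use Uh_rel[OF Uh_rels.intros(5)[of Node1 Node2]] in \<open>simp add: serre Uh_E_def\<close>)
    show "Uh.serre12 (Uh_F Node1) (Uh_F Node2)"
      by (rule s12) (use Uh_rel[OF Uh_rels.intros(6)[of Node1 Node2]] in \<open>simp add: serre Uh_F_def\<close>)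
    show "Uh.serre21 (Uh_E Node1) (Uh_E Node2)"
      by (rule s21) (use Uh_rel[OF Uh_rels.intros(5)[of Node2 Node1]] in \<open>simp add: serre Uh_E_def\<close>)
    show "Uh.serre21 (Uh_F Node1) (Uh_F Node2)"
      by (rule s21) (use Uh_rel[OF Uh_rels.intros(6)[of Node2 Node1]] in \<open>simp add: serre Uh_F_def\<close>)
  qed
qed

section \<open>The comultiplication is a homomorphism\<close>

definition "Uh2_scal c = abs_Uh2 (scal c)"
definition "left_Uh u = tensor_Uh u 1"
definition "right_Uh u = tensor_Uh 1 u"

interpretation Uh2: ring_scalars Uh2_scal
proof
  fix c d x
  show "Uh2_scal (c + d) = Uh2_scal c + Uh2_scal d" "Uh2_scal (c * d) = Uh2_scal c * Uh2_scal d" "Uh2_scal 1 = 1"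
    using cst_free2.fscal_hom by (simp_all add: Uh2_scal_def abs_Uh2_hom fscal_cst)
  obtain p where "x = abs_Uh2 p" by (metis Uh2_cases)
  then show "Uh2_scal c * x = x * Uh2_scal c"
    using cst_free2.fscal_central[of c p] by (simp add: Uh2_scal_def times_Uh2.abs_eq fscal_cst)
qed

lemma left_Uh_abs: "left_Uh (abs_Uh p) = abs_Uh2 (ftens p 1)"
  and right_Uh_abs: "right_Uh (abs_Uh p) = abs_Uh2 (ftens 1 p)"
  by (simp_all add: left_Uh_def right_Uh_def one_Uh_def tensor_Uh.abs_eq)

lemma tens_cst: "tens (cst c) 1 = cst c" "tens 1 (cst c) = cst c"
  by (simp_all add: tens_single zero_prod_def flip: single_one)

lemma ftens_scal: "ftens (scal c) 1 = scal c" "ftens 1 (scal c) = scal c"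
  by (rule fps_ext; simp add: ftens_1_nth scal_def tens_cst)+

lemma ftens_1: "ftens 1 1 = 1"
  using ftens_X[of 0] by simp

lemma ftens_commute: "ftens 1 r * ftens p 1 = ftens p 1 * ftens 1 r"
proof (rule fps_ext)
  fix n
  have "fps_nth (ftens 1 r * ftens p 1) n = (\<Sum>i\<le>n. tens (fps_nth p (n - i)) (fps_nth r i))"
    by (simp add: fps_mult_nth ftens_1_nth atLeast0AtMost flip: tens_mult)
  also have "\<dots> = (\<Sum>i\<le>n. tens (fps_nth p i) (fps_nth r (n - i)))"
    by (rule sum.reindex_bij_witness[of _ "\<lambda>i. n - i" "\<lambda>i. n - i"]) auto
  finally show "fps_nth (ftens 1 r * ftens p 1) n = fps_nth (ftens p 1 * ftens 1 r) n"
    by (simp add: fps_mult_nth ftens_1_nth atLeast0AtMost flip: tens_mult)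
qed

lemma left_Uh_hom: "left_Uh (x + y) = left_Uh x + left_Uh y" "left_Uh (x * y) = left_Uh x * left_Uh y"
    "left_Uh 1 = 1"
  and right_Uh_hom: "right_Uh (x + y) = right_Uh x + right_Uh y" "right_Uh (x * y) = right_Uh x * right_Uh y"
    "right_Uh 1 = 1"
proof -
  obtain p r where "x = abs_Uh p" "y = abs_Uh r" by (metis Uh_cases)
  then show "left_Uh (x + y) = left_Uh x + left_Uh y" "left_Uh (x * y) = left_Uh x * left_Uh y"
    "right_Uh (x + y) = right_Uh x + right_Uh y" "right_Uh (x * y) = right_Uh x * right_Uh y"
    by (simp_all add: plus_Uh.abs_eq times_Uh.abs_eq plus_Uh2.abs_eq times_Uh2.abs_eq left_Uh_abs right_Uh_abs
        ftens_add ftens_1_mult)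
qed (simp_all add: one_Uh_def left_Uh_abs right_Uh_abs ftens_1 one_Uh2_def)

lemma right_left_commute: "right_Uh v * left_Uh u = left_Uh u * right_Uh v"
  and tensor_Uh_left_right: "tensor_Uh u v = left_Uh u * right_Uh v"
proof -
  obtain p r where "u = abs_Uh p" "v = abs_Uh r" by (metis Uh_cases)
  then show "right_Uh v * left_Uh u = left_Uh u * right_Uh v" "tensor_Uh u v = left_Uh u * right_Uh v"
    by (simp_all add: left_Uh_abs right_Uh_abs times_Uh2.abs_eq ftens_commute tensor_Uh.abs_eq ftens_split[of p r])
qed

lemma left_Uh_scal: "left_Uh (Uh_scal c) = Uh2_scal c" and right_Uh_scal: "right_Uh (Uh_scal c) = Uh2_scal c"
  by (simp_all add: Uh_scal_def Uh2_scal_def left_Uh_abs right_Uh_abs ftens_scal)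

interpretation left: g2_family Uh2_scal "left_Uh \<circ> Uh_E" "left_Uh \<circ> Uh_F" "left_Uh \<circ> Uh_H"
  "left_Uh \<circ> Uh_K" "left_Uh \<circ> Uh_L" "left_Uh \<circ> Uh_Q"
  by (rule Uh.image_family) (simp_all add: left_Uh_hom left_Uh_scal Uh2.ring_scalars_axioms)

interpretation right: g2_family Uh2_scal "right_Uh \<circ> Uh_E" "right_Uh \<circ> Uh_F" "right_Uh \<circ> Uh_H"
  "right_Uh \<circ> Uh_K" "right_Uh \<circ> Uh_L" "right_Uh \<circ> Uh_Q"
  by (rule Uh.image_family) (simp_all add: right_Uh_hom right_Uh_scal Uh2.ring_scalars_axioms)

interpretation lr: g2_pair Uh2_scal "left_Uh \<circ> Uh_E" "left_Uh \<circ> Uh_F" "left_Uh \<circ> Uh_H"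
  "left_Uh \<circ> Uh_K" "left_Uh \<circ> Uh_L" "left_Uh \<circ> Uh_Q"
  "right_Uh \<circ> Uh_E" "right_Uh \<circ> Uh_F" "right_Uh \<circ> Uh_H"
  "right_Uh \<circ> Uh_K" "right_Uh \<circ> Uh_L" "right_Uh \<circ> Uh_Q"
proof
  fix x y assume "x \<in> left.gens" "y \<in> right.gens"
  then obtain u v where "x = left_Uh u" "y = right_Uh v" unfolding left.gens_def right.gens_def by auto
  then show "y * x = x * y" by (simp add: right_left_commute)
qed

lemma tens_power: "tens (x ^ n) 1 = tens x 1 ^ n" "tens 1 (x ^ n) = tens 1 x ^ n"
  by (induction n) (use tens_mult[of x _ 1 1] tens_mult[of 1 1 x] in \<open>simp_all add: tens_1\<close>)

lemma tens_cst_mult: "tens (cst c * x) 1 = cst c * tens x 1" "tens 1 (cst c * x) = cst c * tens 1 x"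
  using tens_mult[of "cst c" x 1 1] tens_mult[of 1 1 "cst c" x] by (simp_all add: tens_cst)

lemma exph_tens: "cst_free2.exph (tens x 1) = ftens (cst_free.exph x) 1"
  "cst_free2.exph (tens 1 x) = ftens 1 (cst_free.exph x)"
  by (rule fps_ext; simp add: ftens_1_nth cst_free.exph_def cst_free2.exph_def tens_cst_mult tens_power)+

lemma ftens_shift: "ftens (fps_shift 1 p) 1 = fps_shift 1 (ftens p 1)" "ftens 1 (fps_shift 1 p) = fps_shift 1 (ftens 1 p)"
  by (rule fps_ext; simp add: ftens_1_nth)+

lemma tens_minus: "tens (- x) y = - tens x y" "tens x (- y) = - tens x y"
  using tens_diff(1)[of 0 x y] tens_diff(2)[of x 0 y] by (simp_all add: tens_simps)

lemma kquot_tens: "cst_free2.kquot d (tens x 1) = ftens (cst_free.kquot d x) 1"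
  "cst_free2.kquot d (tens 1 x) = ftens 1 (cst_free.kquot d x)"
  unfolding cst_free2.kquot_def cst_free.kquot_def ftens_1_mult fscal_cst ftens_scal ftens_shift ftens_diff
    exph_tens[symmetric] tens_minus by (rule refl)+

abbreviation (input) "Hsum i \<equiv> tens (lt (HH i)) 1 + tens 1 (lt (HH i))"

lemma flt_tens: "ftens (flt g) 1 = fps_const (tens (lt g) 1)" "ftens 1 (flt g) = fps_const (tens 1 (lt g))"
  by (rule fps_ext; simp add: ftens_1_nth tens_simps)+

lemma Hsum_exp:
  fixes i
  defines "x \<equiv> cst (of_nat (symm i)) * lt (HH i)"
  shows "cst (of_nat (symm i)) * Hsum i = tens x 1 + tens 1 x"
    and "cst_free2.exph (cst (of_nat (symm i)) * Hsum i) = ftens (fK i) 1 * ftens 1 (fK i)"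
    and "cst_free2.exph (- (cst (of_nat (symm i)) * Hsum i)) = ftens (fKinv i) 1 * ftens 1 (fKinv i)"
    and "cst_free2.kquot (symm i) (cst (of_nat (symm i)) * Hsum i)
      = ftens (fKquot i) 1 * ftens 1 (fK i) + ftens (fKinv i) 1 * ftens 1 (fKquot i)"
proof -
  have c: "tens y 1 * tens 1 z = tens 1 z * tens y 1" for y z
    using tens_mult[of y 1 1 z] tens_mult[of 1 y z 1] by simp
  show eq: "cst (of_nat (symm i)) * Hsum i = tens x 1 + tens 1 x"
    by (simp only: x_def tens_cst_mult distrib_left)
  then have neg: "- (cst (of_nat (symm i)) * Hsum i) = tens (- x) 1 + tens 1 (- x)"
    by (simp only: tens_minus minus_add_distrib)
  have K: "fK i = cst_free.exph x" "fKinv i = cst_free.exph (- x)" "fKquot i = cst_free.kquot (symm i) x"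
    unfolding x_def by (rule K_exph)+
  show "cst_free2.exph (cst (of_nat (symm i)) * Hsum i) = ftens (fK i) 1 * ftens 1 (fK i)"
    unfolding eq K exph_tens[symmetric] by (rule cst_free2.exph_add[OF c])
  show "cst_free2.exph (- (cst (of_nat (symm i)) * Hsum i)) = ftens (fKinv i) 1 * ftens 1 (fKinv i)"
    unfolding neg K exph_tens[symmetric] by (rule cst_free2.exph_add[OF c])
  show "cst_free2.kquot (symm i) (cst (of_nat (symm i)) * Hsum i)
      = ftens (fKquot i) 1 * ftens 1 (fK i) + ftens (fKinv i) 1 * ftens 1 (fKquot i)"
    unfolding eq K exph_tens[symmetric] kquot_tens[symmetric] tens_minus by (rule cst_free2.kquot_add[OF c])
qed

text \<open>Here the compatibility of Delta with the relations is established: the images of the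
  letters form the product of the two commuting copies of U_h in its completed square. In particular
  the choice of representatives in \<open>comult\<close> is immaterial.\<close>

interpretation comult: g2_hom "cst :: complex \<Rightarrow> free2" comult_letter abs_Uh2 Hsum
proof (intro g2_hom.intro g2_hom_axioms.intro)
  show "letter_hom (cst :: complex \<Rightarrow> free2)" by unfold_locales
  show "abs_Uh2 (x + y) = abs_Uh2 x + abs_Uh2 y" "abs_Uh2 (x * y) = abs_Uh2 x * abs_Uh2 y" for x y
    by (simp_all add: abs_Uh2_hom)
  show "abs_Uh2 1 = 1" by (simp add: one_Uh2_def)
  show "comult_letter (HH i) = fps_const (Hsum i)" for i
    by (simp add: flt_tens)
  have "g2_family Uh2_scal lr.Ep lr.Fp lr.Hp lr.Kp lr.Lp lr.Qp" by (rule lr.product_family)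
  moreover have "lr.Ep = (\<lambda>i. abs_Uh2 (comult_letter (XP i)))"
    unfolding lr.Ep_def
    by (rule ext) (simp only: o_def Uh_E_def Uh_K_def left_Uh_abs right_Uh_abs comult_letter.simps
        ftens_split[of "flt _" "fK _"] plus_Uh2.abs_eq times_Uh2.abs_eq)
  moreover have "lr.Fp = (\<lambda>i. abs_Uh2 (comult_letter (XM i)))"
    unfolding lr.Fp_def
    by (rule ext) (simp only: o_def Uh_F_def Uh_L_def left_Uh_abs right_Uh_abs comult_letter.simps
        ftens_split[of "fKinv _" "flt _"] plus_Uh2.abs_eq times_Uh2.abs_eq)
  moreover have "lr.Hp = (\<lambda>i. abs_Uh2 (comult_letter (HH i)))"
    unfolding lr.Hp_def
    by (rule ext) (simp only: o_def Uh_H_def left_Uh_abs right_Uh_abs comult_letter.simps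
        plus_Uh2.abs_eq times_Uh2.abs_eq)
  moreover have "lr.Kp = (\<lambda>i. abs_Uh2 (cst_free2.exph (cst (of_nat (symm i)) * Hsum i)))"
    unfolding lr.Kp_def
    by (rule ext) (simp only: o_def Uh_K_def left_Uh_abs right_Uh_abs Hsum_exp(2-)
        plus_Uh2.abs_eq times_Uh2.abs_eq)
  moreover have "lr.Lp = (\<lambda>i. abs_Uh2 (cst_free2.exph (- (cst (of_nat (symm i)) * Hsum i))))"
    unfolding lr.Lp_def
    by (rule ext) (simp only: o_def Uh_L_def left_Uh_abs right_Uh_abs Hsum_exp(2-)
        plus_Uh2.abs_eq times_Uh2.abs_eq)
  moreover have "lr.Qp = (\<lambda>i. abs_Uh2 (cst_free2.kquot (symm i) (cst (of_nat (symm i)) * Hsum i)))"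
    unfolding lr.Qp_def
    by (rule ext) (simp only: o_def Uh_K_def Uh_L_def Uh_Q_def left_Uh_abs right_Uh_abs Hsum_exp(2-)
        plus_Uh2.abs_eq times_Uh2.abs_eq)
  ultimately show "g2_family (\<lambda>c. abs_Uh2 (cst_free2.fscal c)) (\<lambda>i. abs_Uh2 (comult_letter (XP i)))
     (\<lambda>i. abs_Uh2 (comult_letter (XM i))) (\<lambda>i. abs_Uh2 (comult_letter (HH i)))
     (\<lambda>i. abs_Uh2 (cst_free2.exph (cst (of_nat (symm i)) * Hsum i)))
     (\<lambda>i. abs_Uh2 (cst_free2.exph (- (cst (of_nat (symm i)) * Hsum i))))
     (\<lambda>i. abs_Uh2 (cst_free2.kquot (symm i) (cst (of_nat (symm i)) * Hsum i)))"
    unfolding fscal_cst Uh2_scal_def[abs_def] by (simp only:)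
  show "z = 0" if "\<And>n. \<exists>y. z = abs_Uh2 fps_X ^ n * y" for z
    using Uh2_separated[of z] that by (simp add: Uh2_h_def)
qed

lemma comult_eq: "comult = comult.Hom"
proof -
  have "comult_word w = comult.ext_word w" for w
    by (cases w) (simp add: comult.ext_word_def)
  then have "comult_series p = comult.ext_series p" for p
    by (simp add: comult_series_def comult.ext_series_def comult_free_def comult.ext_free_def)
  then show ?thesis by (simp add: fun_eq_iff comult_def comult.Hom_def comult.\<Phi>_def)
qed

lemma comult_gens:
  "comult (Uh_E i) = left_Uh (Uh_E i) * right_Uh (Uh_K i) + right_Uh (Uh_E i)"
  "comult (Uh_K i) = left_Uh (Uh_K i) * right_Uh (Uh_K i)"
  "comult (Uh_H i) = left_Uh (Uh_H i) + right_Uh (Uh_H i)"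
  "comult (Uh_scal c) = Uh2_scal c"
  "comult (Uh_h ^ n * x) = Uh2_h ^ n * comult x"
  unfolding comult_eq comult.Hom_gens
  by (simp_all only: Uh_E_def Uh_K_def Uh_H_def Uh2_scal_def Uh2_h_def left_Uh_abs right_Uh_abs comult_letter.simps
      ftens_split[of "flt _" "fK _"] Hsum_exp(2) fscal_cst plus_Uh2.abs_eq times_Uh2.abs_eq)

section \<open>Tensor powers of the seven-dimensional representation\<close>

text \<open>The weights run from the highest one \<open>W1\<close> down to the lowest one \<open>W7\<close>. Countably many tensor
  factors are carried along, so that all tensor powers share one space; the \<open>n\<close>-th one acts on the
  first \<open>n\<close> factors.\<close>

datatype wt = W1 | W2 | W3 | W4 | W5 | W6 | W7

lemma UNIV_wt: "UNIV = {W1, W2, W3, W4, W5, W6, W7}"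
  by (auto intro: wt.exhaust)

instance wt :: finite
  by standard (simp add: UNIV_wt)

lemma sum_wt: "(\<Sum>b\<in>UNIV. f b) = f W1 + f W2 + f W3 + f W4 + f W5 + f W6 + f W7"
  by (simp add: UNIV_wt add.assoc)

text \<open>A vector is its coordinate function on basis states. Arbitrary functions are allowed, so
  operators need no finiteness conditions.\<close>

type_synonym vec = "(nat \<Rightarrow> wt) \<Rightarrow> complex"

typedef op = "{f :: vec \<Rightarrow> vec. \<forall>x y c. f (\<lambda>s. x s + c * y s) = (\<lambda>s. f x s + c * f y s)}"
  morphisms app Abs_op
  by (rule exI[of _ id]) simp

setup_lifting type_definition_op

lemma app_linear: "app f (\<lambda>s. x s + c * y s) = (\<lambda>s. app f x s + c * app f y s)"
  using app[of f] by simp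

lemma app_add: "app f (\<lambda>s. x s + y s) = (\<lambda>s. app f x s + app f y s)"
  using app_linear[of f x 1 y] by simp

lemma app_0: "app f (\<lambda>s. 0) = (\<lambda>s. 0)"
  using app_linear[of f "\<lambda>s. 0" "- 1" "\<lambda>s. 0"] by simp

lemma app_scale: "app f (\<lambda>s. c * y s) = (\<lambda>s. c * app f y s)"
  using app_linear[of f "\<lambda>s. 0" c y] by (simp add: app_0)

lemma op_eqI: "(\<And>x s. app f x s = app g x s) \<Longrightarrow> f = g"
  by (simp add: app_inject[symmetric] fun_eq_iff)

instantiation op :: ring_1
begin

lift_definition zero_op :: op is "\<lambda>x s. 0" by simp
lift_definition one_op :: op is "\<lambda>x. x" by simp
lift_definition plus_op :: "op \<Rightarrow> op \<Rightarrow> op" is "\<lambda>f g x s. f x s + g x s" by (simp add: algebra_simps)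
lift_definition minus_op :: "op \<Rightarrow> op \<Rightarrow> op" is "\<lambda>f g x s. f x s - g x s" by (simp add: algebra_simps)
lift_definition uminus_op :: "op \<Rightarrow> op" is "\<lambda>f x s. - f x s" by simp
lift_definition times_op :: "op \<Rightarrow> op \<Rightarrow> op" is "\<lambda>f g x. f (g x)" by simp

lemmas app_simps = zero_op.rep_eq one_op.rep_eq plus_op.rep_eq minus_op.rep_eq uminus_op.rep_eq times_op.rep_eq

instance
proof
  have "app 0 (\<lambda>_. 1) (\<lambda>_. W1) \<noteq> app 1 (\<lambda>_. 1) (\<lambda>_. W1)" by (simp add: app_simps)
  then show "(0 :: op) \<noteq> 1" by metis
qed (auto intro!: op_eqI simp: app_simps app_add)

end

lift_definition op_scal :: "complex \<Rightarrow> op" is "\<lambda>c x s. c * x s"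
  by (simp add: algebra_simps)

interpretation op: scalar_algebra op_scal
  by standard (auto intro!: op_eqI simp: app_simps op_scal.rep_eq app_scale algebra_simps)

lemma app_sum: "app (sum f A) x s = (\<Sum>i\<in>A. app (f i) x s)"
  by (induction A rule: infinite_finite_induct) (simp_all add: app_simps)

lift_definition site :: "nat \<Rightarrow> (wt \<Rightarrow> wt \<Rightarrow> complex) \<Rightarrow> op" is
  "\<lambda>k M x s. \<Sum>b\<in>UNIV. M (s k) b * x (s(k := b))"
  by (auto simp: fun_eq_iff sum.distrib sum_distrib_left algebra_simps)

lemma site_mult: "site k M * site k N = site k (\<lambda>a b. \<Sum>c\<in>UNIV. M a c * N c b)"
proof (rule op_eqI)
  fix x s
  have "app (site k M * site k N) x s = (\<Sum>c\<in>UNIV. \<Sum>b\<in>UNIV. M (s k) c * N c b * x (s(k := b)))"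
    by (simp add: app_simps site.rep_eq sum_distrib_left mult.assoc)
  also have "\<dots> = (\<Sum>b\<in>UNIV. \<Sum>c\<in>UNIV. M (s k) c * N c b * x (s(k := b)))"
    by (rule sum.swap)
  finally show "app (site k M * site k N) x s = app (site k (\<lambda>a b. \<Sum>c\<in>UNIV. M a c * N c b)) x s"
    by (simp add: site.rep_eq sum_distrib_right)
qed

lemma site_commute:
  assumes "j \<noteq> k"
  shows "site j M * site k N = site k N * site j M"
proof (rule op_eqI)
  fix x s
  have "app (site j M * site k N) x s = (\<Sum>b\<in>UNIV. \<Sum>c\<in>UNIV. M (s j) b * (N (s k) c * x (s(j := b, k := c))))"
    using assms by (simp add: app_simps site.rep_eq sum_distrib_left)
  also have "\<dots> = (\<Sum>c\<in>UNIV. \<Sum>b\<in>UNIV. M (s j) b * (N (s k) c * x (s(j := b, k := c))))"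
    by (rule sum.swap)
  also have "\<dots> = app (site k N * site j M) x s"
    using assms by (simp add: app_simps site.rep_eq sum_distrib_left fun_upd_twist[OF assms] mult.left_commute)
  finally show "app (site j M * site k N) x s = app (site k N * site j M) x s" .
qed

lemma site_linear: "site k (\<lambda>a b. M a b + N a b) = site k M + site k N"
  "site k (\<lambda>a b. M a b - N a b) = site k M - site k N" "site k (\<lambda>a b. c * M a b) = op_scal c * site k M"
  "site k (\<lambda>a b. 0) = 0"
  by (auto intro!: op_eqI simp: app_simps site.rep_eq op_scal.rep_eq sum.distrib sum_subtractf sum_distrib_left algebra_simps)

lemma site_sum: "site k (\<lambda>a b. \<Sum>i\<in>I. M i a b) = (\<Sum>i\<in>I. site k (M i))"
  by (induction I rule: infinite_finite_induct) (simp_all add: site_linear)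

lemma site_diag_scal: "site k (\<lambda>a b. if a = b then c else 0) = op_scal c"
  by (auto intro!: op_eqI simp: site.rep_eq op_scal.rep_eq if_distrib[of "\<lambda>x. x * _"] cong: if_cong)

section \<open>The seven-dimensional representation over C[[h]]\<close>

typedef mat = "UNIV :: (wt \<Rightarrow> wt \<Rightarrow> complex fps) set"
  morphisms entry Mat ..

setup_lifting type_definition_mat

lemma mat_eqI: "(\<And>a b. entry M a b = entry N a b) \<Longrightarrow> M = N"
  by (simp add: entry_inject[symmetric] fun_eq_iff)

instantiation mat :: ring_1
begin

lift_definition zero_mat :: mat is "\<lambda>a b. 0" .
lift_definition one_mat :: mat is "\<lambda>a b. if a = b then 1 else 0" .
lift_definition plus_mat :: "mat \<Rightarrow> mat \<Rightarrow> mat" is "\<lambda>M N a b. M a b + N a b" .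
lift_definition minus_mat :: "mat \<Rightarrow> mat \<Rightarrow> mat" is "\<lambda>M N a b. M a b - N a b" .
lift_definition uminus_mat :: "mat \<Rightarrow> mat" is "\<lambda>M a b. - M a b" .
lift_definition times_mat :: "mat \<Rightarrow> mat \<Rightarrow> mat" is "\<lambda>M N a b. \<Sum>c\<in>UNIV. M a c * N c b" .

lemmas entry_simps = zero_mat.rep_eq one_mat.rep_eq plus_mat.rep_eq minus_mat.rep_eq uminus_mat.rep_eq
  times_mat.rep_eq

instance
proof
  fix A B C :: mat
  show "A * B * C = A * (B * C)"
  proof (rule mat_eqI)
    fix a b
    have "entry (A * B * C) a b = (\<Sum>c\<in>UNIV. \<Sum>d\<in>UNIV. entry A a d * (entry B d c * entry C c b))"
      by (simp add: entry_simps sum_distrib_right mult.assoc)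
    also have "\<dots> = (\<Sum>d\<in>UNIV. \<Sum>c\<in>UNIV. entry A a d * (entry B d c * entry C c b))"
      by (rule sum.swap)
    finally show "entry (A * B * C) a b = entry (A * (B * C)) a b"
      by (simp add: entry_simps sum_distrib_left)
  qed
  have "entry 0 W1 W1 \<noteq> entry 1 W1 W1" by (simp add: entry_simps)
  then show "(0 :: mat) \<noteq> 1" by metis
qed (auto intro!: mat_eqI simp: entry_simps sum.distrib algebra_simps if_distrib[of "\<lambda>x. x * _"]
    if_distrib[of "\<lambda>x. _ * x"] cong: if_cong)

end

definition diag :: "(wt \<Rightarrow> complex fps) \<Rightarrow> mat" where
  "diag d = Mat (\<lambda>a b. if a = b then d a else 0)"

lemma entry_diag: "entry (diag d) a b = (if a = b then d a else 0)"
  by (simp add: diag_def Mat_inverse)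

lemma diag_mult: "entry (diag d * M) a b = d a * entry M a b" "entry (M * diag d) a b = entry M a b * d b"
  by (simp_all add: entry_simps entry_diag if_distrib[of "\<lambda>x. x * _"] if_distrib[of "\<lambda>x. _ * x"] cong: if_cong)

lemma diag_diag: "diag d * diag e = diag (\<lambda>a. d a * e a)"
  by (rule mat_eqI) (simp add: diag_mult(1) entry_diag)

lemma diag_hom: "diag (\<lambda>_. 1) = 1" "diag (\<lambda>a. d a + e a) = diag d + diag e"
  by (rule mat_eqI; simp add: entry_diag entry_simps)+

interpretation mat: ring_scalars "\<lambda>c. diag (\<lambda>_. c)"
proof
  show "diag (\<lambda>_. c) * M = M * diag (\<lambda>_. c)" for c M
    by (rule mat_eqI) (simp add: diag_mult)
qed (simp_all add: diag_hom diag_diag)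

text \<open>The q^d-integer [w] for a possibly negative w, written like \<open>kquot\<close> so that
  it is visibly the eigenvalue of (K - K^{-1}) / (q^d - q^{-d}) at weight w.\<close>

definition qquot :: "nat \<Rightarrow> int \<Rightarrow> complex fps" where
  "qquot d w = inverse (fps_shift 1 (qpow (int d) - qpow (- int d)))
     * fps_shift 1 (qpow (int d * w) - qpow (- (int d * w)))"

lemma qquot_eqI:
  assumes "d > 0" "v * (qpow (int d) - qpow (- int d)) = qpow (int d * w) - qpow (- (int d * w))"
  shows "qquot d w = v"
proof -
  let ?D = "fps_shift 1 (qpow (int d) - qpow (- int d))"
  have "fps_nth ?D 0 \<noteq> 0" using qdiff_nth(2)[of "int d"] assms(1) by (simp del: fps_sub_nth)
  then have "inverse ?D * ?D = 1" by (rule inverse_mult_eq_1)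
  moreover have "fps_shift 1 (v * (qpow (int d) - qpow (- int d))) = v * ?D"
  proof -
    have "qpow (int d) - qpow (- int d) = fps_X * ?D"
      by (rule fps_ext) (use qdiff_nth(1)[of "int d"] in auto)
    then have "v * (qpow (int d) - qpow (- int d)) = fps_X * (v * ?D)" by (simp add: mult.left_commute)
    then show ?thesis by (simp only: cst_free.fps_shift_X_mult)
  qed
  ultimately show ?thesis
    unfolding qquot_def assms(2)[symmetric] by (simp add: mult.left_commute)
qed

lemma qquot_values: "d > 0 \<Longrightarrow> qquot d 0 = 0" "d > 0 \<Longrightarrow> qquot d 1 = 1" "d > 0 \<Longrightarrow> qquot d (- 1) = - 1"
  "qquot 1 2 = qpow 1 + qpow (- 1)" "qquot 1 (- 2) = - qpow 1 - qpow (- 1)"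
  by (rule qquot_eqI; simp add: algebra_simps qpow_mult)+

text \<open>\<open>weight i a\<close> is the value of the coroot \<open>H\<^sub>i\<close> on the weight vector \<open>a\<close>.\<close>

fun weight :: "node \<Rightarrow> wt \<Rightarrow> int" where
  "weight Node1 W1 = 1" | "weight Node1 W2 = -1" | "weight Node1 W3 = 2" | "weight Node1 W4 = 0"
| "weight Node1 W5 = -2" | "weight Node1 W6 = 1" | "weight Node1 W7 = -1"
| "weight Node2 W1 = 0" | "weight Node2 W2 = 1" | "weight Node2 W3 = -1" | "weight Node2 W4 = 0"
| "weight Node2 W5 = 1" | "weight Node2 W6 = -1" | "weight Node2 W7 = 0"

definition raise :: "node \<Rightarrow> wt \<Rightarrow> wt \<Rightarrow> complex" where
  "raise i a b = (if (a, b) \<in> (case i of Node1 \<Rightarrow> {(W1, W2), (W3, W4), (W4, W5), (W6, W7)}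
     | Node2 \<Rightarrow> {(W2, W3), (W5, W6)}) then 1 else 0)"

text \<open>Since E_1 has entries 0 and 1, F_1 must carry the full factor [2] = q + q^{-1} along the
  string W3, W4, W5; then [E_1, F_1] takes the values [2], 0, -[2] there, as weights 2, 0, -2
  require.\<close>

definition lower :: "node \<Rightarrow> wt \<Rightarrow> wt \<Rightarrow> complex fps" where
  "lower i a b = (if (b, a) \<in> {(W3, W4), (W4, W5)} \<and> i = Node1 then qpow 1 + qpow (- 1)
     else fps_const (raise i b a))"

definition "matE i = Mat (\<lambda>a b. fps_const (raise i a b))"
definition "matF i = Mat (lower i)"
definition "matH i = diag (\<lambda>a. of_int (weight i a))"
definition "matK i = diag (\<lambda>a. qpow (int (symm i) * weight i a))"
definition "matL i = diag (\<lambda>a. qpow (- (int (symm i) * weight i a)))"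
definition "matQ i = diag (\<lambda>a. qquot (symm i) (weight i a))"

lemma entry_EF: "entry (matE i) a b = fps_const (raise i a b)" "entry (matF i) a b = lower i a b"
  by (simp_all add: matE_def matF_def Mat_inverse)

lemma raise_weight: "raise i a b \<noteq> 0 \<Longrightarrow> weight j a = weight j b + cartan j i"
  by (cases i; cases j) (auto simp: raise_def split: if_splits)

lemma lower_weight: "lower i a b \<noteq> 0 \<Longrightarrow> weight j a = weight j b - cartan j i"
  by (cases i; cases j) (auto simp: raise_def lower_def split: if_splits)

lemma EF_row:
  "entry (matE Node1 * M) a b = (case a of W1 \<Rightarrow> entry M W2 b | W3 \<Rightarrow> entry M W4 b | W4 \<Rightarrow> entry M W5 b
    | W6 \<Rightarrow> entry M W7 b | _ \<Rightarrow> 0)"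
  "entry (matE Node2 * M) a b = (case a of W2 \<Rightarrow> entry M W3 b | W5 \<Rightarrow> entry M W6 b | _ \<Rightarrow> 0)"
  "entry (matF Node1 * M) a b = (case a of W2 \<Rightarrow> entry M W1 b | W4 \<Rightarrow> (qpow 1 + qpow (- 1)) * entry M W3 b
    | W5 \<Rightarrow> (qpow 1 + qpow (- 1)) * entry M W4 b | W7 \<Rightarrow> entry M W6 b | _ \<Rightarrow> 0)"
  "entry (matF Node2 * M) a b = (case a of W3 \<Rightarrow> entry M W2 b | W6 \<Rightarrow> entry M W5 b | _ \<Rightarrow> 0)"
  by (cases a; simp add: entry_simps sum_wt entry_EF raise_def lower_def)+

text \<open>In this representation every single monomial of the Serre elements vanishes, so those
  relations hold regardless of the q-binomial coefficients.\<close>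

lemma triple_zero:
  "matE Node1 * matE Node1 * matE Node1 = 0" "matE Node2 * matE Node2 = 0"
  "matF Node1 * matF Node1 * matF Node1 = 0" "matF Node2 * matF Node2 = 0"
  "matE Node2 * matE Node1 * matE Node2 = 0" "matF Node2 * matF Node1 * matF Node2 = 0"
  "matE Node1 * matE Node1 * matE Node2 * matE Node1 * matE Node1 = 0"
  "matF Node1 * matF Node1 * matF Node2 * matF Node1 * matF Node1 = 0"
  by (rule mat_eqI, rename_tac a b, case_tac a;
      simp add: EF_row mult.assoc entry_EF raise_def lower_def zero_mat.rep_eq)+

lemma mat_EF: "matE i * matF j = matF j * matE i + (if i = j then matQ i else 0)"
  by (rule mat_eqI, rename_tac a b, case_tac i; case_tac j; case_tac a; case_tac b)
    (simp_all add: EF_row plus_mat.rep_eq zero_mat.rep_eq entry_EF raise_def lower_def matQ_def entry_diag qquot_values qquot_values(4,5)[unfolded One_nat_def])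

lemma mat_family: "g2_family (\<lambda>c. diag (\<lambda>_. c)) matE matF matH matK matL matQ"
proof
  fix i j
  have entries: "entry (diag d * M) a b = d a * entry M a b" "entry (M * diag d) a b = entry M a b * d b"
    "entry (diag d * diag e) a b = (if a = b then d a * e a else 0)" for d e M a b
    by (simp_all add: diag_mult(1) entry_diag) (rule diag_mult)
  show "matH i * matH j = matH j * matH i" "matH i * matK j = matK j * matH i" "matH i * matL j = matL j * matH i"
    "matK i * matK j = matK j * matK i" "matL i * matL j = matL j * matL i"
    by (simp_all add: matH_def matK_def matL_def diag_diag mult.commute)
  show "matK i * matL i = 1" "matL i * matK i = 1"
    by (simp_all add: matK_def matL_def diag_diag qpow_mult diag_hom)
  show "matH i * matE j = matE j * matH i + diag (\<lambda>_. of_int (cartan i j)) * matE j"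
  proof (rule mat_eqI)
    fix a b
    show "entry (matH i * matE j) a b = entry (matE j * matH i + diag (\<lambda>_. of_int (cartan i j)) * matE j) a b"
      unfolding plus_mat.rep_eq matH_def entries entry_EF using raise_weight[of j a b i]
      by (cases "raise j a b = 0") (simp_all add: algebra_simps)
  qed
  show "matH i * matF j = matF j * matH i - diag (\<lambda>_. of_int (cartan i j)) * matF j"
  proof (rule mat_eqI)
    fix a b
    show "entry (matH i * matF j) a b = entry (matF j * matH i - diag (\<lambda>_. of_int (cartan i j)) * matF j) a b"
    proof (cases "lower j a b = 0")
      case False
      then have "weight i b = weight i a + cartan i j" using lower_weight[of j a b i] by simp
      then show ?thesis
        unfolding minus_mat.rep_eq matH_def entries entry_EF by (simp add: algebra_simps)
    qed (simp add: minus_mat.rep_eq matH_def entries entry_EF)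
  qed
  show "matK i * matE j = mat.q (dot i j) * (matE j * matK i)"
  proof (rule mat_eqI)
    fix a b
    have "qpow (int (symm i) * weight i a) = qpow (dot i j) * qpow (int (symm i) * weight i b)" if "raise j a b \<noteq> 0"
      unfolding raise_weight[OF that, of i] qpow_mult dot_def distrib_left by (simp only: add.commute)
    then show "entry (matK i * matE j) a b = entry (mat.q (dot i j) * (matE j * matK i)) a b"
      unfolding mat.q_def matK_def entries entry_EF
      by (cases "raise j a b = 0") simp_all
  qed
  show "matK i * matF j = mat.q (- dot i j) * (matF j * matK i)"
  proof (rule mat_eqI)
    fix a b
    have "qpow (int (symm i) * weight i a) = qpow (- dot i j) * qpow (int (symm i) * weight i b)" if "lower j a b \<noteq> 0"
      unfolding lower_weight[OF that, of i] qpow_mult dot_def right_diff_distrib by (simp only: add.commute diff_conv_add_uminus)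
    then show "entry (matK i * matF j) a b = entry (mat.q (- dot i j) * (matF j * matK i)) a b"
      unfolding mat.q_def matK_def entries entry_EF
      by (cases "lower j a b = 0") simp_all
  qed
  show "matE i * matF j = matF j * matE i + (if i = j then matQ i else 0)"
    by (rule mat_EF)
next
  have sum: "(\<Sum>r\<le>4. f r) = f 0 + f 1 + f 2 + f 3 + f 4" "(\<Sum>r\<le>2. f r) = f 0 + f 1 + f 2" for f :: "nat \<Rightarrow> mat"
    by (simp_all add: eval_nat_numeral)
  have z: "x * y * z = 0 \<Longrightarrow> x * (y * (z * w)) = 0" "x * y = 0 \<Longrightarrow> x * (y * w) = 0" for x y z w :: mat
    by (metis mult.assoc mult_zero_left)+
  note zeros = triple_zero[unfolded mult.assoc] z(1)[OF triple_zero(1)] z(1)[OF triple_zero(3)]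
    z(2)[OF triple_zero(2)] z(2)[OF triple_zero(4)]
  show "mat.serre12 (matE Node1) (matE Node2)" "mat.serre12 (matF Node1) (matF Node2)"
    "mat.serre21 (matE Node1) (matE Node2)" "mat.serre21 (matF Node1) (matF Node2)"
    unfolding mat.serre12_iff mat.serre21_iff sum
    by (simp_all add: power4_eq_xxxx power3_eq_cube power2_eq_square mult.assoc zeros)
qed

section \<open>Action on one tensor factor and on tensor powers\<close>

definition siteh :: "nat \<Rightarrow> mat \<Rightarrow> op fps" where
  "siteh k M = Abs_fps (\<lambda>n. site k (\<lambda>a b. fps_nth (entry M a b) n))"

lemma siteh_hom: "siteh k (M + N) = siteh k M + siteh k N" "siteh k (M * N) = siteh k M * siteh k N"
  "siteh k (diag (\<lambda>_. c)) = op.fscal c" "siteh k 1 = 1"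
proof -
  show "siteh k (M + N) = siteh k M + siteh k N"
    by (rule fps_ext) (simp add: siteh_def entry_simps site_linear)
  show "siteh k (M * N) = siteh k M * siteh k N"
  proof (rule fps_ext)
    fix n
    have "fps_nth (siteh k (M * N)) n
        = site k (\<lambda>a b. \<Sum>i\<le>n. \<Sum>c\<in>UNIV. fps_nth (entry M a c) i * fps_nth (entry N c b) (n - i))"
      unfolding siteh_def fps_nth_Abs_fps times_mat.rep_eq fps_sum_nth fps_mult_nth atLeast0AtMost
      by (subst sum.swap) (rule refl)
    also have "\<dots> = (\<Sum>i\<le>n. site k (\<lambda>a b. \<Sum>c\<in>UNIV. fps_nth (entry M a c) i * fps_nth (entry N c b) (n - i)))"
      by (rule site_sum)
    also have "\<dots> = fps_nth (siteh k M * siteh k N) n"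
      by (simp add: siteh_def fps_mult_nth site_mult atLeast0AtMost)
    finally show "fps_nth (siteh k (M * N)) n = fps_nth (siteh k M * siteh k N) n" .
  qed
  show *: "siteh k (diag (\<lambda>_. c)) = op.fscal c" for c
    by (rule fps_ext) (simp add: siteh_def entry_diag op.fscal_nth site_diag_scal if_distrib[of "\<lambda>x. fps_nth x _"] cong: if_cong)
  show "siteh k 1 = 1"
    using *[of 1] by (simp add: diag_hom op.fscal_hom)
qed

lemma siteh_commute: "j \<noteq> k \<Longrightarrow> siteh j M * siteh k N = siteh k N * siteh j M"
proof (rule fps_ext)
  fix n assume "j \<noteq> k"
  from site_commute[OF this] have "fps_nth (siteh j M * siteh k N) n
      = (\<Sum>i\<le>n. fps_nth (siteh k N) (n - i) * fps_nth (siteh j M) i)"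
    by (simp add: fps_mult_nth siteh_def atLeast0AtMost)
  also have "\<dots> = (\<Sum>i\<le>n. fps_nth (siteh k N) i * fps_nth (siteh j M) (n - i))"
    by (rule sum.reindex_bij_witness[of _ "\<lambda>i. n - i" "\<lambda>i. n - i"]) auto
  finally show "fps_nth (siteh j M * siteh k N) n = fps_nth (siteh k N * siteh j M) n"
    by (simp add: fps_mult_nth atLeast0AtMost)
qed

interpretation op_fps: ring_scalars op.fscal
  by standard (rule op.fscal_hom op.fscal_central)+

lemma site_family: "g2_family op.fscal (siteh k \<circ> matE) (siteh k \<circ> matF) (siteh k \<circ> matH)
    (siteh k \<circ> matK) (siteh k \<circ> matL) (siteh k \<circ> matQ)"
  by (rule g2_family.image_family[OF mat_family])
    (simp_all add: siteh_hom op_fps.ring_scalars_axioms)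

definition coroot_op :: "nat \<Rightarrow> node \<Rightarrow> op" where
  "coroot_op k i = site k (\<lambda>a b. if a = b then of_int (weight i a) else 0)"

lemma siteh_H: "siteh k (matH i) = fps_const (coroot_op k i)"
  by (rule fps_ext) (simp add: siteh_def matH_def entry_diag coroot_op_def if_distrib[of "\<lambda>x. fps_nth x _"]
      fps_of_int[symmetric] site_linear cong: if_cong)

lemma coroot_op_power: "op_scal c * coroot_op k i ^ n
  = site k (\<lambda>a b. if a = b then c * of_int (weight i a) ^ n else 0)"
proof -
  have "coroot_op k i ^ n = site k (\<lambda>a b. if a = b then of_int (weight i a) ^ n else 0)"
  proof (induction n)
    case 0
    show ?case using site_diag_scal[of k 1] by (simp add: op.\<kappa>_1 cong: if_cong)
  next
    case (Suc n)
    have "coroot_op k i ^ Suc n = coroot_op k i * site k (\<lambda>a b. if a = b then of_int (weight i a) ^ n else 0)"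
      using Suc by simp
    also have "\<dots> = site k (\<lambda>a b. if a = b then of_int (weight i a) ^ Suc n else 0)"
      unfolding coroot_op_def site_mult
      by (rule arg_cong[of _ _ "site k"]) (auto simp: fun_eq_iff if_distrib[of "\<lambda>x. x * _"] cong: if_cong)
    finally show ?case .
  qed
  then show ?thesis unfolding site_linear(3)[symmetric]
    by (simp add: if_distrib[of "\<lambda>x. _ * x"] cong: if_cong flip: site_linear(3))
qed

lemma siteh_K: "siteh k (matK i) = op.exph (op_scal (of_nat (symm i)) * coroot_op k i)"
  "siteh k (matL i) = op.exph (- (op_scal (of_nat (symm i)) * coroot_op k i))"
  "siteh k (matQ i) = op.kquot (symm i) (op_scal (of_nat (symm i)) * coroot_op k i)"
proof -
  have *: "siteh k (diag (\<lambda>a. fps_exp (c * of_int (weight i a)))) = op.exph (op_scal c * coroot_op k i)" for c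
  proof (rule fps_ext)
    fix n
    have "(op_scal c * coroot_op k i) ^ n = op_scal (c ^ n) * coroot_op k i ^ n"
      by (induction n) (simp_all add: op.\<kappa>_1 op.\<kappa>_mult op.\<kappa>_left_commute[of "coroot_op k i"] mult.assoc)
    then have "fps_nth (op.exph (op_scal c * coroot_op k i)) n = op_scal (1 / fact n * c ^ n) * coroot_op k i ^ n"
      by (simp only: op.exph_def fps_nth_Abs_fps op.\<kappa>_mult mult.assoc)
    then show "fps_nth (siteh k (diag (\<lambda>a. fps_exp (c * of_int (weight i a))))) n
        = fps_nth (op.exph (op_scal c * coroot_op k i)) n"
      by (simp add: coroot_op_power siteh_def entry_diag if_distrib[of "\<lambda>x. fps_nth x _"] power_mult_distrib cong: if_cong)
  qed
  from *[of "of_nat (symm i)"] show K: "siteh k (matK i) = op.exph (op_scal (of_nat (symm i)) * coroot_op k i)"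
    by (simp add: matK_def qpow_def)
  from *[of "- of_nat (symm i)"] show L: "siteh k (matL i) = op.exph (- (op_scal (of_nat (symm i)) * coroot_op k i))"
    by (simp add: matL_def qpow_def op.\<kappa>_minus)
  have "siteh k (matK i) - siteh k (matL i) = siteh k (diag (\<lambda>a. qpow (int (symm i) * weight i a) - qpow (- (int (symm i) * weight i a))))"
    by (rule fps_ext)
      (simp only: fps_sub_nth siteh_def fps_nth_Abs_fps site_linear(2)[symmetric],
        rule arg_cong[of _ _ "site k"], simp add: fun_eq_iff matK_def matL_def entry_diag)
  then have shift: "fps_shift 1 (siteh k (matK i) - siteh k (matL i))
      = siteh k (diag (\<lambda>a. fps_shift 1 (qpow (int (symm i) * weight i a) - qpow (- (int (symm i) * weight i a)))))"
    by (intro fps_ext) (simp add: siteh_def entry_diag if_distrib[of "\<lambda>x. fps_nth x _"] cong: if_cong)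
  show "siteh k (matQ i) = op.kquot (symm i) (op_scal (of_nat (symm i)) * coroot_op k i)"
    unfolding op.kquot_def K[symmetric] L[symmetric] shift siteh_hom(3)[of k, symmetric] siteh_hom(2)[symmetric]
      diag_diag matQ_def qquot_def ..
qed

text \<open>The iterated coproduct, with each new factor added on the right as in E \<otimes> K + 1
  \<otimes> E; zero factors give the trivial representation. The other five recursions follow the
  product family likewise.\<close>

primrec hatE :: "nat \<Rightarrow> node \<Rightarrow> op fps" where
  "hatE 0 = (\<lambda>i. 0)" | "hatE (Suc n) = (\<lambda>i. hatE n i * siteh n (matK i) + siteh n (matE i))"

primrec hatK :: "nat \<Rightarrow> node \<Rightarrow> op fps" where
  "hatK 0 = (\<lambda>i. 1)" | "hatK (Suc n) = (\<lambda>i. hatK n i * siteh n (matK i))"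

primrec hatL :: "nat \<Rightarrow> node \<Rightarrow> op fps" where
  "hatL 0 = (\<lambda>i. 1)" | "hatL (Suc n) = (\<lambda>i. hatL n i * siteh n (matL i))"

primrec hatF :: "nat \<Rightarrow> node \<Rightarrow> op fps" where
  "hatF 0 = (\<lambda>i. 0)" | "hatF (Suc n) = (\<lambda>i. hatF n i + hatL n i * siteh n (matF i))"

primrec hatH :: "nat \<Rightarrow> node \<Rightarrow> op fps" where
  "hatH 0 = (\<lambda>i. 0)" | "hatH (Suc n) = (\<lambda>i. hatH n i + siteh n (matH i))"

primrec hatQ :: "nat \<Rightarrow> node \<Rightarrow> op fps" where
  "hatQ 0 = (\<lambda>i. 0)" | "hatQ (Suc n) = (\<lambda>i. hatQ n i * siteh n (matK i) + hatL n i * siteh n (matQ i))"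

definition hat_coroot :: "nat \<Rightarrow> node \<Rightarrow> op" where
  "hat_coroot n i = (\<Sum>k<n. coroot_op k i)"

lemma hat_commute:
  assumes "n \<le> m" "x \<in> {hatE n i, hatF n i, hatH n i, hatK n i, hatL n i, hatQ n i}"
  shows "siteh m M * x = x * siteh m M"
  using assms
proof (induction n arbitrary: x)
  case 0
  then show ?case by auto
next
  case (Suc n)
  note c = Suc.IH[OF Suc_leD[OF Suc.prems(1)]]
  have c: "siteh m M * hatE n i = hatE n i * siteh m M" "siteh m M * hatF n i = hatF n i * siteh m M"
    "siteh m M * hatH n i = hatH n i * siteh m M" "siteh m M * hatK n i = hatK n i * siteh m M"
    "siteh m M * hatL n i = hatL n i * siteh m M" "siteh m M * hatQ n i = hatQ n i * siteh m M"
    by (rule c; simp)+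
  have s: "siteh m M * siteh n N = siteh n N * siteh m M" for N
    using siteh_commute[of m n M N] Suc.prems(1) by simp
  have p: "siteh m M * (y * z) = (y * z) * siteh m M"
    if "siteh m M * y = y * siteh m M" "siteh m M * z = z * siteh m M" for y z
    using that by (metis mult.assoc)
  have a: "siteh m M * (y + z) = (y + z) * siteh m M"
    if "siteh m M * y = y * siteh m M" "siteh m M * z = z * siteh m M" for y z
    using that by (simp add: distrib_left distrib_right)
  show ?case using Suc.prems(2) by (auto intro!: a p c s)
qed

lemma hat_family: "g2_family op.fscal (hatE n) (hatF n) (hatH n) (hatK n) (hatL n) (hatQ n)"
proof (induction n)
  case 0
  show ?case
    by standard (simp_all add: op_fps.serre12_def op_fps.serre21_def op_fps.Zel_def op_fps.Xel_def op_fps.Yel_def)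
next
  case (Suc n)
  interpret A: g2_family op.fscal "hatE n" "hatF n" "hatH n" "hatK n" "hatL n" "hatQ n" by (rule Suc)
  interpret B: g2_family op.fscal "siteh n \<circ> matE" "siteh n \<circ> matF" "siteh n \<circ> matH"
    "siteh n \<circ> matK" "siteh n \<circ> matL" "siteh n \<circ> matQ" by (rule site_family)
  interpret p: g2_pair op.fscal "hatE n" "hatF n" "hatH n" "hatK n" "hatL n" "hatQ n"
    "siteh n \<circ> matE" "siteh n \<circ> matF" "siteh n \<circ> matH" "siteh n \<circ> matK" "siteh n \<circ> matL" "siteh n \<circ> matQ"
  proof
    fix x y assume "x \<in> A.gens" "y \<in> B.gens"
    then show "y * x = x * y" unfolding A.gens_def B.gens_def using hat_commute[of n n x] by auto
  qed
  have "p.Ep = hatE (Suc n)" "p.Fp = hatF (Suc n)" "p.Hp = hatH (Suc n)" "p.Kp = hatK (Suc n)"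
    "p.Lp = hatL (Suc n)" "p.Qp = hatQ (Suc n)"
    by (rule ext; simp add: p.Ep_def p.Fp_def p.Hp_def p.Kp_def p.Lp_def p.Qp_def)+
  then show ?case using p.product_family by simp
qed

lemma coroot_op_commute: "coroot_op j i * coroot_op k i' = coroot_op k i' * coroot_op j i"
proof (cases "j = k")
  case True
  show ?thesis unfolding True coroot_op_def site_mult
    by (intro arg_cong2[of _ _ _ _ site] ext) (auto simp: mult.commute intro!: sum.cong)
qed (simp add: coroot_op_def site_commute)

text \<open>Coroots on different sites commute, so the addition formulas turn the products over
  sites into exponentials of one summed coroot operator, the form that \<open>g2_hom\<close> asks
  for.\<close>

lemma hat_exp:
  "hatH n i = fps_const (hat_coroot n i)"
  "hatK n i = op.exph (op_scal (of_nat (symm i)) * hat_coroot n i)"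
  "hatL n i = op.exph (- (op_scal (of_nat (symm i)) * hat_coroot n i))"
  "hatQ n i = op.kquot (symm i) (op_scal (of_nat (symm i)) * hat_coroot n i)"
proof -
  let ?c = "op_scal (of_nat (symm i))"
  have c: "(?c * hat_coroot n i) * (?c * coroot_op k i) = (?c * coroot_op k i) * (?c * hat_coroot n i)" for n k
  proof -
    have "hat_coroot n i * coroot_op k i = coroot_op k i * hat_coroot n i"
      by (simp add: hat_coroot_def sum_distrib_left sum_distrib_right coroot_op_commute)
    then show ?thesis by (simp add: op.\<kappa>_left_commute[of "hat_coroot n i"] op.\<kappa>_left_commute[of "coroot_op k i"] mult.assoc)
  qed
  have c': "- (?c * hat_coroot n i) * - (?c * coroot_op k i) = - (?c * coroot_op k i) * - (?c * hat_coroot n i)" for n k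
    using c by simp
  have Suc: "?c * hat_coroot (Suc n) i = ?c * hat_coroot n i + ?c * coroot_op n i" for n
    by (simp add: hat_coroot_def distrib_left)
  then have Suc': "- (?c * hat_coroot (Suc n) i) = - (?c * hat_coroot n i) + - (?c * coroot_op n i)" for n
    by simp
  have coroot_0: "?c * hat_coroot 0 i = 0" by (simp add: hat_coroot_def)
  show "hatH n i = fps_const (hat_coroot n i)"
    by (induction n) (simp_all add: hat_coroot_def siteh_H)
  show "hatK n i = op.exph (?c * hat_coroot n i)"
    by (induction n) (simp_all only: coroot_0 op.exph_0 hatK.simps siteh_K Suc op.exph_add[OF c])
  show L: "hatL n i = op.exph (- (?c * hat_coroot n i))" for n
    by (induction n) (simp_all only: coroot_0 minus_zero op.exph_0 hatL.simps siteh_K Suc' op.exph_add[OF c'])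
  show "hatQ n i = op.kquot (symm i) (?c * hat_coroot n i)"
  proof (induction n)
    case 0
    show ?case by (simp add: coroot_0 op.kquot_def op.exph_0)
  next
    case (Suc n)
    then show ?case
      by (simp only: hatQ.simps siteh_K \<open>\<And>n. ?c * hat_coroot (Suc n) i = _\<close> op.kquot_add[OF c] L)
  qed
qed

fun hat_letter :: "nat \<Rightarrow> letter \<Rightarrow> op fps" where
  "hat_letter n (XP i) = hatE n i"
| "hat_letter n (XM i) = hatF n i"
| "hat_letter n (HH i) = hatH n i"

interpretation rho: g2_hom op_scal "hat_letter n" "\<lambda>x. x" "hat_coroot n" for n
proof (intro g2_hom.intro g2_hom_axioms.intro)
  show "letter_hom op_scal" by unfold_locales
  show "g2_family (\<lambda>c. op.fscal c) (\<lambda>i. hat_letter n (XP i)) (\<lambda>i. hat_letter n (XM i)) (\<lambda>i. hat_letter n (HH i))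
     (\<lambda>i. op.exph (op_scal (of_nat (symm i)) * hat_coroot n i))
     (\<lambda>i. op.exph (- (op_scal (of_nat (symm i)) * hat_coroot n i)))
     (\<lambda>i. op.kquot (symm i) (op_scal (of_nat (symm i)) * hat_coroot n i))"
    using hat_family[of n] by (simp add: hat_exp[symmetric])
  show "z = 0" if z: "\<And>n. \<exists>y. z = fps_X ^ n * y" for z :: "op fps"
  proof (rule fps_ext)
    fix m
    obtain y where "z = fps_X ^ Suc m * y" using z by blast
    then show "fps_nth z m = fps_nth 0 m" by (simp only: fps_X_power_mult_nth) simp
  qed
qed (simp_all add: hat_exp)

section \<open>Independence of the ordered monomials\<close>

definition der :: "nat \<Rightarrow> (wt \<Rightarrow> wt \<Rightarrow> complex) \<Rightarrow> op" where
  "der n M = (\<Sum>k<n. site k M)"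

definition mcomm :: "(wt \<Rightarrow> wt \<Rightarrow> complex) \<Rightarrow> (wt \<Rightarrow> wt \<Rightarrow> complex) \<Rightarrow> wt \<Rightarrow> wt \<Rightarrow> complex" where
  "mcomm M N a b = (\<Sum>c\<in>UNIV. M a c * N c b) - (\<Sum>c\<in>UNIV. N a c * M c b)"

lemma site_comm: "site k M * site k N - site k N * site k M = site k (mcomm M N)"
  unfolding site_mult site_linear(2)[symmetric] by (simp add: mcomm_def[abs_def])

text \<open>Operators on different sites commute, so only the diagonal terms of the double sum
  survive. The classical limits of X and Y can therefore be computed on a single tensor
  factor.\<close>

lemma der_commutator: "der n M * der n N - der n N * der n M = der n (mcomm M N)"
proof -
  have "der n M * der n N - der n N * der n M
      = (\<Sum>j<n. \<Sum>k<n. site j M * site k N) - (\<Sum>j<n. \<Sum>k<n. site k N * site j M)"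
    unfolding der_def sum_product by (subst (2) sum.swap) (rule refl)
  also have "\<dots> = (\<Sum>j<n. \<Sum>k<n. if k = j then site j (mcomm M N) else 0)"
    unfolding sum_subtractf[symmetric]
    by (intro sum.cong refl) (metis cancel_comm_monoid_add_class.diff_cancel site_commute site_comm)
  also have "\<dots> = der n (mcomm M N)"
    by (simp add: der_def)
  finally show ?thesis .
qed

lemma hatE_0: "fps_nth (hatE n i) 0 = der n (raise i)"
proof (induction n)
  case (Suc n)
  have "fps_nth (siteh n (matE i)) 0 = site n (raise i)"
    by (simp add: siteh_def entry_EF)
  then show ?case using Suc by (simp add: siteh_K der_def)
qed (simp add: der_def)

definition "rho0 n u = fps_nth (rho.Hom n u) 0"

lemma rho0_hom: "rho0 n (x + y) = rho0 n x + rho0 n y" "rho0 n (x - y) = rho0 n x - rho0 n y"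
  "rho0 n (x * y) = rho0 n x * rho0 n y" "rho0 n (x ^ k) = rho0 n x ^ k"
  "rho0 n (Uh_scal c) = op_scal (fps_nth c 0)"
  by (simp_all add: rho0_def rho.Hom_hom rho.Hom_power rho.Hom_gens op.fscal_nth fps_nth_power_0)

definition "Xq = qcomm (-1) (qcomm 3 (Uh_E Node1) (Uh_E Node2)) (Uh_E Node1)"
definition "Yq = qcomm 1 (qcomm (-1) (qcomm 3 (Uh_E Node1) (Uh_E Node2)) (Uh_E Node1)) (Uh_E Node1)"
definition "Tq = Uh_logK Node1 + Uh_logK Node2"

lemma rho0_qcomm: "rho0 n (qcomm k x y) = rho0 n x * rho0 n y - rho0 n y * rho0 n x"
  by (simp add: qcomm_def rho0_hom qpow_def op.\<kappa>_1)

definition "matX = mcomm (mcomm (raise Node1) (raise Node2)) (raise Node1)"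
definition "matY = mcomm matX (raise Node1)"

lemma rho0_gens: "rho0 n (Uh_E i) = der n (raise i)" "rho0 n Xq = der n matX" "rho0 n Yq = der n matY"
proof -
  show E: "rho0 n (Uh_E i) = der n (raise i)" for i
    by (simp add: rho0_def rho.Hom_gens hatE_0)
  show "rho0 n Xq = der n matX" "rho0 n Yq = der n matY"
    by (simp_all add: Xq_def Yq_def matX_def matY_def rho0_qcomm E der_commutator)
qed

definition tau :: "nat \<Rightarrow> (nat \<Rightarrow> wt) \<Rightarrow> int" where "tau n s = (\<Sum>k<n. weight Node1 (s k) + 3 * weight Node2 (s k))"

lemma rho0_T: "app (rho0 n Tq) x s = of_int (tau n s) * x s"
proof -
  have "app (hat_coroot n i) x s = of_int (\<Sum>k<n. weight i (s k)) * x s" for i x s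
    by (simp add: hat_coroot_def app_sum coroot_op_def site.rep_eq if_distrib[of "\<lambda>x. x * _"]
        sum_distrib_right cong: if_cong)
  moreover have "rho0 n Tq = hat_coroot n Node1 + op_scal 3 * hat_coroot n Node2"
    by (simp add: Tq_def Uh_logK_def rho0_hom) (simp add: rho0_def rho.Hom_gens hat_exp op.\<kappa>_1 fps_of_nat[symmetric])
  ultimately show ?thesis
    by (simp add: app_simps op_scal.rep_eq tau_def sum.distrib sum_distrib_left algebra_simps)
qed

lemma raise_sums:
  "(\<Sum>c\<in>UNIV. M c * raise Node1 c b) = (case b of W2 \<Rightarrow> M W1 | W4 \<Rightarrow> M W3 | W5 \<Rightarrow> M W4 | W7 \<Rightarrow> M W6 | _ \<Rightarrow> 0)"
  "(\<Sum>c\<in>UNIV. M c * raise Node2 c b) = (case b of W3 \<Rightarrow> M W2 | W6 \<Rightarrow> M W5 | _ \<Rightarrow> 0)"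
  by (cases b; simp add: sum_wt raise_def)+

lemma raise_sums':
  "(\<Sum>c\<in>UNIV. raise Node1 a c * M c) = (case a of W1 \<Rightarrow> M W2 | W3 \<Rightarrow> M W4 | W4 \<Rightarrow> M W5 | W6 \<Rightarrow> M W7 | _ \<Rightarrow> 0)"
  "(\<Sum>c\<in>UNIV. raise Node2 a c * M c) = (case a of W2 \<Rightarrow> M W3 | W5 \<Rightarrow> M W6 | _ \<Rightarrow> 0)"
  by (cases a; simp add: sum_wt raise_def)+

text \<open>E_1, X, Y send the lowest vector to multiples of three different weight vectors, W6, W4,
  W3. The types of the excited factors in a state hence tell which operators were applied.\<close>

lemma column_W7: "raise Node1 a W7 = (if a = W6 then 1 else 0)" "matX a W7 = (if a = W4 then 2 else 0)"
  "matY a W7 = (if a = W3 then -3 else 0)"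
  unfolding matX_def matY_def mcomm_def raise_sums raise_sums' by (cases a; simp add: raise_def)+

section \<open>Leading parts and independence\<close>

definition exc :: "nat \<Rightarrow> (nat \<Rightarrow> wt) \<Rightarrow> nat set" where "exc n s = {k. k < n \<and> s k \<noteq> W7}"
definition cnt :: "nat \<Rightarrow> (nat \<Rightarrow> wt) \<Rightarrow> wt \<Rightarrow> nat" where "cnt n s w = card {k. k < n \<and> s k = w}"

lemma finite_exc [simp]: "finite (exc n s)"
  by (rule finite_subset[of _ "{..<n}"]) (auto simp: exc_def)

text \<open>The leading part of a vector is its restriction to the states with the largest number \<open>m\<close> of
  excited (not lowest) factors. The monomials only ever add up positive contributions there, so no
  cancellation can occur.\<close>

definition leading :: "nat \<Rightarrow> vec \<Rightarrow> nat \<Rightarrow> (wt \<Rightarrow> nat) \<Rightarrow> complex \<Rightarrow> bool" where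
  "leading n f m t c \<longleftrightarrow>
    (\<forall>s. f s \<noteq> 0 \<longrightarrow> (\<forall>k\<ge>n. s k = W7) \<and> card (exc n s) \<le> m) \<and>
    (\<forall>s. (\<forall>k\<ge>n. s k = W7) \<and> card (exc n s) = m \<longrightarrow>
      (\<exists>N::nat. f s = c * of_nat N \<and> (N > 0 \<longleftrightarrow> (\<forall>w. w \<noteq> W7 \<longrightarrow> cnt n s w = t w))))"

lemma leading_support:
  assumes "leading n f m t c" "f s \<noteq> 0"
  shows "(\<forall>k\<ge>n. s k = W7) \<and> card (exc n s) \<le> m"
  using assms unfolding leading_def by blast

lemma leading_value:
  assumes "leading n f m t c" "\<forall>k\<ge>n. s k = W7" "card (exc n s) = m"
  shows "\<exists>N::nat. f s = c * of_nat N \<and> (N > 0 \<longleftrightarrow> (\<forall>w. w \<noteq> W7 \<longrightarrow> cnt n s w = t w))"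
  using assms unfolding leading_def by blast

lemma app_der: "app (der n M) f s = (\<Sum>k<n. \<Sum>b\<in>UNIV. M (s k) b * f (s(k := b)))"
  by (simp add: der_def app_sum site.rep_eq)

text \<open>To reach m + 1 excited factors from a vector with at most m, the operator must act on a
  lowest factor, so only the column W7 of M enters. Each such site contributes d times the previous
  value, and the natural number N counts the ways of building the state.\<close>

lemma leading_step:
  assumes f: "leading n f m t c" and M: "\<And>a. M a W7 = (if a = w then d else 0)" and w: "w \<noteq> W7"
  shows "leading n (app (der n M) f) (Suc m) (t(w := Suc (t w))) (c * d)"
  unfolding leading_def
proof (intro conjI allI impI)
  fix s assume nz: "app (der n M) f s \<noteq> 0"
  have "\<exists>k<n. \<exists>b. M (s k) b * f (s(k := b)) \<noteq> 0"
  proof (rule ccontr)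
    assume "\<not> (\<exists>k<n. \<exists>b. M (s k) b * f (s(k := b)) \<noteq> 0)"
    then have "M (s k) b * f (s(k := b)) = 0" if "k < n" for k b using that by blast
    then have "app (der n M) f s = 0" unfolding app_der by (intro sum.neutral ballI) simp
    then show False using nz by contradiction
  qed
  then obtain k b where k: "k < n" and "M (s k) b * f (s(k := b)) \<noteq> 0" by blast
  then have "f (s(k := b)) \<noteq> 0" by auto
  from leading_support[OF f this]
  have s: "\<forall>j\<ge>n. (s(k := b)) j = W7" "card (exc n (s(k := b))) \<le> m" by blast+
  show "s j = W7" if "j \<ge> n" for j using s(1)[rule_format, OF that] k that by simp
  have "exc n s \<subseteq> insert k (exc n (s(k := b)))" by (auto simp: exc_def)
  then have "card (exc n s) \<le> card (insert k (exc n (s(k := b))))" by (intro card_mono) auto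
  also have "\<dots> \<le> Suc (card (exc n (s(k := b))))" by (rule card_insert_le_m1) auto
  finally show "card (exc n s) \<le> Suc m" using s(2) by simp
next
  fix s assume s: "(\<forall>k\<ge>n. s k = W7) \<and> card (exc n s) = Suc m"
  have val: "M (s k) b * f (s(k := b)) = (if b = W7 then if s k = w then d * f (s(k := W7)) else 0 else 0)"
    if k: "k < n" for k b
  proof (cases "b = W7 \<and> s k \<noteq> W7")
    case True
    then show ?thesis by (simp add: M)
  next
    case False
    have "exc n s \<subseteq> exc n (s(k := b))" using False by (auto simp: exc_def)
    then have "Suc m \<le> card (exc n (s(k := b)))" using s by (metis card_mono finite_exc)
    then have "\<not> card (exc n (s(k := b))) \<le> m" by simp
    then have "f (s(k := b)) = 0" using leading_support[OF f, of "s(k := b)"] by blast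
    then show ?thesis using False w by auto
  qed
  have "app (der n M) f s = (\<Sum>k<n. if s k = w then d * f (s(k := W7)) else 0)"
    unfolding app_der by (rule sum.cong) (simp_all add: val)
  also have "\<dots> = (\<Sum>k\<in>{k. k < n \<and> s k = w}. d * f (s(k := W7)))"
    by (simp add: sum.If_cases Int_def)
  finally have sum: "app (der n M) f s = (\<Sum>k\<in>{k. k < n \<and> s k = w}. d * f (s(k := W7)))" .
  \<comment> \<open>Undoing the excitation of site k lowers the number of factors w by one and
    leaves the other types alone, so s has the new content exactly if its predecessor had the old
    one.\<close>
  have "\<exists>N::nat. f (s(k := W7)) = c * of_nat N
      \<and> (N > 0 \<longleftrightarrow> (\<forall>v. v \<noteq> W7 \<longrightarrow> cnt n s v = (t(w := Suc (t w))) v))"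
    if k: "k < n" "s k = w" for k
  proof -
    have "exc n (s(k := W7)) = exc n s - {k}" "k \<in> exc n s" using k w by (auto simp: exc_def)
    then have card: "card (exc n (s(k := W7))) = m" using s by simp
    have tail: "\<forall>j\<ge>n. (s(k := W7)) j = W7" using s by simp
    have h: "(cnt n (s(k := W7)) v = t v) = (cnt n s v = (t(w := Suc (t w))) v)" if "v \<noteq> W7" for v
    proof (cases "v = w")
      case True
      have "{j. j < n \<and> s j = w} = insert k {j. j < n \<and> (s(k := W7)) j = w}"
        using k w by auto
      moreover have "k \<notin> {j. j < n \<and> (s(k := W7)) j = w}" using w by auto
      ultimately have "cnt n s w = Suc (cnt n (s(k := W7)) w)" unfolding cnt_def by simp
      then show ?thesis using True by simp
    next
      case False
      have "{j. j < n \<and> (s(k := W7)) j = v} = {j. j < n \<and> s j = v}"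
        using k False that by auto
      then show ?thesis using False by (simp add: cnt_def)
    qed
    have "(\<forall>v. v \<noteq> W7 \<longrightarrow> cnt n (s(k := W7)) v = t v) \<longleftrightarrow> (\<forall>v. v \<noteq> W7 \<longrightarrow> cnt n s v = (t(w := Suc (t w))) v)"
      by (rule all_cong1, rule imp_cong, rule refl, erule h)
    with leading_value[OF f tail card] show ?thesis by (simp only:)
  qed
  then have "\<forall>k\<in>{k. k < n \<and> s k = w}. \<exists>N::nat. f (s(k := W7)) = c * of_nat N
      \<and> (N > 0 \<longleftrightarrow> (\<forall>v. v \<noteq> W7 \<longrightarrow> cnt n s v = (t(w := Suc (t w))) v))" by simp
  from bchoice[OF this] obtain N :: "nat \<Rightarrow> nat" where N: "\<And>k. k \<in> {k. k < n \<and> s k = w} \<Longrightarrow> f (s(k := W7)) = c * of_nat (N k)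
      \<and> (N k > 0 \<longleftrightarrow> (\<forall>v. v \<noteq> W7 \<longrightarrow> cnt n s v = (t(w := Suc (t w))) v))"
    by blast
  let ?P = "\<forall>v. v \<noteq> W7 \<longrightarrow> cnt n s v = (t(w := Suc (t w))) v"
  have "app (der n M) f s = c * d * of_nat (\<Sum>k\<in>{k. k < n \<and> s k = w}. N k)"
    unfolding sum of_nat_sum sum_distrib_left
    by (rule sum.cong) (simp_all add: N[THEN conjunct1] mult_ac)
  moreover have "(\<Sum>k\<in>{k. k < n \<and> s k = w}. N k) > 0 \<longleftrightarrow> ?P"
  proof
    assume "(\<Sum>k\<in>{k. k < n \<and> s k = w}. N k) > 0"
    then have "(\<Sum>k\<in>{k. k < n \<and> s k = w}. N k) \<noteq> 0" by (rule gr_implies_not0)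
    then have "\<exists>k\<in>{k. k < n \<and> s k = w}. N k \<noteq> 0"
      by (rule contrapos_np) (rule sum.neutral, blast)
    then obtain k where "k \<in> {k. k < n \<and> s k = w}" "N k \<noteq> 0" by blast
    then show ?P using N by (simp only: neq0_conv)
  next
    assume P: ?P
    then have "cnt n s w > 0" using w by simp
    then have "{k. k < n \<and> s k = w} \<noteq> {}" unfolding cnt_def by (intro notI) simp
    then obtain k where k: "k \<in> {k. k < n \<and> s k = w}" by blast
    from N[OF this, THEN conjunct2] P have "N k > 0" by (rule iffD2)
    moreover have "N k \<le> (\<Sum>k\<in>{k. k < n \<and> s k = w}. N k)"
      using k by (intro member_le_sum) auto
    ultimately show "(\<Sum>k\<in>{k. k < n \<and> s k = w}. N k) > 0" by simp
  qed
  ultimately show "\<exists>N::nat. app (der n M) f s = c * d * of_nat N \<and> (N > 0 \<longleftrightarrow> ?P)"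
    by (intro exI[of _ "\<Sum>k\<in>{k. k < n \<and> s k = w}. N k"] conjI)
qed

lemma leading_power:
  assumes "leading n f m t c" "\<And>a. M a W7 = (if a = w then d else 0)" "w \<noteq> W7"
  shows "leading n (app (der n M ^ j) f) (m + j) (t(w := t w + j)) (c * d ^ j)"
proof (induction j)
  case 0
  then show ?case using assms(1) by (simp add: app_simps)
next
  case (Suc j)
  have "(t(w := t w + j))(w := Suc ((t(w := t w + j)) w)) = t(w := t w + Suc j)"
    "c * d ^ j * d = c * d ^ Suc j" "app (der n M) (app (der n M ^ j) f) = app (der n M ^ Suc j) f"
    by (simp_all add: app_simps)
  with leading_step[where M = M and w = w and d = d, OF Suc assms(2,3)] show ?case
    by (simp only: add_Suc_right)
qed

definition v0 :: vec where "v0 s = (if \<forall>k. s k = W7 then 1 else 0)"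

lemma leading_v0: "leading n v0 0 (\<lambda>_. 0) 1"
  unfolding leading_def
proof (intro conjI allI impI)
  fix s assume s: "(\<forall>k\<ge>n. s k = W7) \<and> card (exc n s) = 0"
  then have "s k = W7" for k by (cases "k < n") (auto simp: exc_def)
  then show "\<exists>N::nat. v0 s = 1 * of_nat N \<and> (N > 0 \<longleftrightarrow> (\<forall>w. w \<noteq> W7 \<longrightarrow> cnt n s w = 0))"
    by (intro exI[of _ 1]) (auto simp: v0_def cnt_def)
qed (auto simp: v0_def exc_def split: if_splits)

definition mon :: "nat \<times> nat \<times> nat \<times> nat \<Rightarrow> Uh" where
  "mon = (\<lambda>(a, b, c, d). Tq ^ a * (Uh_E Node1 ^ b * (Yq ^ c * Xq ^ d)))"

definition content :: "nat \<Rightarrow> nat \<Rightarrow> nat \<Rightarrow> wt \<Rightarrow> nat" where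
  "content b c d w = (case w of W6 \<Rightarrow> b | W3 \<Rightarrow> c | W4 \<Rightarrow> d | _ \<Rightarrow> 0)"

lemma leading_mon:
  "leading n (app (rho0 n (Uh_E Node1 ^ b * (Yq ^ c * Xq ^ d))) v0) (b + c + d) (content b c d) (2 ^ d * (- 3) ^ c)"
proof -
  define t1 t2 where "t1 = (\<lambda>_. 0 :: nat)(W4 := d)" and "t2 = t1(W3 := c)"
  have ne: "W4 \<noteq> W7" "W3 \<noteq> W7" "W6 \<noteq> W7" by simp_all
  have t: "(\<lambda>_. 0)(W4 := 0 + d) = t1" "t1(W3 := t1 W3 + c) = t2" by (simp_all add: t1_def t2_def)
  have t3: "t2(W6 := t2 W6 + b) = content b c d"
    by (rule ext, rename_tac w, case_tac w) (simp_all add: t1_def t2_def content_def)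
  note X = leading_power[where n = n and f = v0 and m = 0 and t = "\<lambda>_. 0" and c = 1 and M = matX and w = W4
      and d = 2 and j = d, OF leading_v0 column_W7(2) ne(1), unfolded t(1)]
  note Y = leading_power[where n = n and t = t1 and M = matY and w = W3 and d = "- 3" and j = c,
      OF X column_W7(3) ne(2), unfolded t(2)]
  note leading_power[where n = n and t = t2 and M = "raise Node1" and w = W6 and d = 1 and j = b,
      OF Y column_W7(1) ne(3), unfolded t3]
  moreover have "app (rho0 n (Uh_E Node1 ^ b * (Yq ^ c * Xq ^ d))) v0
      = app (der n (raise Node1) ^ b) (app (der n matY ^ c) (app (der n matX ^ d) v0))"
    by (simp only: rho0_hom rho0_gens app_simps)
  moreover have "0 + d + c + b = b + c + d" by simp
  moreover have "1 * 2 ^ d * (- 3) ^ c * 1 ^ b = (2 ^ d * (- 3) ^ c :: complex)" by simp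
  ultimately show ?thesis by (simp only:)
qed

lemma rho0_mon: "app (rho0 n (mon (a, b, c, d))) x s
    = of_int (tau n s) ^ a * app (rho0 n (Uh_E Node1 ^ b * (Yq ^ c * Xq ^ d))) x s"
proof -
  have "app (rho0 n Tq ^ a) y s = of_int (tau n s) ^ a * y s" for y
    by (induction a arbitrary: s) (simp_all add: app_simps rho0_T)
  then show ?thesis by (simp add: mon_def rho0_hom(3)[of n "Tq ^ a"] rho0_hom(4)[of n Tq] app_simps)
qed

text \<open>N is the top degree among monomials with nonzero coefficient. At a state with N excited
  factors all lower degrees vanish, and in degree N only one triple of exponents survives. The
  relation then reads p(tau) = 0, where p collects the coefficients of the powers of T for that
  triple.\<close>

lemma mon_independent:
  assumes "finite S" and zero: "\<And>n. (\<Sum>m\<in>S. op_scal (c m) * rho0 n (mon m)) = 0" and "m0 \<in> S"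
  shows "c m0 = 0"
proof (rule ccontr)
  assume "c m0 \<noteq> 0"
  define deg where "deg = (\<lambda>(a :: nat, b, c, d). b + c + d :: nat)"
  define S' where "S' = {m \<in> S. c m \<noteq> 0}"
  have "m0 \<in> S'" using assms(3) \<open>c m0 \<noteq> 0\<close> by (simp add: S'_def)
  then have S': "finite S'" "S' \<noteq> {}" using assms(1) by (simp add: S'_def, blast)
  define N where "N = Max (deg ` S')"
  have le: "deg m \<le> N" if "m \<in> S'" for m using S' that by (simp add: N_def)
  obtain a0 b0 c0 d0 where m: "(a0, b0, c0, d0) \<in> S'" "b0 + c0 + d0 = N"
  proof -
    have "N \<in> deg ` S'" unfolding N_def using S' by (intro Max_in) auto
    then show ?thesis using that by (auto simp: deg_def)
  qed
  define A where "A = {a. (a, b0, c0, d0) \<in> S'}"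
  have A: "finite A"
  proof (rule finite_subset)
    show "A \<subseteq> fst ` S'" unfolding A_def by force
  qed (use S' in simp)
  define p where "p = (\<Sum>a\<in>A. monom (c (a, b0, c0, d0)) a)"
  \<comment> \<open>The argument is the value of T on a state with b0 factors W6, c0 factors W3, d0
    factors W4 and k factors W7; they contribute -2, -1, 0, -1 each. Increasing k yields infinitely
    many roots.\<close>
  have root: "poly p (of_int (- int k - 2 * int b0 - int c0)) = 0" for k
  proof -
    define n where "n = N + k"
    define s where "s j = (if j < b0 then W6 else if j < b0 + c0 then W3 else if j < N then W4 else W7)" for j
    let ?g = "\<lambda>b c d. app (rho0 n (Uh_E Node1 ^ b * (Yq ^ c * Xq ^ d))) v0 s"
    have sets: "{j. j < n \<and> s j = W6} = {..<b0}" "{j. j < n \<and> s j = W3} = {b0..<b0+c0}"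
      "{j. j < n \<and> s j = W4} = {b0+c0..<N}" "{j. j < n \<and> s j = W1} = {}" "{j. j < n \<and> s j = W2} = {}"
      "{j. j < n \<and> s j = W5} = {}" "exc n s = {..<N}"
      using m(2) by (auto simp: s_def n_def exc_def split: if_splits)
    have tail: "\<forall>j\<ge>n. s j = W7" using m(2) by (auto simp: s_def n_def)
    have cnt: "(\<forall>w. w \<noteq> W7 \<longrightarrow> cnt n s w = content b c d w) \<longleftrightarrow> b = b0 \<and> c = c0 \<and> d = d0" for b c d
    proof -
      have "(\<forall>w. w \<noteq> W7 \<longrightarrow> P w) \<longleftrightarrow> P W1 \<and> P W2 \<and> P W3 \<and> P W4 \<and> P W5 \<and> P W6" for P
        by (rule iffI, simp, intro allI, rename_tac w, case_tac w, simp_all)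
      then have "(\<forall>w. w \<noteq> W7 \<longrightarrow> cnt n s w = content b c d w) \<longleftrightarrow>
        cnt n s W1 = 0 \<and> cnt n s W2 = 0 \<and> cnt n s W3 = c \<and> cnt n s W4 = d \<and> cnt n s W5 = 0 \<and> cnt n s W6 = b"
        by (simp add: content_def)
      also have "\<dots> \<longleftrightarrow> b = b0 \<and> c = c0 \<and> d = d0"
        unfolding cnt_def sets using m(2) by auto
      finally show ?thesis .
    qed
    have small: "?g b c d = 0" if "b + c + d < N" for b c d
      using leading_support[OF leading_mon[of n b c d], of s] that by (auto simp: sets)
    have eq: "\<exists>M::nat. ?g b c d = 2 ^ d * (- 3) ^ c * of_nat M \<and> (M > 0 \<longleftrightarrow> b = b0 \<and> c = c0 \<and> d = d0)"
      if "b + c + d = N" for b c d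
      using leading_value[OF leading_mon[of n b c d] tail] that unfolding cnt by (simp add: sets)
    have nz: "?g b0 c0 d0 \<noteq> 0" using eq[OF m(2)] by auto
    have other: "?g b c d = 0" if "b + c + d \<le> N" "(b, c, d) \<noteq> (b0, c0, d0)" for b c d
      using small[of b c d] eq[of b c d] that by (cases "b + c + d = N") auto
    have tau: "tau n s = - int k - 2 * int b0 - int c0"
    proof -
      define g :: "nat \<Rightarrow> int" where "g j = (if j < b0 then -2 else if j < b0 + c0 then -1 else if j < N then 0 else -1)" for j
      have "tau n s = sum g {0..<n}"
        unfolding tau_def lessThan_atLeast0 by (rule sum.cong) (auto simp: s_def g_def)
      also have "\<dots> = sum g {0..<b0} + sum g {b0..<b0+c0} + sum g {b0+c0..<N} + sum g {N..<n}"
        using m(2) by (simp add: sum.atLeastLessThan_concat n_def)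
      also have "sum g {0..<b0} = (\<Sum>j\<in>{0..<b0}. -2)" by (rule sum.cong) (auto simp: g_def)
      also have "sum g {b0..<b0+c0} = (\<Sum>j\<in>{b0..<b0+c0}. -1)" by (rule sum.cong) (auto simp: g_def)
      also have "sum g {b0+c0..<N} = 0" by (rule sum.neutral) (auto simp: g_def)
      also have "sum g {N..<n} = (\<Sum>j\<in>{N..<n}. -1)" using m(2) by (intro sum.cong) (auto simp: g_def)
      also have "(\<Sum>j\<in>{0..<b0}. -2) + (\<Sum>j\<in>{b0..<b0+c0}. -1) + 0 + (\<Sum>j\<in>{N..<n}. -1) = - int k - 2 * int b0 - int c0"
        by (simp add: n_def)
      finally show ?thesis .
    qed
    have "0 = app (\<Sum>m\<in>S. op_scal (c m) * rho0 n (mon m)) v0 s"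
      by (simp add: zero app_simps)
    also have "\<dots> = (\<Sum>m\<in>S. c m * app (rho0 n (mon m)) v0 s)"
      by (simp add: app_sum app_simps op_scal.rep_eq)
    also have "\<dots> = (\<Sum>m\<in>S'. c m * app (rho0 n (mon m)) v0 s)"
      using assms(1) by (intro sum.mono_neutral_right) (auto simp: S'_def)
    also have "\<dots> = (\<Sum>m\<in>(\<lambda>a. (a, b0, c0, d0)) ` A. c m * app (rho0 n (mon m)) v0 s)"
    proof (rule sum.mono_neutral_right)
      show "finite S'" by (rule S')
      show "(\<lambda>a. (a, b0, c0, d0)) ` A \<subseteq> S'" by (auto simp: A_def)
      show "\<forall>m\<in>S' - (\<lambda>a. (a, b0, c0, d0)) ` A. c m * app (rho0 n (mon m)) v0 s = 0"
      proof
        fix m assume m: "m \<in> S' - (\<lambda>a. (a, b0, c0, d0)) ` A"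
        obtain a b c' d where [simp]: "m = (a, b, c', d)" by (cases m)
        have "b + c' + d \<le> N" using le[of m] m by (simp add: deg_def)
        moreover have "(b, c', d) \<noteq> (b0, c0, d0)" using m by (auto simp: A_def)
        ultimately show "c m * app (rho0 n (mon m)) v0 s = 0" by (simp add: rho0_mon other)
      qed
    qed
    also have "\<dots> = (\<Sum>a\<in>A. c (a, b0, c0, d0) * (of_int (tau n s) ^ a * ?g b0 c0 d0))"
      by (subst sum.reindex) (auto simp: inj_on_def rho0_mon)
    also have "\<dots> = poly p (of_int (tau n s)) * ?g b0 c0 d0"
      by (simp add: p_def poly_sum poly_monom sum_distrib_right mult.assoc)
    finally show ?thesis using nz by (simp add: tau)
  qed
  have "inj (\<lambda>k::nat. of_int (- int k - 2 * int b0 - int c0) :: complex)"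
  proof (rule injI)
    fix k l :: nat assume "of_int (- int k - 2 * int b0 - int c0) = (of_int (- int l - 2 * int b0 - int c0) :: complex)"
    then have "- int k - 2 * int b0 - int c0 = - int l - 2 * int b0 - int c0" by (simp only: of_int_eq_iff)
    then show "k = l" by simp
  qed
  then have "infinite (range (\<lambda>k::nat. of_int (- int k - 2 * int b0 - int c0) :: complex))"
    by (rule range_inj_infinite)
  moreover have "range (\<lambda>k::nat. of_int (- int k - 2 * int b0 - int c0) :: complex) \<subseteq> {x. poly p x = 0}"
    using root by auto
  ultimately have "p = 0" using poly_roots_finite[of p] finite_subset by blast
  then have "coeff p a0 = 0" by simp
  moreover have "coeff p a0 = c (a0, b0, c0, d0)"
    using A m(1) by (simp add: p_def coeff_sum A_def sum.delta)
  ultimately show False using m(1) by (simp add: S'_def)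
qed

text \<open>Independence at h = 0 shows that all coefficients are divisible by h; one power is
  divided out and the argument repeats. The cancellation takes place in power series with operator
  coefficients, where h is not a zero divisor.\<close>

lemma mon_divisible:
  assumes "finite S" and "\<And>n. \<exists>y. (\<Sum>m\<in>S. op.fscal (c m) * rho.Hom n (mon m)) = fps_X ^ N * y" and "m0 \<in> S"
  shows "\<exists>d. c m0 = fps_X ^ N * d"
  using assms(2)
proof (induction N arbitrary: c)
  case 0
  then show ?case by simp
next
  case (Suc N)
  have z: "fps_nth (c m) 0 = 0" if "m \<in> S" for m
  proof (rule mon_independent[OF assms(1) _ that, of "\<lambda>m. fps_nth (c m) 0"])
    fix n
    obtain y where "(\<Sum>m\<in>S. op.fscal (c m) * rho.Hom n (mon m)) = fps_X ^ Suc N * y" using Suc.prems by blast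
    then have "fps_nth (\<Sum>m\<in>S. op.fscal (c m) * rho.Hom n (mon m)) 0 = 0" by simp
    then show "(\<Sum>m\<in>S. op_scal (fps_nth (c m) 0) * rho0 n (mon m)) = 0"
      by (simp add: fps_sum_nth op.fscal_nth rho0_def)
  qed
  define c' where "c' m = fps_shift 1 (c m)" for m
  have c: "c m = fps_X * c' m" if "m \<in> S" for m
    by (rule fps_ext) (use z[OF that] in \<open>auto simp: c'_def\<close>)
  have "\<exists>y. (\<Sum>m\<in>S. op.fscal (c' m) * rho.Hom n (mon m)) = fps_X ^ N * y" for n
  proof -
    obtain y where y: "(\<Sum>m\<in>S. op.fscal (c m) * rho.Hom n (mon m)) = fps_X ^ Suc N * y" using Suc.prems by blast
    have "(\<Sum>m\<in>S. op.fscal (c m) * rho.Hom n (mon m)) = fps_X * (\<Sum>m\<in>S. op.fscal (c' m) * rho.Hom n (mon m))"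
      unfolding sum_distrib_left by (rule sum.cong) (simp_all add: c op.fscal_hom op.fscal_X mult.assoc)
    then have "fps_X * (\<Sum>m\<in>S. op.fscal (c' m) * rho.Hom n (mon m)) = fps_X * (fps_X ^ N * y)"
      using y by (simp add: mult.assoc)
    from arg_cong[OF this, of "fps_shift 1"] show ?thesis by (auto simp only: op.fps_shift_X_mult)
  qed
  from Suc.IH[OF this] obtain d where "c' m0 = fps_X ^ N * d" by blast
  then show ?case using c[OF assms(3)] by (auto simp: mult.assoc)
qed

lemma mon_divisible_Uh:
  assumes "finite S" and "(\<Sum>m\<in>S. Uh_scal (c m) * mon m) = Uh_h ^ N * u" and "m0 \<in> S"
  shows "\<exists>d. c m0 = fps_X ^ N * d"
proof (rule mon_divisible[OF assms(1) _ assms(3)])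
  fix n
  have "rho.Hom n (\<Sum>m\<in>S. Uh_scal (c m) * mon m) = fps_X ^ N * rho.Hom n u"
    unfolding assms(2) by (rule rho.Hom_gens)
  then show "\<exists>y. (\<Sum>m\<in>S. op.fscal (c m) * rho.Hom n (mon m)) = fps_X ^ N * y"
    unfolding rho.Hom_sum rho.Hom_hom(3) rho.Hom_gens(1) by blast
qed

section \<open>The subalgebra generated by the quantum coisotropic generators\<close>

inductive_set mspan :: "Uh set" where
  zero: "0 \<in> mspan"
| step: "x \<in> mspan \<Longrightarrow> x + Uh_scal c * mon m \<in> mspan"

lemma mspan_add:
  assumes "x \<in> mspan" "y \<in> mspan"
  shows "x + y \<in> mspan"
  using assms(2)
proof (induction y rule: mspan.induct)
  case (step y c m)
  then show ?case using mspan.step[of "x + y" c m] by (simp add: add.assoc)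
qed (simp add: assms)

lemma mspan_scal: "x \<in> mspan \<Longrightarrow> Uh_scal d * x \<in> mspan"
proof (induction x rule: mspan.induct)
  case (step x c m)
  then show ?case using mspan.step[of "Uh_scal d * x" "d * c" m] by (simp add: distrib_left Uh.\<sigma>_mult mult.assoc)
qed (simp add: mspan.zero)

lemma mspan_diff: "x \<in> mspan \<Longrightarrow> y \<in> mspan \<Longrightarrow> x - y \<in> mspan"
  using mspan_add[of x "Uh_scal (- 1) * y"] mspan_scal[of y "- 1"] by (simp add: Uh.\<sigma>_minus Uh.\<sigma>_1)

lemma mspan_mon: "mon m \<in> mspan"
  using mspan.step[OF mspan.zero, of 1 m] by (simp add: Uh.\<sigma>_1)

lemma mspan_left_mult:
  assumes "\<And>m. g * mon m \<in> mspan" "x \<in> mspan"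
  shows "g * x \<in> mspan"
  using assms(2)
proof (induction x rule: mspan.induct)
  case (step x c m)
  then show ?case using mspan_add[OF step.IH mspan_scal[OF assms(1), of c m]]
    by (simp add: distrib_left Uh.\<sigma>_left_commute[of g])
qed (simp add: mspan.zero)

text \<open>Extending the coefficients by zero allows combinations with different supports to be
  compared on the union of the supports.\<close>

lemma mspan_sum_form:
  assumes "x \<in> mspan"
  shows "\<exists>S c. finite S \<and> (\<forall>m. m \<notin> S \<longrightarrow> c m = 0) \<and> x = (\<Sum>m\<in>S. Uh_scal (c m) * mon m)"
  using assms
proof (induction x rule: mspan.induct)
  case zero
  show ?case by (rule exI[of _ "{}"], rule exI[of _ "\<lambda>_. 0"]) simp
next
  case (step x d m)
  then obtain S c where S: "finite S" "\<forall>m. m \<notin> S \<longrightarrow> c m = 0" and x: "x = (\<Sum>m\<in>S. Uh_scal (c m) * mon m)" by blast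
  let ?c = "c(m := c m + d)"
  have "x = (\<Sum>m\<in>insert m S. Uh_scal (c m) * mon m)"
    unfolding x using S by (intro sum.mono_neutral_left) (auto simp: Uh.\<sigma>_0)
  also have "\<dots> = Uh_scal (c m) * mon m + (\<Sum>m\<in>insert m S - {m}. Uh_scal (c m) * mon m)"
    using S by (subst sum.remove[of _ m]) auto
  finally have "x + Uh_scal d * mon m = Uh_scal (?c m) * mon m + (\<Sum>m\<in>insert m S - {m}. Uh_scal (c m) * mon m)"
    by (simp add: Uh.\<sigma>_add distrib_right add_ac)
  also have "(\<Sum>m\<in>insert m S - {m}. Uh_scal (c m) * mon m) = (\<Sum>m\<in>insert m S - {m}. Uh_scal (?c m) * mon m)"
    by (rule sum.cong) auto
  also have "Uh_scal (?c m) * mon m + (\<Sum>m\<in>insert m S - {m}. Uh_scal (?c m) * mon m) = (\<Sum>m\<in>insert m S. Uh_scal (?c m) * mon m)"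
    using S by (subst (2) sum.remove[of _ m]) auto
  finally have "x + Uh_scal d * mon m = (\<Sum>m\<in>insert m S. Uh_scal (?c m) * mon m)" .
  moreover have "\<forall>k. k \<notin> insert m S \<longrightarrow> ?c k = 0" using S by auto
  moreover have "finite (insert m S)" using S by simp
  ultimately show ?case by blast
qed

lemma mspan_sum: "finite S \<Longrightarrow> (\<Sum>m\<in>S. Uh_scal (c m) * mon m) \<in> mspan"
  by (induction S rule: finite_induct) (auto intro: mspan.zero mspan_add mspan_scal mspan_mon)

abbreviation (input) "Eq \<equiv> Uh_E Node1"

lemma XY_Uh: "Xq = Uh.Xel (Uh_E Node1) (Uh_E Node2)" "Yq = Uh.Yel (Uh_E Node1) (Uh_E Node2)"
  by (simp_all add: Xq_def Yq_def qcomm_def Uh.Xel_def Uh.Yel_def Uh.Zel_def Uh.q_def mult.assoc)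

text \<open>The first rule is the quartic Serre relation, the second is the definition of Y, and
  only the third needs both Serre relations.\<close>

lemma quantum_relations:
  "Yq * Eq = Uh.q 3 * (Eq * Yq)" "Xq * Eq = Uh.q 1 * (Eq * Xq) + Yq" "Xq * Yq = Uh.q 3 * (Yq * Xq)"
proof -
  show "Yq * Eq = Uh.q 3 * (Eq * Yq)" using Uh.serreE(1) by (simp add: Uh.serre12_def XY_Uh)
  show "Xq * Eq = Uh.q 1 * (Eq * Xq) + Yq" by (simp add: XY_Uh Uh.Yel_def)
  show "Xq * Yq = Uh.q 3 * (Yq * Xq)" unfolding XY_Uh by (rule Uh.XY_commute[OF Uh.serreE])
qed

definition twt :: "node \<Rightarrow> int" where "twt j = cartan Node1 j + 3 * cartan Node2 j"

lemma T_E: "Uh_E j * Tq = (Tq - Uh_scal (of_int (twt j))) * Uh_E j"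
proof -
  have "Tq * Uh_E j = Uh_E j * Tq + Uh_scal (of_int (twt j)) * Uh_E j"
    by (simp add: Tq_def Uh_logK_def distrib_left distrib_right mult.assoc Uh.HE Uh.\<sigma>_left_commute[of "Uh_E j"]
        Uh.\<sigma>_1 twt_def Uh.\<sigma>_add Uh.\<sigma>_mult add_ac)
  then show ?thesis by (simp add: algebra_simps)
qed

lemma T_mult:
  assumes "x * Tq = (Tq - Uh_scal (of_int j)) * x" "y * Tq = (Tq - Uh_scal (of_int k)) * y"
  shows "(x * y) * Tq = (Tq - Uh_scal (of_int (j + k))) * (x * y)"
proof -
  have "(x * y) * Tq = x * ((Tq - Uh_scal (of_int k)) * y)" using assms(2) by (simp add: mult.assoc)
  also have "\<dots> = (x * Tq) * y - Uh_scal (of_int k) * (x * y)"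
    by (simp add: algebra_simps Uh.\<sigma>_left_commute[of x])
  finally show ?thesis unfolding assms(1) by (simp add: algebra_simps Uh.\<sigma>_add)
qed

lemma T_qcomm:
  assumes "x * Tq = (Tq - Uh_scal (of_int j)) * x" "y * Tq = (Tq - Uh_scal (of_int k)) * y"
  shows "qcomm l x y * Tq = (Tq - Uh_scal (of_int (j + k))) * qcomm l x y"
proof -
  let ?t = "Tq - Uh_scal (of_int (j + k))"
  have "qcomm l x y * Tq = (x * y) * Tq - Uh_scal (qpow l) * ((y * x) * Tq)"
    by (simp only: qcomm_def left_diff_distrib mult.assoc)
  also have "\<dots> = ?t * (x * y) - Uh_scal (qpow l) * (?t * (y * x))"
    by (simp only: T_mult[OF assms] T_mult[OF assms(2,1), unfolded add.commute[of k j]])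
  also have "\<dots> = ?t * qcomm l x y"
    by (simp only: qcomm_def right_diff_distrib Uh.\<sigma>_left_commute[of ?t] mult.assoc)
  finally show ?thesis .
qed

text \<open>T has weight -1 on E_1 and 3 on E_2. X contains E_1 twice and E_2 once, hence has weight
  1; Y contains E_1 three times, hence has weight 0.\<close>

lemma T_commute:
  "Eq * Tq = (Tq + 1) * Eq" "Xq * Tq = (Tq - 1) * Xq" "Yq * Tq = Tq * Yq"
proof -
  have E: "Eq * Tq = (Tq - Uh_scal (of_int (- 1))) * Eq" "Uh_E Node2 * Tq = (Tq - Uh_scal (of_int 3)) * Uh_E Node2"
    using T_E[of Node1] T_E[of Node2] by (simp_all add: twt_def)
  have X: "Xq * Tq = (Tq - Uh_scal (of_int 1)) * Xq"
    unfolding Xq_def using T_qcomm[OF T_qcomm[OF E(1,2), of 3] E(1), of "- 1"] by simp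
  then show "Xq * Tq = (Tq - 1) * Xq" by (simp add: Uh.\<sigma>_1)
  show "Eq * Tq = (Tq + 1) * Eq" using E(1) by (simp add: Uh.\<sigma>_1 Uh.\<sigma>_minus)
  show "Yq * Tq = Tq * Yq"
    using T_qcomm[OF X E(1), of 1] by (simp add: Yq_def Xq_def[symmetric] Uh.\<sigma>_0)
qed

lemma mspan_T:
  assumes "x \<in> mspan" shows "Tq * x \<in> mspan"
proof (rule mspan_left_mult[OF _ assms])
  fix m :: "nat \<times> nat \<times> nat \<times> nat"
  obtain a b c d where m: "m = (a, b, c, d)" by (cases m)
  have "Tq * mon m = mon (Suc a, b, c, d)" by (simp add: m mon_def mult.assoc)
  then show "Tq * mon m \<in> mspan" by (simp add: mspan_mon)
qed

text \<open>Moving g past a power of T only shifts T by a scalar, so the powers of T may be ignored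
  when g is brought into normal order.\<close>

lemma mspan_intertwine:
  assumes "g * Tq = (Tq + Uh_scal k) * g" and "\<And>b c d. g * mon (0, b, c, d) \<in> mspan" and "x \<in> mspan"
  shows "g * x \<in> mspan"
proof (rule mspan_left_mult[OF _ assms(3)])
  fix m :: "nat \<times> nat \<times> nat \<times> nat"
  obtain a b c d where m: "m = (a, b, c, d)" by (cases m)
  have "g * mon (a, b, c, d) \<in> mspan"
  proof (induction a)
    case (Suc a)
    have "mon (Suc a, b, c, d) = Tq * mon (a, b, c, d)" by (simp add: mon_def mult.assoc)
    then have "g * mon (Suc a, b, c, d) = Tq * (g * mon (a, b, c, d)) + Uh_scal k * (g * mon (a, b, c, d))"
      using assms(1) by (simp add: distrib_right flip: mult.assoc)
    then show ?case using mspan_add mspan_T mspan_scal Suc by simp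
  qed (rule assms(2))
  then show "g * mon m \<in> mspan" by (simp add: m)
qed

lemma mspan_E: assumes "x \<in> mspan" shows "Eq * x \<in> mspan"
proof (rule mspan_intertwine[of _ 1, OF _ _ assms])
  show "Eq * Tq = (Tq + Uh_scal 1) * Eq" by (simp add: T_commute Uh.\<sigma>_1)
  fix b c d
  have "Eq * mon (0, b, c, d) = mon (0, Suc b, c, d)" by (simp add: mon_def mult.assoc)
  then show "Eq * mon (0, b, c, d) \<in> mspan" by (simp add: mspan_mon)
qed

lemma mspan_Y: assumes "x \<in> mspan" shows "Yq * x \<in> mspan"
proof (rule mspan_intertwine[of _ 0, OF _ _ assms])
  show "Yq * Tq = (Tq + Uh_scal 0) * Yq" by (simp add: T_commute Uh.\<sigma>_0)
  fix b c d
  show "Yq * mon (0, b, c, d) \<in> mspan"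
  proof (induction b)
    case 0
    have "Yq * mon (0, 0, c, d) = mon (0, 0, Suc c, d)" by (simp add: mon_def mult.assoc)
    then show ?case by (simp add: mspan_mon)
  next
    case (Suc b)
    have "mon (0, Suc b, c, d) = Eq * mon (0, b, c, d)" by (simp add: mon_def mult.assoc)
    then have "Yq * mon (0, Suc b, c, d) = Uh.q 3 * (Eq * (Yq * mon (0, b, c, d)))"
      using quantum_relations(1) by (simp only: mult.assoc[symmetric])
    then show ?case using Suc by (simp add: Uh.q_def mspan_scal mspan_E)
  qed
qed

text \<open>Passing X through E_1 leaves a summand Y. It is absorbed because left multiplication by
  Y already preserves the span, and this dictates the order of the lemmas.\<close>

lemma mspan_X: assumes "x \<in> mspan" shows "Xq * x \<in> mspan"
proof (rule mspan_intertwine[of _ "- 1", OF _ _ assms])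
  show "Xq * Tq = (Tq + Uh_scal (- 1)) * Xq" by (simp add: T_commute Uh.\<sigma>_1 Uh.\<sigma>_minus)
  fix b c d
  show "Xq * mon (0, b, c, d) \<in> mspan"
  proof (induction b)
    case 0
    show ?case
    proof (induction c)
      case 0
      have "Xq * mon (0, 0, 0, d) = mon (0, 0, 0, Suc d)" by (simp add: mon_def)
      then show ?case by (simp add: mspan_mon)
    next
      case (Suc c)
      have "mon (0, 0, Suc c, d) = Yq * mon (0, 0, c, d)" by (simp add: mon_def mult.assoc)
      then have "Xq * mon (0, 0, Suc c, d) = Uh.q 3 * (Yq * (Xq * mon (0, 0, c, d)))"
        using quantum_relations(3) by (simp only: mult.assoc[symmetric])
      then show ?case using Suc by (simp add: Uh.q_def mspan_scal mspan_Y)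
    qed
  next
    case (Suc b)
    have "mon (0, Suc b, c, d) = Eq * mon (0, b, c, d)" by (simp add: mon_def mult.assoc)
    then have "Xq * mon (0, Suc b, c, d) = (Xq * Eq) * mon (0, b, c, d)"
      by (simp only: mult.assoc)
    also have "\<dots> = Uh.q 1 * (Eq * (Xq * mon (0, b, c, d))) + Yq * mon (0, b, c, d)"
      unfolding quantum_relations(2) by (simp only: distrib_right mult.assoc)
    finally show ?case using Suc by (simp add: Uh.q_def mspan_scal mspan_E mspan_Y mspan_add mspan_mon)
  qed
qed

lemma mspan_mult:
  assumes "x \<in> mspan" "y \<in> mspan" shows "x * y \<in> mspan"
  using assms(1)
proof (induction x rule: mspan.induct)
  case (step x c m)
  have pow: "g ^ n * z \<in> mspan" if "\<And>z. z \<in> mspan \<Longrightarrow> g * z \<in> mspan" "z \<in> mspan" for g n z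
    by (induction n) (simp_all add: that mult.assoc)
  obtain a b c' d where m: "m = (a, b, c', d)" by (cases m)
  have "mon m * y \<in> mspan"
    unfolding m mon_def prod.case mult.assoc
    by (rule pow[OF mspan_T], assumption, rule pow[OF mspan_E], assumption, rule pow[OF mspan_Y], assumption,
        rule pow[OF mspan_X], assumption, rule assms(2))
  then show ?case using mspan_add[OF step.IH mspan_scal] by (simp add: distrib_right mult.assoc)
qed (simp add: mspan.zero)

lemma mspan_1: "1 \<in> mspan"
  using mspan_mon[of "(0, 0, 0, 0)"] by (simp add: mon_def)

definition "gens_B = {Uh_K Node1 * Uh_K Node2, Tq, Eq, Xq, Yq}"

section \<open>Divided powers and the torus generator as an exponential\<close>

context ring_scalars
begin

definition dpow :: "nat \<Rightarrow> 'a \<Rightarrow> 'a" where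
  "dpow n x = \<sigma> (fps_const (1 / fact n)) * x ^ n"

lemma dpow_Suc: "\<sigma> (of_nat (Suc n)) * dpow (Suc n) x = x * dpow n x"
proof -
  have "of_nat (Suc n) * fps_const (1 / fact (Suc n)) = (fps_const (1 / fact n) :: complex fps)"
    by (simp add: fps_of_nat[symmetric] field_simps del: of_nat_Suc)
  then have "\<sigma> (of_nat (Suc n)) * dpow (Suc n) x = \<sigma> (fps_const (1 / fact n)) * x * x ^ n"
    by (simp only: dpow_def power_Suc mult.assoc[symmetric] \<sigma>_mult[symmetric])
  then show ?thesis by (simp only: dpow_def \<sigma>_central[of _ x] mult.assoc[symmetric])
qed

lemma of_nat_Suc_cancel: "\<sigma> (of_nat (Suc n)) * x = \<sigma> (of_nat (Suc n)) * y \<Longrightarrow> x = y"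
proof -
  have *: "\<sigma> (fps_const (1 / of_nat (Suc n))) * (\<sigma> (of_nat (Suc n)) * z) = z" for z
  proof -
    have "fps_const (1 / of_nat (Suc n)) * of_nat (Suc n) = (1 :: complex fps)"
      by (simp add: fps_of_nat[symmetric] del: of_nat_Suc)
    then show ?thesis by (simp only: mult.assoc[symmetric] \<sigma>_mult[symmetric] \<sigma>_1 mult_1_left)
  qed
  assume "\<sigma> (of_nat (Suc n)) * x = \<sigma> (of_nat (Suc n)) * y"
  from arg_cong[OF this, of "\<lambda>z. \<sigma> (fps_const (1 / of_nat (Suc n))) * z"] show "x = y" by (simp only: *)
qed

lemma dpow_add:
  assumes xy: "x * y = y * x"
  shows "(\<Sum>i\<le>n. dpow i x * dpow (n - i) y) = dpow n (x + y)"
proof (induction n)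
  case 0
  show ?case by (simp add: dpow_def \<sigma>_1)
next
  case (Suc n)
  have c: "y * dpow i x = dpow i x * y" for i
    using power_commuting_commutes[OF xy, of i]
    by (simp add: dpow_def \<sigma>_left_commute[of y] mult.assoc)
  have "\<sigma> (of_nat (Suc n)) * (\<Sum>i\<le>Suc n. dpow i x * dpow (Suc n - i) y)
      = (\<Sum>i\<le>Suc n. (\<sigma> (of_nat i) + \<sigma> (of_nat (Suc n - i))) * (dpow i x * dpow (Suc n - i) y))"
    unfolding sum_distrib_left \<sigma>_add[symmetric] of_nat_add[symmetric] by (rule sum.cong) simp_all
  also have "\<dots> = (\<Sum>i\<le>Suc n. \<sigma> (of_nat i) * dpow i x * dpow (Suc n - i) y)
      + (\<Sum>i\<le>Suc n. dpow i x * (\<sigma> (of_nat (Suc n - i)) * dpow (Suc n - i) y))"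
    unfolding sum.distrib[symmetric] distrib_right
    by (rule sum.cong) (simp_all only: mult.assoc \<sigma>_left_commute[of "dpow _ x"])
  also have "(\<Sum>i\<le>Suc n. \<sigma> (of_nat i) * dpow i x * dpow (Suc n - i) y) = (\<Sum>i\<le>n. x * dpow i x * dpow (n - i) y)"
    unfolding sum.atMost_Suc_shift by (simp add: dpow_Suc \<sigma>_0 del: of_nat_Suc)
  also have "(\<Sum>i\<le>Suc n. dpow i x * (\<sigma> (of_nat (Suc n - i)) * dpow (Suc n - i) y)) = (\<Sum>i\<le>n. y * dpow i x * dpow (n - i) y)"
    unfolding sum.atMost_Suc by (simp add: Suc_diff_le dpow_Suc c mult.assoc \<sigma>_0 del: of_nat_Suc)
  also have "(\<Sum>i\<le>n. x * dpow i x * dpow (n - i) y) + (\<Sum>i\<le>n. y * dpow i x * dpow (n - i) y)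
      = (x + y) * (\<Sum>i\<le>n. dpow i x * dpow (n - i) y)"
    by (simp add: sum_distrib_left distrib_right mult.assoc sum.distrib)
  also have "\<dots> = \<sigma> (of_nat (Suc n)) * dpow (Suc n) (x + y)" by (simp only: Suc dpow_Suc)
  finally show ?case by (rule of_nat_Suc_cancel)
qed

end

lemma fps_truncate: "\<exists>y. f = (\<Sum>k<n. fps_X ^ k * fps_const (fps_nth f k)) + fps_X ^ n * (y :: 'b::ring_1 fps)"
proof -
  have "fps_nth (\<Sum>k<n. fps_X ^ k * fps_const (fps_nth f k)) m = (if m < n then fps_nth f m else 0)" for m
  proof -
    have "fps_nth (\<Sum>k<n. fps_X ^ k * fps_const (fps_nth f k)) m = (\<Sum>k<n. if m = k then fps_nth f k else 0)"
      unfolding fps_sum_nth by (rule sum.cong) (auto simp: fps_X_power_mult_nth)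
    then show ?thesis by simp
  qed
  then have "f = (\<Sum>k<n. fps_X ^ k * fps_const (fps_nth f k)) + fps_X ^ n * fps_shift n f"
    by (intro fps_ext) (simp add: fps_X_power_mult_nth)
  then show ?thesis by blast
qed

text \<open>\<open>K_1 K_2\<close> is e^{hT}. Since H_1 and H_2 commute only after passing to U_h,
  the law for exponentials over the free algebra does not apply; instead each coefficient of the
  product is mapped to the quotient and identified with T^k / k! by the binomial theorem.\<close>

lemma K1K2_closure: "Uh_K Node1 * Uh_K Node2 \<in> adic_closure Uh_h mspan"
proof (rule adic_closureI)
  fix n
  let ?a = "\<lambda>i. cst (of_nat (symm i)) * lt (HH i)"
  let ?f = "cst_free.exph (?a Node1) * cst_free.exph (?a Node2)"
  have c: "abs_Uh (fps_const (cst c)) = Uh_scal (fps_const c)" for c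
    by (simp add: Uh_scal_def cst_free.fscal_const flip: fscal_cst(1))
  have a: "abs_Uh (fps_const (?a i)) = Uh_logK i" for i
    by (simp add: Uh_logK_def Uh_H_def c fps_of_nat[symmetric] times_Uh.abs_eq flip: fps_const_mult c)
  have comm: "Uh_logK Node1 * Uh_logK Node2 = Uh_logK Node2 * Uh_logK Node1"
  proof -
    have "Uh_logK Node1 * Uh_logK Node2 = Uh_scal (of_nat (symm Node1)) * (Uh_scal (of_nat (symm Node2)) * (Uh_H Node1 * Uh_H Node2))"
      unfolding Uh_logK_def mult.assoc Uh.\<sigma>_left_commute[of "Uh_H Node1"] ..
    also have "\<dots> = Uh_scal (of_nat (symm Node2)) * (Uh_scal (of_nat (symm Node1)) * (Uh_H Node2 * Uh_H Node1))"
      unfolding Uh.HH[of Node1 Node2] by (rule Uh.\<sigma>_left_commute)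
    also have "\<dots> = Uh_logK Node2 * Uh_logK Node1"
      unfolding Uh_logK_def mult.assoc Uh.\<sigma>_left_commute[of "Uh_H Node2"] ..
    finally show ?thesis .
  qed
  have dp: "abs_Uh (fps_const (cst (1 / fact k) * ?a i ^ k)) = Uh.dpow k (Uh_logK i)" for k i
    by (simp add: Uh.dpow_def c[symmetric] a[symmetric] times_Uh.abs_eq fps_const_power flip: abs_Uh_power)
  have coeff: "abs_Uh (fps_const (fps_nth ?f k)) = Uh.dpow k Tq" for k
  proof -
    have "fps_const (fps_nth ?f k) = (\<Sum>i\<le>k. fps_const (cst (1 / fact i) * ?a Node1 ^ i) * fps_const (cst (1 / fact (k - i)) * ?a Node2 ^ (k - i)))"
      by (rule fps_ext) (simp add: fps_mult_nth cst_free.exph_def atLeast0AtMost fps_sum_nth)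
    then have "abs_Uh (fps_const (fps_nth ?f k)) = (\<Sum>i\<le>k. Uh.dpow i (Uh_logK Node1) * Uh.dpow (k - i) (Uh_logK Node2))"
      by (simp only: abs_Uh_sum times_Uh.abs_eq[symmetric] dp)
    then show ?thesis unfolding Tq_def Uh.dpow_add[OF comm] .
  qed
  obtain y where "?f = (\<Sum>k<n. fps_X ^ k * fps_const (fps_nth ?f k)) + fps_X ^ n * y"
    using fps_truncate by blast
  then have "abs_Uh ?f = abs_Uh ((\<Sum>k<n. fps_X ^ k * fps_const (fps_nth ?f k)) + fps_X ^ n * y)" by simp
  then have "Uh_K Node1 * Uh_K Node2 = (\<Sum>k<n. Uh_h ^ k * Uh.dpow k Tq) + Uh_h ^ n * abs_Uh y"
    by (simp only: Uh_K_def K_exph times_Uh.abs_eq plus_Uh.abs_eq[symmetric] abs_Uh_sum Uh_h_power_mult[symmetric] coeff)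
  moreover have "(\<Sum>k<n. Uh_h ^ k * Uh.dpow k Tq) \<in> mspan"
  proof -
    have "Uh_h ^ k * Uh.dpow k Tq \<in> mspan" for k
    proof -
      have h: "Uh_h ^ k = Uh_scal (fps_X ^ k)"
        by (simp add: Uh_h_def Uh_scal_def cst_free.fscal_X[unfolded fscal_cst] flip: abs_Uh_power)
          (rule arg_cong[of _ _ abs_Uh], rule fps_ext, auto simp: scal_def fps_X_power_nth)
      have "Tq ^ k = mon (k, 0, 0, 0)" by (simp add: mon_def)
      then show ?thesis unfolding h Uh.dpow_def by (simp add: mspan_scal mspan_mon)
    qed
    then show ?thesis by (induction n) (simp_all add: mspan.zero mspan_add)
  qed
  ultimately show "\<exists>s\<in>mspan. \<exists>y. Uh_K Node1 * Uh_K Node2 - s = Uh_h ^ n * y"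
    by (metis add_diff_cancel_left')
qed

lemma generated_eq: "generated_Uh gens_B = adic_closure Uh_h mspan"
proof
  let ?G = "range Uh_scal \<union> gens_B"
  have in_mspan: "Tq \<in> mspan" "Eq \<in> mspan" "Xq \<in> mspan" "Yq \<in> mspan" "Uh_scal c \<in> mspan" for c
    using mspan_mon[of "(1, 0, 0, 0)"] mspan_mon[of "(0, 1, 0, 0)"] mspan_mon[of "(0, 0, 1, 0)"]
      mspan_mon[of "(0, 0, 0, 1)"] mspan_scal[OF mspan_1, of c] by (simp_all add: mon_def)
  have "?G \<subseteq> adic_closure Uh_h mspan"
    using K1K2_closure in_mspan subset_adic_closure[of mspan Uh_h] by (auto simp: gens_B_def)
  then have "ring_hull ?G \<subseteq> adic_closure Uh_h mspan"
    using subalgebra_of_closure_subset[of Uh_h _ ?G mspan] Uh_h_central mspan_1 mspan_diff mspan_mult by blast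
  then show "generated_Uh gens_B \<subseteq> adic_closure Uh_h mspan"
    unfolding generated_Uh_def using adic_closure_mono adic_closure_idem by blast
  have pow: "x ^ n \<in> ring_hull ?G" if "x \<in> ring_hull ?G" for x n
    by (induction n) (auto intro: ring_hull.intros that)
  have add: "x + y \<in> ring_hull ?G" if "x \<in> ring_hull ?G" "y \<in> ring_hull ?G" for x y
  proof -
    have "x - ((1 - 1) - y) \<in> ring_hull ?G" by (intro ring_hull.intros that)
    then show ?thesis by simp
  qed
  have "mspan \<subseteq> ring_hull ?G"
  proof
    fix x assume "x \<in> mspan"
    then show "x \<in> ring_hull ?G"
    proof induction
      case zero
      have "1 - 1 \<in> ring_hull ?G" by (intro ring_hull.intros)
      then show ?case by simp
    next
      case (step x c m)
      obtain a b c' d where m: "m = (a, b, c', d)" by (cases m)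
      have "mon m \<in> ring_hull ?G"
        unfolding m mon_def prod.case by (intro ring_hull.mult pow ring_hull.base) (auto simp: gens_B_def)
      then show ?case by (intro add step.IH ring_hull.mult) (auto intro: ring_hull.base)
    qed
  qed
  then show "adic_closure Uh_h mspan \<subseteq> generated_Uh gens_B"
    unfolding generated_Uh_def by (rule adic_closure_mono)
qed

section \<open>Specialization\<close>

lemma specialization_abs: "specialization (abs_Uh p) = abs_Ug (fps_nth p 0)"
  by (rule specialization.abs_eq)

lemma specialization_hom:
  "specialization (x + y) = specialization x + specialization y"
  "specialization (x - y) = specialization x - specialization y"
  "specialization (x * y) = specialization x * specialization y"
  "specialization 1 = 1" "specialization 0 = 0"
proof -
  obtain p r where "x = abs_Uh p" "y = abs_Uh r" by (metis Uh_cases)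
  then show "specialization (x + y) = specialization x + specialization y"
    "specialization (x - y) = specialization x - specialization y"
    "specialization (x * y) = specialization x * specialization y"
    by (simp_all add: specialization_abs plus_Uh.abs_eq minus_Uh.abs_eq times_Uh.abs_eq
        plus_Ug.abs_eq minus_Ug.abs_eq times_Ug.abs_eq)
qed (simp_all add: specialization_abs one_Uh_def zero_Uh_def one_Ug_def zero_Ug_def)

lemma specialization_scal: "specialization (Uh_scal c) = scale_Ug (fps_nth c 0) 1"
  by (simp add: Uh_scal_def specialization_abs scal_def scale_Ug_def)

lemma specialization_gens:
  "specialization (Uh_H i) = Ug_coroot i" "specialization (Uh_E i) = Ug_e i" "specialization (Uh_K i) = 1"
  by (simp_all add: Uh_H_def Uh_E_def Uh_K_def specialization_abs Ug_coroot_def Ug_e_def fK_def hexp_def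
      one_Ug_def single_one)

lemma specialization_h_power: "specialization (Uh_h ^ Suc n * x) = 0"
proof -
  obtain p where "x = abs_Uh p" by (metis Uh_cases)
  then show ?thesis by (simp only: Uh_h_power_mult specialization_abs) (simp add: zero_Ug_def)
qed

lemma scale_Ug_mult: "scale_Ug c x * y = scale_Ug c (x * y)" "x * scale_Ug c y = scale_Ug c (x * y)"
proof -
  show "scale_Ug c x * y = scale_Ug c (x * y)" by (simp add: scale_Ug_def mult.assoc)
  obtain a where "x = abs_Ug a" by (induct x rule: Ug.abs_induct) auto
  then have "x * abs_Ug (cst c) = abs_Ug (cst c) * x"
    by (simp add: times_Ug.abs_eq cst_free.\<kappa>_central)
  then show "x * scale_Ug c y = scale_Ug c (x * y)" unfolding scale_Ug_def by (simp flip: mult.assoc)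
qed

lemma scale_Ug_one_mult: "scale_Ug c 1 * x = scale_Ug c x"
  by (simp add: scale_Ug_mult)

lemma U_rels_lift:
  assumes "r \<in> U_rels"
  shows "\<exists>r'\<in>Uh_rels. fps_nth r' 0 = r"
proof -
  have if0: "fps_nth (if P then x else 0) 0 = (if P then fps_nth x 0 else 0)" for P and x :: "free fps"
    by simp
  have int0: "fps_nth (of_int k :: free fps) 0 = of_int k" for k
    by (simp add: fps_of_int[symmetric])
  have comm0: "fps_nth (commutator x y) 0 = commutator (fps_nth x 0) (fps_nth y 0)" for x y :: "free fps"
    by (simp add: commutator_def)
  note z = serre_0 comm0 int0 if0 fKquot_0 fps_sub_nth fps_add_nth fps_mult_nth_0 fps_nth_fps_const if_True simp_thms
  show ?thesis
    using assms
  proof cases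
    case (1 i j)
    show ?thesis by (rule bexI[OF _ Uh_rels.intros(1)[of i j]]) (simp only: z 1)
  next
    case (2 i j)
    show ?thesis by (rule bexI[OF _ Uh_rels.intros(2)[of i j]]) (simp only: z 2)
  next
    case (3 i j)
    show ?thesis by (rule bexI[OF _ Uh_rels.intros(3)[of i j]]) (simp only: z 3)
  next
    case (4 i j)
    show ?thesis by (rule bexI[OF _ Uh_rels.intros(4)[of i j]]) (simp only: z 4)
  next
    case (5 i j)
    show ?thesis by (rule bexI[OF _ Uh_rels.intros(5)[OF 5(2)]]) (simp only: z 5)
  next
    case (6 i j)
    show ?thesis by (rule bexI[OF _ Uh_rels.intros(6)[OF 6(2)]]) (simp only: z 6)
  qed
qed

text \<open>Every classical relation is the constant term of a quantum one, so an element of the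
  classical ideal lifts to the quantum ideal. Subtracting the lift removes the constant term of a
  representative. With specialization onto U(g), this is the isomorphism of U_h / h U_h with
  U(g).\<close>

lemma specialization_kernel:
  assumes "specialization x = 0"
  shows "\<exists>y. x = Uh_h * y"
proof -
  obtain p where p: "x = abs_Uh p" by (metis Uh_cases)
  have "abs_Ug (fps_nth p 0) = abs_Ug 0" using assms by (simp add: p specialization_abs zero_Ug_def)
  then have "fps_nth p 0 \<in> ideal_gen U_rels" by (simp add: Ug.abs_eq_iff U_ideal_def)
  moreover have "\<exists>s\<in>ideal_gen Uh_rels. fps_nth s 0 = a" if "a \<in> ideal_gen U_rels" for a
    using that
  proof induction
    case zero
    show ?case by (rule bexI[OF _ ideal_gen.zero]) simp
  next
    case (gen r a b)
    then obtain r' where "r' \<in> Uh_rels" "fps_nth r' 0 = r" using U_rels_lift by blast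
    then show ?case by (intro bexI[OF _ ideal_gen.gen[of r' _ "fps_const a" "fps_const b"]]) simp_all
  next
    case (add x y)
    then obtain s t where "s \<in> ideal_gen Uh_rels" "fps_nth s 0 = x" "t \<in> ideal_gen Uh_rels" "fps_nth t 0 = y" by blast
    then show ?case by (intro bexI[OF _ ideal_gen.add[of s _ t]]) simp_all
  qed
  ultimately obtain s where s: "s \<in> ideal_gen Uh_rels" "fps_nth s 0 = fps_nth p 0" by blast
  have "p - s = fps_X * fps_shift 1 (p - s)" by (rule fps_ext) (use s(2) in auto)
  then have "abs_Uh (p - s) = abs_Uh (fps_X * fps_shift 1 (p - s))" by simp
  moreover have "abs_Uh s = 0"
    unfolding abs_Uh_0_iff Uh_ideal_def using s(1) subset_adic_closure by blast
  ultimately have "x = Uh_h * abs_Uh (fps_shift 1 (p - s))"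
    by (simp only: abs_Uh_hom p Uh_h_def diff_zero)
  then show ?thesis by blast
qed

text \<open>The coefficients of approximations of \<open>b\<close> by combinations of monomials form a Cauchy sequence,
  because divisibility by \<open>h\<^sup>n\<close> in \<open>U\<^sub>h(\<gg>)\<close> can be read off the coefficients; they are divisible by \<open>h\<close>, and
  the quotients converge.\<close>

lemma mspan_closure_kernel:
  assumes b: "b \<in> adic_closure Uh_h mspan" and "specialization b = 0"
  shows "\<exists>u\<in>adic_closure Uh_h mspan. b = Uh_h * u"
proof -
  \<comment> \<open>Approximation to order n + 1 leaves order n after the coefficients have been
    divided by h.\<close>
  have "\<exists>s y. s \<in> mspan \<and> b = s + Uh_h ^ Suc n * y" for n
    by (rule adic_closureE[OF b, of "Suc n"]) blast
  then obtain s y where s: "\<And>n. s n \<in> mspan" and bs: "\<And>n. b = s n + Uh_h ^ Suc n * y n" by metis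
  have "\<exists>S c. finite S \<and> (\<forall>m. m \<notin> S \<longrightarrow> c m = 0) \<and> s n = (\<Sum>m\<in>S. Uh_scal (c m) * mon m)" for n
    by (rule mspan_sum_form[OF s])
  then obtain S c where S: "\<And>n. finite (S n)" and c0: "\<And>n m. m \<notin> S n \<Longrightarrow> c n m = 0"
    and sc: "\<And>n. s n = (\<Sum>m\<in>S n. Uh_scal (c n m) * mon m)" by metis
  have sup: "s n = (\<Sum>m\<in>A. Uh_scal (c n m) * mon m)" if "finite A" "S n \<subseteq> A" for n A
    unfolding sc using that c0 by (intro sum.mono_neutral_left) (auto simp: Uh.\<sigma>_0)
  have Xscal: "Uh_h * Uh_scal d = Uh_scal (fps_X * d)" "Uh_h ^ k * Uh_scal d = Uh_scal (fps_X ^ k * d)" for d k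
  proof -
    have 1: "scal fps_X = (fps_X :: free fps)" using cst_free.fscal_X by (simp add: fscal_cst)
    show *: "Uh_h * Uh_scal d = Uh_scal (fps_X * d)" for d
      by (simp add: Uh.\<sigma>_mult) (simp add: Uh_h_def Uh_scal_def 1)
    show "Uh_h ^ k * Uh_scal d = Uh_scal (fps_X ^ k * d)"
      by (induction k) (simp_all add: mult.assoc *)
  qed
  have "\<exists>d. c n m = fps_X * d" for n m
  proof (cases "m \<in> S n")
    case True
    have "specialization (s n) = 0"
      using assms(2) bs[of n] specialization_h_power[of n "y n"] by (simp add: specialization_hom del: power_Suc)
    then obtain u where "s n = Uh_h ^ 1 * u" using specialization_kernel by auto
    then show ?thesis using mon_divisible_Uh[OF S[of n], of "c n" 1 u m] True sc by auto
  next
    case False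
    then show ?thesis using c0 by (intro exI[of _ 0]) simp
  qed
  then obtain c' where c': "\<And>n m. c n m = fps_X * c' n m" by metis
  define r where "r n = (\<Sum>m\<in>S n. Uh_scal (c' n m) * mon m)" for n
  have r: "r n \<in> mspan" "Uh_h * r n = s n" for n
    unfolding r_def sc sum_distrib_left by (simp_all add: mspan_sum S c' Xscal(1)[symmetric] mult.assoc)
  have c'0: "c' n m = 0" if "m \<notin> S n" for n m
    using c0[OF that] c'[of n m] by simp
  have rsup: "r n = (\<Sum>m\<in>A. Uh_scal (c' n m) * mon m)" if "finite A" "S n \<subseteq> A" for n A
    unfolding r_def using that c'0 by (intro sum.mono_neutral_left) (auto simp: Uh.\<sigma>_0)
  have "\<exists>w. w \<in> mspan \<and> r (Suc n) - r n = Uh_h ^ n * w" for n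
  proof -
    let ?A = "S n \<union> S (Suc n)"
    have A: "finite ?A" using S by simp
    have "(\<Sum>m\<in>?A. Uh_scal (c (Suc n) m - c n m) * mon m) = s (Suc n) - s n"
      using sup[OF A, of n] sup[OF A, of "Suc n"] by (simp add: Uh.\<sigma>_diff left_diff_distrib sum_subtractf)
    also have "\<dots> = Uh_h ^ Suc n * y n - Uh_h ^ Suc (Suc n) * y (Suc n)"
    proof -
      have "q - p = v - w" if "b = p + v" "b = q + w" for p q v w :: Uh
        using that(2) unfolding that(1) by (simp add: algebra_simps)
      from this[OF bs[of n] bs[of "Suc n"]] show ?thesis .
    qed
    also have "\<dots> = Uh_h ^ Suc n * (y n - Uh_h * y (Suc n))"
      by (simp add: right_diff_distrib power_Suc2 mult.assoc del: power_Suc)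
    finally have eq: "(\<Sum>m\<in>?A. Uh_scal (c (Suc n) m - c n m) * mon m) = Uh_h ^ Suc n * (y n - Uh_h * y (Suc n))" .
    have "\<exists>d. c' (Suc n) m - c' n m = fps_X ^ n * d" for m
    proof (cases "m \<in> ?A")
      case True
      from mon_divisible_Uh[OF A eq True] obtain d where "c (Suc n) m - c n m = fps_X ^ Suc n * d" by blast
      then have "fps_X * (c' (Suc n) m - c' n m) = fps_X * (fps_X ^ n * d)"
        by (simp add: c' right_diff_distrib mult.assoc)
      then show ?thesis by auto
    next
      case False
      then show ?thesis using c'0 by (intro exI[of _ 0]) simp
    qed
    then obtain d where d: "\<And>m. c' (Suc n) m - c' n m = fps_X ^ n * d m" by metis
    have "r (Suc n) - r n = (\<Sum>m\<in>?A. Uh_scal (c' (Suc n) m - c' n m) * mon m)"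
      using rsup[OF A, of n] rsup[OF A, of "Suc n"] by (simp add: Uh.\<sigma>_diff left_diff_distrib sum_subtractf)
    also have "\<dots> = Uh_h ^ n * (\<Sum>m\<in>?A. Uh_scal (d m) * mon m)"
      by (simp add: d sum_distrib_left Xscal(2)[symmetric] mult.assoc)
    finally show ?thesis using mspan_sum[OF A, of d] by blast
  qed
  then obtain w where w: "\<And>n. w n \<in> mspan" and rw: "\<And>n. r (Suc n) - r n = Uh_h ^ n * w n" by metis
  obtain v where v: "\<And>n. \<exists>z. v - (\<Sum>k<n. Uh_h ^ k * w k) = Uh_h ^ n * z" by (rule Uh_adic_limit[of w]) blast
  have rn: "r n = r 0 + (\<Sum>k<n. Uh_h ^ k * w k)" for n
  proof (induction n)
    case (Suc n)
    have "r (Suc n) = r n + Uh_h ^ n * w n" using rw[of n] by (simp add: diff_eq_eq add.commute)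
    then show ?case by (simp only: Suc sum.lessThan_Suc add.assoc)
  qed simp
  define u where "u = r 0 + v"
  have ur: "\<exists>z. u - r n = Uh_h ^ n * z" for n
    using v[of n] unfolding u_def rn[of n] by simp
  have "u \<in> adic_closure Uh_h mspan"
    by (rule adic_closureI) (use ur r(1) in blast)
  \<comment> \<open>The two sides agree modulo every power of h, so separatedness gives equality
    without cancelling h in U_h.\<close>
  moreover have "Uh_h * u - b = 0"
  proof (rule Uh_separated)
    fix n
    obtain z where "u - r n = Uh_h ^ n * z" using ur by blast
    then have "Uh_h * u - s n = Uh_h ^ Suc n * z"
      by (simp add: r(2)[symmetric] mult.assoc flip: right_diff_distrib)
    moreover have "Uh_h * u - b = (Uh_h * u - s n) - Uh_h ^ Suc n * y n"
      by (subst bs[of n]) (simp only: diff_diff_add)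
    ultimately have "Uh_h * u - b = Uh_h ^ n * (Uh_h * (z - y n))"
      by (simp only: right_diff_distrib[symmetric] power_Suc2 mult.assoc)
    then show "\<exists>y. Uh_h * u - b = Uh_h ^ n * y" by blast
  qed
  ultimately show ?thesis by (intro bexI[of _ u]) simp_all
qed

section \<open>The coideal property\<close>

definition "tens_hull = additive_hull {tensor_Uh a b | a b. a \<in> generated_Uh gens_B \<and> b \<in> UNIV}"

lemma B_gens: "x \<in> gens_B \<Longrightarrow> x \<in> generated_Uh gens_B" "Uh_scal c \<in> generated_Uh gens_B"
  unfolding generated_Uh_def by (rule subsetD[OF subset_adic_closure], rule ring_hull.base, simp)+

lemma B_one: "1 \<in> generated_Uh gens_B"
  using B_gens(2)[of 1] by (simp add: Uh.\<sigma>_1)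

lemma B_mult: "x \<in> generated_Uh gens_B \<Longrightarrow> y \<in> generated_Uh gens_B \<Longrightarrow> x * y \<in> generated_Uh gens_B"
  and B_diff: "x \<in> generated_Uh gens_B \<Longrightarrow> y \<in> generated_Uh gens_B \<Longrightarrow> x - y \<in> generated_Uh gens_B"
  unfolding generated_Uh_def by (rule closure_ring_hull_props[OF Uh_h_central]; assumption)+

lemma tens_hull_base: "a \<in> generated_Uh gens_B \<Longrightarrow> left_Uh a * right_Uh b \<in> tens_hull"
  unfolding tens_hull_def tensor_Uh_left_right[symmetric] by (rule additive_hull.base) blast

lemma tens_hull_diff: "x \<in> tens_hull \<Longrightarrow> y \<in> tens_hull \<Longrightarrow> x - y \<in> tens_hull"
  unfolding tens_hull_def by (rule additive_hull.diff)

lemma tens_hull_add: "x \<in> tens_hull \<Longrightarrow> y \<in> tens_hull \<Longrightarrow> x + y \<in> tens_hull"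
proof -
  assume xy: "x \<in> tens_hull" "y \<in> tens_hull"
  have "0 \<in> tens_hull" unfolding tens_hull_def by (rule additive_hull.zero)
  from tens_hull_diff[OF xy(1) tens_hull_diff[OF this xy(2)]] show ?thesis by simp
qed

text \<open>Since B is a ring, so is the algebraic tensor product of B with U_h. The coideal
  property thus has to be checked on generators only, and passes to limits afterwards.\<close>

lemma tens_hull_mult:
  assumes "x \<in> tens_hull" "y \<in> tens_hull"
  shows "x * y \<in> tens_hull"
  using assms(1) unfolding tens_hull_def
proof induction
  case zero
  show ?case by (simp add: additive_hull.zero)
next
  case (base x)
  then obtain a b where x: "x = left_Uh a * right_Uh b" and a: "a \<in> generated_Uh gens_B"
    by (auto simp: tensor_Uh_left_right)
  show ?case
    using assms(2) unfolding tens_hull_def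
  proof induction
    case zero
    show ?case by (simp add: additive_hull.zero)
  next
    case (base y)
    then obtain a' b' where y: "y = left_Uh a' * right_Uh b'" and a': "a' \<in> generated_Uh gens_B"
      by (auto simp: tensor_Uh_left_right)
    have "x * y = left_Uh (a * a') * right_Uh (b * b')"
      unfolding x y left_Uh_hom right_Uh_hom
      by (simp only: mult.assoc right_left_commute[THEN mult_left_rule])
    then show ?case using tens_hull_base[OF B_mult[OF a a'], of "b * b'"] by (simp add: tens_hull_def)
  next
    case (diff y z)
    then show ?case by (simp add: right_diff_distrib additive_hull.diff)
  qed
next
  case (diff x z)
  then show ?case by (simp add: left_diff_distrib additive_hull.diff)
qed

lemma tens_hull_simple: "right_Uh x \<in> tens_hull" "x \<in> generated_Uh gens_B \<Longrightarrow> left_Uh x \<in> tens_hull"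
    "Uh2_scal c \<in> tens_hull"
  using tens_hull_base[OF B_one, of x] tens_hull_base[of x 1] tens_hull_base[OF B_gens(2), of c 1]
  by (simp_all add: left_Uh_hom right_Uh_hom left_Uh_scal)

lemma comult_hom:
  "comult (x + y) = comult x + comult y" "comult (x - y) = comult x - comult y" "comult (x * y) = comult x * comult y"
  "comult 1 = 1"
  unfolding comult_eq by (rule comult.Hom_hom)+

lemma left_Uh_diff: "left_Uh (x - y) = left_Uh x - left_Uh y" and right_Uh_diff: "right_Uh (x - y) = right_Uh x - right_Uh y"
  using left_Uh_hom(1)[of "x - y" y] right_Uh_hom(1)[of "x - y" y] by simp_all

text \<open>\<open>X_sum\<close> with a_i = E_i \<otimes> K_i and b_i = 1 \<otimes> E_i: every left
  factor that occurs is X, E_1, a square of E_1, or a scalar.\<close>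

lemma comult_X: "comult Xq \<in> tens_hull"
proof -
  let ?a = "\<lambda>i. left_Uh (Uh_E i) * right_Uh (Uh_K i)" and ?b = "\<lambda>i. right_Uh (Uh_E i)"
  have E: "Eq \<in> generated_Uh gens_B" "Xq \<in> generated_Uh gens_B" using B_gens by (auto simp: gens_B_def)
  have q: "comult (Uh.q k) = Uh2.q k" "left_Uh (Uh.q k) = Uh2.q k" "right_Uh (Uh.q k) = Uh2.q k" for k
    by (simp_all add: Uh.q_def Uh2.q_def comult_gens left_Uh_scal right_Uh_scal)
  have qh: "Uh2.q k \<in> tens_hull" for k
    by (simp add: Uh2.q_def tens_hull_simple)
  have ab: "?a i * ?b j = Uh2.q (dot i j) * (?b j * ?a i)" for i j
  proof -
    have K: "right_Uh (Uh_K i) * right_Uh (Uh_E j) = Uh2.q (dot i j) * (right_Uh (Uh_E j) * right_Uh (Uh_K i))"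
      using arg_cong[OF Uh.KE[of i j], of right_Uh] by (simp add: right_Uh_hom q)
    show ?thesis
      by (simp only: mult.assoc K Uh2.q_left_commute[of "left_Uh _"] right_left_commute[THEN mult_left_rule])
  qed
  note abs = ab[of Node1 Node1, unfolded dot_simps] ab[of Node1 Node2, unfolded dot_simps]
    ab[of Node2 Node1, unfolded dot_simps] ab[of Node2 Node2, unfolded dot_simps]
  have c: "comult Xq = Uh2.Xel (?a Node1 + ?b Node1) (?a Node2 + ?b Node2)"
    unfolding XY_Uh Uh.Xel_def Uh.Zel_def Uh2.Xel_def Uh2.Zel_def comult_hom q comult_gens ..
  have lX: "Uh2.Xel (left_Uh x) (left_Uh y) = left_Uh (Uh.Xel x y)" for x y
    unfolding Uh.Xel_def Uh.Zel_def Uh2.Xel_def Uh2.Zel_def left_Uh_hom left_Uh_diff q ..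
  have rX: "Uh2.Xel (right_Uh x) (right_Uh y) = right_Uh (Uh.Xel x y)"
    "Uh2.Zel (right_Uh x) (right_Uh y) = right_Uh (Uh.Zel x y)" for x y
    unfolding Uh.Xel_def Uh.Zel_def Uh2.Xel_def Uh2.Zel_def right_Uh_hom right_Uh_diff q by (rule refl)+
  have KK: "right_Uh (Uh_K Node1) * right_Uh (Uh_K Node2) = right_Uh (Uh_K Node2) * right_Uh (Uh_K Node1)"
    using arg_cong[OF Uh.KK[of Node1 Node2], of right_Uh] by (simp add: right_Uh_hom)
  have XA: "Uh2.Xel (?a Node1) (?a Node2) = left_Uh Xq * (right_Uh (Uh_K Node1) * (right_Uh (Uh_K Node1) * right_Uh (Uh_K Node2)))"
    unfolding XY_Uh lX[symmetric] by (rule Uh2.twist(2)) (rule KK right_left_commute)+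
  have a1: "?a Node1 \<in> tens_hull" by (rule tens_hull_base[OF E(1)])
  have 1: "1 \<in> tens_hull" using qh[of 0] by (simp add: Uh2.q_simps)
  show ?thesis
    unfolding c Uh2.X_sum[OF abs] XA rX
    by (intro tens_hull_add tens_hull_diff tens_hull_mult a1 qh tens_hull_simple(1) tens_hull_simple(2)[OF E(2)] 1)
qed

lemma B_coideal: "left_coideal (generated_Uh gens_B)"
  unfolding left_coideal_def tensor_closure_def tens_hull_def[symmetric]
proof (rule image_subsetI)
  have gens_B: "g \<in> generated_Uh gens_B" if "g \<in> gens_B" for g using that by (rule B_gens)
  have gens: "comult g \<in> tens_hull" if "g \<in> range Uh_scal \<union> gens_B" for g
  proof -
    have E: "comult Eq \<in> tens_hull"
      unfolding comult_gens by (intro tens_hull_add tens_hull_base tens_hull_simple gens_B) (simp add: gens_B_def)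
    \<comment> \<open>Y is a q-commutator of X and E_1, whose coproducts already lie in the subring,
      so no explicit formula for its coproduct is used.\<close>
    have Y: "comult Yq \<in> tens_hull"
    proof -
      have "Yq = Xq * Eq - Uh_scal (qpow 1) * (Eq * Xq)"
        by (simp add: Yq_def Xq_def qcomm_def mult.assoc)
      from arg_cong[OF this, of comult]
      have "comult Yq = comult Xq * comult Eq - Uh2_scal (qpow 1) * (comult Eq * comult Xq)"
        unfolding comult_hom comult_gens(4) .
      then show ?thesis
        by (simp only:) (intro tens_hull_diff tens_hull_mult comult_X E tens_hull_simple)
    qed
    have K: "comult (Uh_K Node1 * Uh_K Node2) \<in> tens_hull"
    proof -
      have "comult (Uh_K Node1 * Uh_K Node2) = left_Uh (Uh_K Node1 * Uh_K Node2) * right_Uh (Uh_K Node1 * Uh_K Node2)"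
        unfolding comult_hom comult_gens left_Uh_hom right_Uh_hom
        by (simp only: mult.assoc right_left_commute[THEN mult_left_rule])
      then show ?thesis by (simp only:) (intro tens_hull_base gens_B, simp add: gens_B_def)
    qed
    have T: "comult Tq \<in> tens_hull"
    proof -
      have "comult (Uh_logK i) = left_Uh (Uh_logK i) + right_Uh (Uh_logK i)" for i
        by (simp only: Uh_logK_def comult_hom comult_gens left_Uh_hom right_Uh_hom left_Uh_scal right_Uh_scal distrib_left)
      then have "comult Tq = left_Uh Tq + right_Uh Tq"
        by (simp only: Tq_def comult_hom left_Uh_hom right_Uh_hom add_ac)
      then show ?thesis by (simp only:) (intro tens_hull_add tens_hull_simple gens_B, simp add: gens_B_def)
    qed
    show ?thesis using that E K T Y comult_X by (auto simp: gens_B_def comult_gens(4) tens_hull_simple)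
  qed
  have hull: "comult s \<in> adic_closure Uh2_h tens_hull" if "s \<in> ring_hull (range Uh_scal \<union> gens_B)" for s
    using that
  proof induction
    case (base s)
    then show ?case using gens subset_adic_closure by blast
  next
    case one
    have "1 \<in> tens_hull" using tens_hull_simple(1)[of 1] by (simp add: right_Uh_hom)
    then show ?case unfolding comult_hom using subset_adic_closure by blast
  next
    case (diff x y)
    then show ?case unfolding comult_hom by (intro adic_closure_diff tens_hull_diff)
  next
    case (mult x y)
    then show ?case unfolding comult_hom by (intro adic_closure_mult[of Uh2_h tens_hull] Uh2_h_central tens_hull_mult)
  qed
  fix b assume b: "b \<in> generated_Uh gens_B"
  have "comult b \<in> adic_closure Uh2_h (adic_closure Uh2_h tens_hull)"
  proof (rule adic_closureI)
    fix n
    obtain s y where s: "s \<in> ring_hull (range Uh_scal \<union> gens_B)" "b = s + Uh_h ^ n * y"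
      using b unfolding generated_Uh_def by (rule adic_closureE)
    have "comult b - comult s = Uh2_h ^ n * comult y"
      unfolding s(2) comult_hom(1) comult_gens(5) by simp
    then show "\<exists>s\<in>adic_closure Uh2_h tens_hull. \<exists>y. comult b - s = Uh2_h ^ n * y"
      using hull[OF s(1)] by blast
  qed
  then show "comult b \<in> adic_closure Uh2_h tens_hull" by (simp add: adic_closure_idem)
qed

section \<open>The image under specialization\<close>

definition hcois :: "Ug set" where
  "hcois = Ug.span {Ug_h Node1 + Ug_h Node2, Ug_e Node1,
     commutator (Ug_e Node1) (commutator (Ug_e Node1) (Ug_e Node2)),
     commutator (Ug_e Node1) (commutator (Ug_e Node1) (commutator (Ug_e Node1) (Ug_e Node2)))}"

lemma specialization_qcomm: "specialization (qcomm k x y) = commutator (specialization x) (specialization y)"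
  by (simp add: qcomm_def specialization_hom specialization_scal scale_Ug_one_mult commutator_def qpow_def)

text \<open>X and Y have E_1 on the right in their outer brackets, so each such bracket contributes
  a sign: X specializes to -x_4 and Y to +x_5.\<close>

lemma specialization_TXY:
  "specialization Tq = Ug_h Node1 + Ug_h Node2"
  "specialization Xq = - commutator (Ug_e Node1) (commutator (Ug_e Node1) (Ug_e Node2))"
  "specialization Yq = commutator (Ug_e Node1) (commutator (Ug_e Node1) (commutator (Ug_e Node1) (Ug_e Node2)))"
proof -
  show "specialization Tq = Ug_h Node1 + Ug_h Node2"
    by (simp add: Tq_def Uh_logK_def specialization_hom specialization_scal specialization_gens scale_Ug_one_mult
        Ug_h_def fps_of_nat[symmetric])
  show X: "specialization Xq = - commutator (Ug_e Node1) (commutator (Ug_e Node1) (Ug_e Node2))"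
    by (simp add: Xq_def specialization_qcomm specialization_gens commutator_def)
  show "specialization Yq = commutator (Ug_e Node1) (commutator (Ug_e Node1) (commutator (Ug_e Node1) (Ug_e Node2)))"
    unfolding Yq_def Xq_def[symmetric] specialization_qcomm X specialization_gens
    by (simp add: commutator_def[of "- _"] commutator_def[of _ "commutator _ (commutator _ _)"])
qed

lemma specialization_image: "specialization ` generated_Uh gens_B = env hcois"
proof
  show "specialization ` generated_Uh gens_B \<subseteq> env hcois"
  proof (rule image_subsetI)
    fix b assume "b \<in> generated_Uh gens_B"
    then obtain s y where s: "s \<in> ring_hull (range Uh_scal \<union> gens_B)" and "b = s + Uh_h ^ Suc 0 * y"
      unfolding generated_Uh_def by (rule adic_closureE)
    then have "specialization b = specialization s"
      using specialization_h_power[of 0 y] by (simp add: specialization_hom)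
    moreover have "specialization s \<in> env hcois"
      using s
    proof induction
      case (base s)
      have "specialization g \<in> env hcois" if "specialization g \<in> hcois" for g
        using that unfolding env_def by (intro ring_hull.base) blast
      moreover have "specialization g \<in> hcois" if "g \<in> {Tq, Eq, Xq, Yq}" for g
      proof -
        have "specialization Tq \<in> hcois" "specialization Eq \<in> hcois" "specialization Yq \<in> hcois"
          unfolding hcois_def specialization_TXY specialization_gens by (rule Ug.span_base, simp)+
        moreover have "specialization Xq \<in> hcois"
          unfolding hcois_def specialization_TXY by (rule Ug.span_neg, rule Ug.span_base, simp)
        ultimately show ?thesis using that by blast
      qed
      moreover have "specialization (Uh_scal c) \<in> env hcois" for c
        unfolding env_def specialization_scal by (intro ring_hull.base) blast
      moreover have "specialization (Uh_K Node1 * Uh_K Node2) \<in> env hcois"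
        by (simp add: specialization_hom specialization_gens env_def ring_hull.one)
      ultimately show ?case using base by (auto simp: gens_B_def)
    qed (simp_all add: specialization_hom env_def ring_hull.intros)
    ultimately show "specialization b \<in> env hcois" by simp
  qed
  let ?I = "specialization ` generated_Uh gens_B"
  have scal: "scale_Ug c x \<in> ?I" if "x \<in> ?I" for c x
  proof -
    obtain b where "b \<in> generated_Uh gens_B" "x = specialization b" using \<open>x \<in> ?I\<close> by blast
    then show ?thesis
      by (intro image_eqI[of _ _ "Uh_scal (fps_const c) * b"])
        (simp_all add: specialization_hom specialization_scal scale_Ug_one_mult B_mult B_gens)
  qed
  have diff: "x - y \<in> ?I" if "x \<in> ?I" "y \<in> ?I" for x y
    using that by (auto simp: specialization_hom[symmetric] intro!: imageI B_diff)
  have mult: "x * y \<in> ?I" if "x \<in> ?I" "y \<in> ?I" for x y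
    using that by (auto simp: specialization_hom[symmetric] intro!: imageI B_mult)
  have one: "1 \<in> ?I" using imageI[OF B_one, of specialization] by (simp add: specialization_hom)
  have zero: "0 \<in> ?I" using diff[OF one one] by simp
  have add: "x + y \<in> ?I" if "x \<in> ?I" "y \<in> ?I" for x y
    using diff[OF that(1) diff[OF zero that(2)]] by simp
  have "hcois \<subseteq> ?I"
    unfolding hcois_def
  proof (rule Ug.span_minimal)
    show "Ug.subspace ?I" unfolding Ug.subspace_def using zero add scal by blast
    have g: "specialization g \<in> ?I" if "g \<in> gens_B" for g using that B_gens by blast
    have X: "- specialization Xq \<in> ?I" using diff[OF zero g[of Xq]] by (simp add: gens_B_def)
    show "{Ug_h Node1 + Ug_h Node2, Ug_e Node1, commutator (Ug_e Node1) (commutator (Ug_e Node1) (Ug_e Node2)),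
     commutator (Ug_e Node1) (commutator (Ug_e Node1) (commutator (Ug_e Node1) (Ug_e Node2)))} \<subseteq> ?I"
      using g[of Tq] g[of Eq] X g[of Yq] by (simp add: gens_B_def specialization_TXY specialization_gens)
  qed
  then have base: "range (\<lambda>c. scale_Ug c 1) \<union> hcois \<subseteq> ?I" using scal one by blast
  show "env hcois \<subseteq> ?I"
  proof
    fix x assume "x \<in> env hcois"
    then show "x \<in> ?I" unfolding env_def
      by induction (use base one diff mult in blast)+
  qed
qed

lemma B_subalgebra: "subalgebra_Uh (generated_Uh gens_B)"
proof -
  have add: "x + y \<in> generated_Uh gens_B" if "x \<in> generated_Uh gens_B" "y \<in> generated_Uh gens_B" for x y
    using B_diff[OF that(1) B_diff[OF B_diff[OF B_one B_one] that(2)]] by simp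
  show ?thesis
    unfolding subalgebra_Uh_def using B_gens(2) add B_mult
    by (auto simp: generated_Uh_def adic_closure_idem)
qed

lemma B_kernel: "{b \<in> generated_Uh gens_B. specialization b = 0} = (\<lambda>b. Uh_h * b) ` generated_Uh gens_B"
proof
  show "{b \<in> generated_Uh gens_B. specialization b = 0} \<subseteq> (\<lambda>b. Uh_h * b) ` generated_Uh gens_B"
    using mspan_closure_kernel unfolding generated_eq by blast
  have "Uh_h * b = Uh_scal fps_X * b" for b
    using cst_free.fscal_X by (simp add: Uh_h_def Uh_scal_def fscal_cst)
  then show "(\<lambda>b. Uh_h * b) ` generated_Uh gens_B \<subseteq> {b \<in> generated_Uh gens_B. specialization b = 0}"
    using B_mult[OF B_gens(2)] specialization_h_power[of 0] by auto
qed

lemma is_quantization_B: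
  assumes "coisotropic hcois"
  shows "is_quantization (generated_Uh gens_B) hcois"
  unfolding is_quantization_def
  using assms B_subalgebra B_coideal B_kernel specialization_image by blast

section \<open>The Lie algebra of type \<open>G\<^sub>2\<close> inside \<open>U(\<gg>)\<close>\<close>

lemma comm_add: "commutator (x + y) z = commutator x z + commutator y z"
  "commutator z (x + y) = commutator z x + commutator z y"
  by (simp_all add: commutator_def algebra_simps)

lemma comm_diff: "commutator (x - y) z = commutator x z - commutator y z"
  "commutator z (x - y) = commutator z x - commutator z y"
  by (simp_all add: commutator_def algebra_simps)

lemma comm_minus: "commutator (- x) z = - commutator x z" "commutator z (- x) = - commutator z x"
  by (simp_all add: commutator_def algebra_simps)

lemma comm_0: "commutator 0 z = 0" "commutator z 0 = 0" "commutator z z = 0"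
  by (simp_all add: commutator_def)

lemma comm_anti: "commutator x y = - commutator y x"
  by (simp add: commutator_def)

lemma comm_scale: "commutator (scale_Ug c x) z = scale_Ug c (commutator x z)"
  "commutator z (scale_Ug c x) = scale_Ug c (commutator z x)"
  by (simp_all add: commutator_def scale_Ug_mult Ug.scale_right_diff_distrib)

lemma jacobi: "commutator a (commutator b c) = commutator (commutator a b) c + commutator b (commutator a c)"
  by (simp add: commutator_def algebra_simps)

lemmas comm_simps = comm_add comm_diff comm_minus comm_0 comm_scale

lemma weight_comm:
  assumes "commutator h a = scale_Ug c a" "commutator h b = scale_Ug d b"
  shows "commutator h (commutator a b) = scale_Ug (c + d) (commutator a b)"
  unfolding jacobi[of h a b] assms comm_scale by (simp add: Ug.scale_left_distrib)

text \<open>Stated for arbitrary elements so that the Chevalley involution e, f, h \<mapsto> f, e,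
  -h can be applied and one set of tables serves positive and negative root vectors. Nonvanishing of
  the coroots is the one assumption that does not come from the presentation.\<close>

locale g2_chev =
  fixes e1 e2 f1 f2 h1 h2 :: Ug
  assumes hh: "commutator h1 h2 = 0"
    and he: "commutator h1 e1 = scale_Ug 2 e1" "commutator h1 e2 = scale_Ug (- 3) e2"
      "commutator h2 e1 = scale_Ug (- 1) e1" "commutator h2 e2 = scale_Ug 2 e2"
    and hf: "commutator h1 f1 = scale_Ug (- 2) f1" "commutator h1 f2 = scale_Ug 3 f2"
      "commutator h2 f1 = scale_Ug 1 f1" "commutator h2 f2 = scale_Ug (- 2) f2"
    and ef: "commutator e1 f1 = h1" "commutator e2 f2 = h2" "commutator e1 f2 = 0" "commutator e2 f1 = 0"
    and se: "commutator e1 (commutator e1 (commutator e1 (commutator e1 e2))) = 0" "commutator e2 (commutator e2 e1) = 0"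
    and sf: "commutator f1 (commutator f1 (commutator f1 (commutator f1 f2))) = 0" "commutator f2 (commutator f2 f1) = 0"
    and h_nonzero: "h1 \<noteq> 0" "h2 \<noteq> 0"
begin

definition "x3 = commutator e1 e2"
definition "x4 = commutator e1 x3"
definition "x5 = commutator e1 x4"
definition "x6 = commutator e2 x5"

lemma e_table:
  "commutator e1 e2 = x3" "commutator e1 x3 = x4" "commutator e1 x4 = x5" "commutator e1 x5 = 0"
  "commutator e2 e1 = - x3" "commutator e2 x3 = 0" "commutator e2 x4 = 0" "commutator e2 x5 = x6"
  "commutator e1 x6 = 0" "commutator e2 x6 = 0" "commutator x4 x5 = 0"
proof -
  show 12: "commutator e1 e2 = x3" and 13: "commutator e1 x3 = x4" and 14: "commutator e1 x4 = x5"
    and 25: "commutator e2 x5 = x6"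
    by (simp_all add: x3_def x4_def x5_def x6_def)
  show 15: "commutator e1 x5 = 0" using se(1) by (simp add: x3_def x4_def x5_def)
  show 21: "commutator e2 e1 = - x3" by (simp add: x3_def comm_anti[of e2 e1])
  show 23: "commutator e2 x3 = 0" using se(2) by (simp add: x3_def comm_anti[of e1 e2] comm_simps)
  show 24: "commutator e2 x4 = 0"
    unfolding x4_def by (subst jacobi) (simp add: 21 23 comm_simps)
  have 34: "commutator x3 x4 = - x6"
    using jacobi[of e1 e2 x4] by (simp add: 12 14 24 25 comm_simps eq_neg_iff_add_eq_0)
  have "commutator e1 (commutator x3 x4) = commutator x3 x5"
    by (subst jacobi) (simp add: 13 14 comm_simps)
  then have "- commutator e1 x6 = commutator x3 x5" by (simp add: 34 comm_simps)
  then have 16: "commutator e1 x6 = - commutator x3 x5" by (simp only: eq_neg_iff_add_eq_0 neg_eq_iff_add_eq_0)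
  \<comment> \<open>[e1, x6] is evaluated once through x6 = -[x3, x4] and once through x6 =
    [e2, x5]; the results have opposite signs, so twice [x3, x5] vanishes.\<close>
  moreover have "commutator e1 x6 = commutator x3 x5"
    unfolding x6_def by (subst jacobi) (simp add: 12 15 comm_simps)
  ultimately have "commutator x3 x5 + commutator x3 x5 = 0" by (simp add: eq_neg_iff_add_eq_0)
  then have "scale_Ug 2 (commutator x3 x5) = 0"
    using Ug.scale_left_distrib[of 1 1 "commutator x3 x5"] by simp
  then have 35: "commutator x3 x5 = 0" by simp
  then show "commutator e1 x6 = 0" using 16 by simp
  show "commutator e2 x6 = 0"
  proof -
    have "commutator e2 (commutator x3 x4) = 0"
      by (subst jacobi) (simp add: 23 24 comm_simps)
    then show ?thesis by (simp add: 34 comm_simps)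
  qed
  show "commutator x4 x5 = 0"
    using jacobi[of e1 x3 x5] by (simp add: 13 15 35 comm_simps)
qed

lemma h_table:
  "commutator h1 x3 = scale_Ug (- 1) x3" "commutator h1 x4 = scale_Ug 1 x4" "commutator h1 x5 = scale_Ug 3 x5"
  "commutator h1 x6 = scale_Ug 0 x6"
  "commutator h2 x3 = scale_Ug 1 x3" "commutator h2 x4 = scale_Ug 0 x4" "commutator h2 x5 = scale_Ug (- 1) x5"
  "commutator h2 x6 = scale_Ug 1 x6"
proof -
  show 13: "commutator h1 x3 = scale_Ug (- 1) x3" using weight_comm[OF he(1,2)] by (simp add: x3_def)
  show 14: "commutator h1 x4 = scale_Ug 1 x4" using weight_comm[OF he(1) 13] by (simp add: x4_def)
  show 15: "commutator h1 x5 = scale_Ug 3 x5" using weight_comm[OF he(1) 14] by (simp add: x5_def)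
  show "commutator h1 x6 = scale_Ug 0 x6" using weight_comm[OF he(2) 15] by (simp add: x6_def)
  show 23: "commutator h2 x3 = scale_Ug 1 x3" using weight_comm[OF he(3,4)] by (simp add: x3_def)
  show 24: "commutator h2 x4 = scale_Ug 0 x4" using weight_comm[OF he(3) 23] by (simp add: x4_def)
  show 25: "commutator h2 x5 = scale_Ug (- 1) x5" using weight_comm[OF he(3) 24] by (simp add: x5_def)
  show "commutator h2 x6 = scale_Ug 1 x6" using weight_comm[OF he(4) 25] by (simp add: x6_def)
qed

lemma f_table:
  "commutator f1 e1 = - h1" "commutator f1 e2 = 0" "commutator f2 e1 = 0" "commutator f2 e2 = - h2"
  "commutator f1 x3 = scale_Ug 3 e2" "commutator f2 x3 = - e1"
  "commutator f1 x4 = scale_Ug 4 x3" "commutator f2 x4 = 0"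
  "commutator f1 x5 = scale_Ug 3 x4" "commutator f2 x5 = 0"
  "commutator f1 x6 = 0" "commutator f2 x6 = x5"
proof -
  show b: "commutator f1 e1 = - h1" "commutator f1 e2 = 0" "commutator f2 e1 = 0" "commutator f2 e2 = - h2"
    using ef by (simp_all add: comm_anti[of f1] comm_anti[of f2])
  show 13: "commutator f1 x3 = scale_Ug 3 e2"
    unfolding x3_def by (subst jacobi) (simp add: b comm_simps he)
  show 23: "commutator f2 x3 = - e1"
    unfolding x3_def by (subst jacobi) (simp add: b comm_simps he comm_anti[of e1 h2])
  show 14: "commutator f1 x4 = scale_Ug 4 x3"
    unfolding x4_def
    by (subst jacobi) (simp add: b 13 comm_simps h_table e_table Ug.scale_left_distrib[of 1 3, simplified])
  show 24: "commutator f2 x4 = 0"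
    unfolding x4_def by (subst jacobi) (simp add: b 23 comm_simps)
  show 15: "commutator f1 x5 = scale_Ug 3 x4"
    unfolding x5_def
    by (subst jacobi) (simp add: b 14 comm_simps h_table e_table Ug.scale_left_diff_distrib[of 4 1, simplified])
  show 25: "commutator f2 x5 = 0"
    unfolding x5_def by (subst jacobi) (simp add: b 24 comm_simps)
  show "commutator f1 x6 = 0"
    unfolding x6_def by (subst jacobi) (simp add: b 15 comm_simps e_table)
  show "commutator f2 x6 = x5"
    unfolding x6_def by (subst jacobi) (simp add: b 25 comm_simps h_table)
qed

text \<open>Bracketing with f1 or f2 leads each root vector back to a nonzero multiple of an earlier
  one, and finally to a coroot.\<close>

lemma x_nonzero: "e1 \<noteq> 0" "e2 \<noteq> 0" "x3 \<noteq> 0" "x4 \<noteq> 0" "x5 \<noteq> 0" "x6 \<noteq> 0"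
proof -
  show 1: "e1 \<noteq> 0" and "e2 \<noteq> 0" using ef h_nonzero by (auto simp: comm_0)
  show 3: "x3 \<noteq> 0" using f_table(6) 1 by (auto simp: comm_0)
  show 4: "x4 \<noteq> 0" using f_table(7) 3 by (auto simp: comm_0)
  show 5: "x5 \<noteq> 0" using f_table(9) 4 by (auto simp: comm_0)
  show "x6 \<noteq> 0" using f_table(12) 5 by (auto simp: comm_0)
qed

lemma dual: "g2_chev f1 f2 e1 e2 (- h1) (- h2)"
  by standard (use hh he hf ef se sf h_nonzero f_table(1-4) in \<open>simp_all add: comm_simps\<close>)

end

lemma Ug_rel: "r \<in> U_rels \<Longrightarrow> abs_Ug r = 0"
proof -
  assume "r \<in> U_rels"
  then have "1 * r * 1 \<in> ideal_gen U_rels" by (rule ideal_gen.gen)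
  then have "r - 0 \<in> U_ideal" by (simp add: U_ideal_def)
  then show ?thesis unfolding zero_Ug_def by (simp only: Ug.abs_eq_iff)
qed

lemma abs_Ug_commutator: "abs_Ug (commutator a b) = commutator (abs_Ug a) (abs_Ug b)"
  by (simp add: commutator_def minus_Ug.abs_eq times_Ug.abs_eq)

lemma abs_Ug_of_int: "abs_Ug (of_int k * a) = scale_Ug (of_int k) (abs_Ug a)"
  by (simp add: scale_Ug_def times_Ug.abs_eq cst_free.\<kappa>_of_int)

lemma Ug_relations:
  "commutator (Ug_coroot i) (Ug_coroot j) = 0"
  "commutator (Ug_coroot i) (Ug_e j) = scale_Ug (of_int (cartan i j)) (Ug_e j)"
  "commutator (Ug_coroot i) (Ug_f j) = scale_Ug (of_int (- cartan i j)) (Ug_f j)"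
  "commutator (Ug_e i) (Ug_f j) = (if i = j then Ug_coroot i else 0)"
proof -
  note d = Ug_e_def Ug_f_def Ug_coroot_def
  show "commutator (Ug_coroot i) (Ug_coroot j) = 0"
    using Ug_rel[OF U_rels.intros(1)[of i j]] by (simp add: d abs_Ug_commutator)
  show "commutator (Ug_coroot i) (Ug_e j) = scale_Ug (of_int (cartan i j)) (Ug_e j)"
    using Ug_rel[OF U_rels.intros(2)[of i j]]
    by (simp only: minus_Ug.abs_eq[symmetric] abs_Ug_commutator abs_Ug_of_int d) simp
  show "commutator (Ug_coroot i) (Ug_f j) = scale_Ug (of_int (- cartan i j)) (Ug_f j)"
    using Ug_rel[OF U_rels.intros(3)[of i j]]
    by (simp only: plus_Ug.abs_eq[symmetric] abs_Ug_commutator abs_Ug_of_int d)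
      (simp add: eq_neg_iff_add_eq_0 Ug.scale_minus_left)
  show "commutator (Ug_e i) (Ug_f j) = (if i = j then Ug_coroot i else 0)"
    using Ug_rel[OF U_rels.intros(4)[of i j]]
    by (cases "i = j") (simp_all only: minus_Ug.abs_eq[symmetric] abs_Ug_commutator d if_True if_False, simp_all add: zero_Ug_def[symmetric])
qed

text \<open>Seen in the seven-dimensional representation of U_h: if a coroot vanished in U(g), H_i
  would be divisible by h and would act by zero at h = 0. The vector W6 has weight 1 or -1 under the
  two coroots.\<close>

lemma coroot_nonzero: "Ug_coroot i \<noteq> 0"
proof
  assume "Ug_coroot i = 0"
  then obtain y where "Uh_H i = Uh_h ^ 1 * y"
    using specialization_kernel[of "Uh_H i"] by (auto simp: specialization_gens)
  then have "rho.Hom 1 (Uh_H i) = fps_X ^ 1 * rho.Hom 1 y" by (simp only: rho.Hom_gens)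
  then have "fps_nth (hatH 1 i) 0 = 0" by (simp add: rho.Hom_gens)
  then have "hat_coroot 1 i = 0" by (simp only: hat_exp) simp
  then have "app (hat_coroot 1 i) (\<lambda>_. 1) (\<lambda>_. W6) = 0" by (simp add: app_simps)
  then show False
    by (cases i) (simp_all add: hat_coroot_def coroot_op_def site.rep_eq if_distrib[of "\<lambda>x. x * _"] cong: if_cong)
qed

interpretation g: g2_chev "Ug_e Node1" "Ug_e Node2" "Ug_f Node1" "Ug_f Node2" "Ug_coroot Node1" "Ug_coroot Node2"
proof
  have fp: "nat (1 - cartan Node1 Node2) = 4" "nat (1 - cartan Node2 Node1) = 2" by simp_all
  have p: "(f ^^ 4) z = f (f (f (f z)))" "(f ^^ 2) z = f (f z)" for f :: "free \<Rightarrow> free" and z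
    by (simp_all add: eval_nat_numeral)
  note s = Ug_rel[OF U_rels.intros(5)[of Node1 Node2], unfolded fp p] Ug_rel[OF U_rels.intros(5)[of Node2 Node1], unfolded fp p]
    Ug_rel[OF U_rels.intros(6)[of Node1 Node2], unfolded fp p] Ug_rel[OF U_rels.intros(6)[of Node2 Node1], unfolded fp p]
  show "commutator (Ug_e Node1) (commutator (Ug_e Node1) (commutator (Ug_e Node1) (commutator (Ug_e Node1) (Ug_e Node2)))) = 0"
    "commutator (Ug_e Node2) (commutator (Ug_e Node2) (Ug_e Node1)) = 0"
    "commutator (Ug_f Node1) (commutator (Ug_f Node1) (commutator (Ug_f Node1) (commutator (Ug_f Node1) (Ug_f Node2)))) = 0"
    "commutator (Ug_f Node2) (commutator (Ug_f Node2) (Ug_f Node1)) = 0"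
    using s by (simp_all add: abs_Ug_commutator Ug_e_def Ug_f_def)
qed (simp_all add: Ug_relations coroot_nonzero)

interpretation d: g2_chev "Ug_f Node1" "Ug_f Node2" "Ug_e Node1" "Ug_e Node2" "- Ug_coroot Node1" "- Ug_coroot Node2"
  by (rule g.dual)

section \<open>Root vectors spanning the Lie algebra\<close>

datatype rt = R1 | R2 | R3 | R4 | R5 | R6

lemma UNIV_rt: "UNIV = {R1, R2, R3, R4, R5, R6}"
  by (auto intro: rt.exhaust)

instance rt :: finite
  by standard (simp add: UNIV_rt)

fun xr :: "rt \<Rightarrow> Ug" where
  "xr R1 = Ug_e Node1" | "xr R2 = Ug_e Node2" | "xr R3 = g.x3" | "xr R4 = g.x4" | "xr R5 = g.x5" | "xr R6 = g.x6"

fun yr :: "rt \<Rightarrow> Ug" where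
  "yr R1 = Ug_f Node1" | "yr R2 = Ug_f Node2" | "yr R3 = d.x3" | "yr R4 = d.x4" | "yr R5 = d.x5" | "yr R6 = d.x6"

fun rht :: "rt \<Rightarrow> node \<Rightarrow> int" where
  "rht R1 Node1 = 1" | "rht R1 Node2 = 0" | "rht R2 Node1 = 0" | "rht R2 Node2 = 1"
| "rht R3 Node1 = 1" | "rht R3 Node2 = 1" | "rht R4 Node1 = 2" | "rht R4 Node2 = 1"
| "rht R5 Node1 = 3" | "rht R5 Node2 = 1" | "rht R6 Node1 = 3" | "rht R6 Node2 = 2"

definition pairing :: "node \<Rightarrow> (node \<Rightarrow> int) \<Rightarrow> int" where
  "pairing i \<beta> = \<beta> Node1 * cartan i Node1 + \<beta> Node2 * cartan i Node2"

lemma coroot_comm: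
  "commutator (Ug_coroot i) (xr k) = scale_Ug (of_int (pairing i (rht k))) (xr k)"
  "commutator (Ug_coroot i) (yr k) = scale_Ug (of_int (pairing i (\<lambda>j. - rht k j))) (yr k)"
proof -
  show "commutator (Ug_coroot i) (xr k) = scale_Ug (of_int (pairing i (rht k))) (xr k)"
    by (cases i; cases k) (simp_all add: pairing_def g.he g.h_table)
  have neg: "commutator x y = scale_Ug (- c) y" if "commutator (- x) y = scale_Ug c y" for x y c
    using that by (simp add: comm_minus Ug.scale_minus_left eq_neg_iff_add_eq_0 neg_eq_iff_add_eq_0)
  show "commutator (Ug_coroot i) (yr k) = scale_Ug (of_int (pairing i (\<lambda>j. - rht k j))) (yr k)"
    by (cases i; cases k) (simp_all add: pairing_def g.hf d.h_table[THEN neg])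
qed

lemma rev_comm: "commutator (xr k) (Ug_coroot i) = scale_Ug (- of_int (pairing i (rht k))) (xr k)"
  "commutator (yr k) (Ug_coroot i) = scale_Ug (- of_int (pairing i (\<lambda>j. - rht k j))) (yr k)"
  using comm_anti[of "xr k" "Ug_coroot i"] comm_anti[of "yr k" "Ug_coroot i"]
  by (simp_all only: coroot_comm Ug.scale_minus_left)

lemma gens_table:
  "commutator (Ug_e Node1) (xr k) = (case k of R2 \<Rightarrow> xr R3 | R3 \<Rightarrow> xr R4 | R4 \<Rightarrow> xr R5 | _ \<Rightarrow> 0)"
  "commutator (Ug_e Node2) (xr k) = (case k of R1 \<Rightarrow> - xr R3 | R5 \<Rightarrow> xr R6 | _ \<Rightarrow> 0)"
  "commutator (Ug_f Node1) (yr k) = (case k of R2 \<Rightarrow> yr R3 | R3 \<Rightarrow> yr R4 | R4 \<Rightarrow> yr R5 | _ \<Rightarrow> 0)"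
  "commutator (Ug_f Node2) (yr k) = (case k of R1 \<Rightarrow> - yr R3 | R5 \<Rightarrow> yr R6 | _ \<Rightarrow> 0)"
  "commutator (Ug_e Node1) (yr k) = (case k of R1 \<Rightarrow> Ug_coroot Node1 | R3 \<Rightarrow> scale_Ug 3 (yr R2)
     | R4 \<Rightarrow> scale_Ug 4 (yr R3) | R5 \<Rightarrow> scale_Ug 3 (yr R4) | _ \<Rightarrow> 0)"
  "commutator (Ug_e Node2) (yr k) = (case k of R2 \<Rightarrow> Ug_coroot Node2 | R3 \<Rightarrow> - yr R1 | R6 \<Rightarrow> yr R5 | _ \<Rightarrow> 0)"
  "commutator (Ug_f Node1) (xr k) = (case k of R1 \<Rightarrow> - Ug_coroot Node1 | R3 \<Rightarrow> scale_Ug 3 (xr R2)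
     | R4 \<Rightarrow> scale_Ug 4 (xr R3) | R5 \<Rightarrow> scale_Ug 3 (xr R4) | _ \<Rightarrow> 0)"
  "commutator (Ug_f Node2) (xr k) = (case k of R2 \<Rightarrow> - Ug_coroot Node2 | R3 \<Rightarrow> - xr R1 | R6 \<Rightarrow> xr R5 | _ \<Rightarrow> 0)"
  by (cases k; simp add: g.e_table d.e_table g.f_table d.f_table comm_0)+

lemma r_nonzero: "xr k \<noteq> 0" "yr k \<noteq> 0"
  by (cases k; simp add: g.x_nonzero d.x_nonzero)+

lemma r_gg: "xr k \<in> gg" "yr k \<in> gg"
  by (cases k; simp add: g.x3_def g.x4_def g.x5_def g.x6_def d.x3_def d.x4_def d.x5_def d.x6_def gg.intros)+

definition Vb :: "Ug set" where "Vb = range Ug_coroot \<union> range xr \<union> range yr"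

lemma finite_Vb: "finite Vb"
proof -
  have "finite (UNIV :: node set)"
    by (rule finite_subset[of _ "{Node1, Node2}"]) (auto intro: node.exhaust)
  then show ?thesis unfolding Vb_def by simp
qed

lemma Vb_span: "Ug_coroot i \<in> Ug.span Vb" "xr k \<in> Ug.span Vb" "yr k \<in> Ug.span Vb"
  by (rule Ug.span_base, simp add: Vb_def)+

lemma ef_xr: "Ug_e i = xr (if i = Node1 then R1 else R2)" "Ug_f i = yr (if i = Node1 then R1 else R2)"
  by (cases i; simp)+

lemmas Vb_span_intros = Vb_span Ug.span_scale Ug.span_neg Ug.span_zero

lemma ef_xr_span: "commutator (Ug_e i) (xr k) \<in> Ug.span Vb" "commutator (Ug_e i) (yr k) \<in> Ug.span Vb"
  "commutator (Ug_f i) (xr k) \<in> Ug.span Vb" "commutator (Ug_f i) (yr k) \<in> Ug.span Vb"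
  by (cases i; simp only: gens_table split: rt.split; intro conjI impI Vb_span_intros)+

lemma ef_coroot_span: "commutator (Ug_e i) (Ug_coroot j) \<in> Ug.span Vb" "commutator (Ug_f i) (Ug_coroot j) \<in> Ug.span Vb"
  unfolding ef_xr rev_comm by (rule Ug.span_scale, rule Vb_span)+

lemma coroot_span: "commutator (Ug_coroot i) (Ug_coroot j) \<in> Ug.span Vb"
  "commutator (Ug_coroot i) (xr k) \<in> Ug.span Vb" "commutator (Ug_coroot i) (yr k) \<in> Ug.span Vb"
  unfolding Ug_relations(1) coroot_comm by (rule Ug.span_zero, (rule Ug.span_scale, rule Vb_span)+)

lemma Vb_cases:
  assumes "s \<in> Vb" and "\<And>j. P (Ug_coroot j)" "\<And>k. P (xr k)" "\<And>k. P (yr k)"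
  shows "P s"
  using assms unfolding Vb_def by blast

lemma gens_span:
  assumes "s \<in> Vb"
  shows "commutator (Ug_coroot i) s \<in> Ug.span Vb" "commutator (Ug_e i) s \<in> Ug.span Vb"
    "commutator (Ug_f i) s \<in> Ug.span Vb"
proof -
  show "commutator (Ug_coroot i) s \<in> Ug.span Vb" by (rule Vb_cases[OF assms]) (rule coroot_span)+
  show "commutator (Ug_e i) s \<in> Ug.span Vb" by (rule Vb_cases[OF assms]) (rule ef_xr_span ef_coroot_span)+
  show "commutator (Ug_f i) s \<in> Ug.span Vb" by (rule Vb_cases[OF assms]) (rule ef_xr_span ef_coroot_span)+
qed

lemma comm_span:
  assumes "\<And>s. s \<in> S \<Longrightarrow> commutator x s \<in> Ug.span T" "y \<in> Ug.span S"
  shows "commutator x y \<in> Ug.span T"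
  using assms(2)
proof (induction rule: Ug.span_induct_alt)
  case base
  show ?case by (simp add: comm_0 Ug.span_zero)
next
  case (step c s y)
  then show ?case using assms(1) by (simp add: comm_simps Ug.span_add Ug.span_scale)
qed

text \<open>Closure under brackets needs the stronger induction hypothesis that ad x also preserves
  the span; the Jacobi identity propagates it.\<close>

lemma gg_span: "x \<in> gg \<Longrightarrow> x \<in> Ug.span Vb"
proof -
  assume "x \<in> gg"
  then have "x \<in> Ug.span Vb \<and> (\<forall>s\<in>Vb. commutator x s \<in> Ug.span Vb)"
  proof induction
    case (1 i)
    have "Ug_e i \<in> Ug.span Vb" unfolding ef_xr by (rule Vb_span)
    then show ?case using gens_span(2) by blast
  next
    case (2 i)
    have "Ug_f i \<in> Ug.span Vb" unfolding ef_xr by (rule Vb_span)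
    then show ?case using gens_span(3) by blast
  next
    case (3 i)
    show ?case using gens_span(1) Vb_span(1) by blast
  next
    case 4
    then show ?case by (simp add: comm_0 Ug.span_zero)
  next
    case (5 x y)
    then show ?case by (simp add: comm_simps Ug.span_add)
  next
    case (6 x c)
    then show ?case by (simp add: comm_simps Ug.span_scale)
  next
    case (7 x y)
    have x: "commutator x z \<in> Ug.span Vb" if "z \<in> Ug.span Vb" for z
      by (rule comm_span[OF _ that], rule bspec[OF conjunct2[OF "7.IH"(1)]])
    have y: "commutator y z \<in> Ug.span Vb" if "z \<in> Ug.span Vb" for z
      by (rule comm_span[OF _ that], rule bspec[OF conjunct2[OF "7.IH"(2)]])
    have eq: "commutator (commutator x y) s = commutator x (commutator y s) - commutator y (commutator x s)" for s
      by (simp add: jacobi[of x y s])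
    have "commutator (commutator x y) s \<in> Ug.span Vb" if "s \<in> Vb" for s
      unfolding eq by (intro Ug.span_diff x y Ug.span_base that)
    moreover have "commutator x y \<in> Ug.span Vb" by (rule x[OF conjunct1[OF "7.IH"(2)]])
    ultimately show ?case by blast
  qed
  then show ?thesis by simp
qed

section \<open>Weight decomposition and root spaces\<close>

text \<open>Subtracting l(a) times the sum from its image under ad H eliminates the component a and
  rescales the others by nonzero factors.\<close>

lemma eigenvectors_independent:
  assumes "finite A" "\<And>w. w \<in> A \<Longrightarrow> commutator H (v w) = scale_Ug (l w) (v w)" "inj_on l A"
    "(\<Sum>w\<in>A. v w) = 0" "w \<in> A"
  shows "v w = 0"
  using assms
proof (induction A arbitrary: v w rule: finite_induct)
  case (insert a F)
  have comm_sum: "commutator H (sum f B) = (\<Sum>w\<in>B. commutator H (f w))" for f :: "'a \<Rightarrow> Ug" and B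
    by (induction B rule: infinite_finite_induct) (simp_all add: comm_simps)
  have sum: "v a + (\<Sum>w\<in>F. v w) = 0" using insert by simp
  have "commutator H (v a + (\<Sum>w\<in>F. v w)) = scale_Ug (l a) (v a) + (\<Sum>w\<in>F. scale_Ug (l w) (v w))"
    unfolding comm_add comm_sum using insert.prems(1) by (simp cong: sum.cong)
  then have "scale_Ug (l a) (v a) + (\<Sum>w\<in>F. scale_Ug (l w) (v w)) = 0" using sum by (simp add: comm_0)
  moreover have "scale_Ug (l a) (v a) + (\<Sum>w\<in>F. scale_Ug (l a) (v w)) = 0"
    using arg_cong[OF sum, of "scale_Ug (l a)"] by (simp add: Ug.scale_right_distrib Ug.scale_sum_right)
  ultimately have "(\<Sum>w\<in>F. scale_Ug (l w) (v w)) = (\<Sum>w\<in>F. scale_Ug (l a) (v w))"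
    by (metis add_left_cancel)
  then have zero: "(\<Sum>w\<in>F. scale_Ug (l w - l a) (v w)) = 0"
    by (simp add: Ug.scale_left_diff_distrib sum_subtractf)
  have F: "v w = 0" if "w \<in> F" for w
  proof -
    have "commutator H (scale_Ug (l u - l a) (v u)) = scale_Ug (l u) (scale_Ug (l u - l a) (v u))" if "u \<in> F" for u
      using insert.prems(1)[of u] that by (simp add: comm_simps mult.commute)
    moreover have "inj_on l F" using insert.prems(2) by (simp add: inj_on_def)
    ultimately have "scale_Ug (l w - l a) (v w) = 0"
      using insert.IH[of "\<lambda>u. scale_Ug (l u - l a) (v u)" w] zero that by blast
    moreover have "l w \<noteq> l a" using insert.prems(2) that insert.hyps by (auto simp: inj_on_def)
    ultimately show ?thesis by simp
  qed
  then have "v a = 0" using sum by simp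
  then show ?case using F insert.prems by auto
qed simp

datatype idx = Cartan | Pos rt | Neg rt

lemma UNIV_idx: "UNIV = insert Cartan (range Pos \<union> range Neg)"
  by (auto intro: idx.exhaust)

instance idx :: finite
  by standard (simp add: UNIV_idx)

fun iwt :: "idx \<Rightarrow> node \<Rightarrow> int" where
  "iwt Cartan j = 0" | "iwt (Pos k) j = rht k j" | "iwt (Neg k) j = - rht k j"

fun rcomp :: "idx \<Rightarrow> Ug set" where
  "rcomp Cartan = range Ug_coroot" | "rcomp (Pos k) = {xr k}" | "rcomp (Neg k) = {yr k}"

lemma inj_iwt: "inj iwt"
proof (rule injI)
  fix m n assume "iwt m = iwt n"
  then have "iwt m Node1 = iwt n Node1" "iwt m Node2 = iwt n Node2" by simp_all
  moreover have rht: "rht k Node1 = rht l Node1 \<Longrightarrow> rht k Node2 = rht l Node2 \<Longrightarrow> k = l" for k l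
    by (cases k; cases l; simp)
  moreover have pos: "rht k Node1 + rht k Node2 > 0" for k by (cases k; simp)
  ultimately show "m = n"
  proof (cases m; cases n)
    fix k l assume "m = Pos k" "n = Neg l"
    then show "m = n" using \<open>iwt m Node1 = iwt n Node1\<close> \<open>iwt m Node2 = iwt n Node2\<close> pos[of k] pos[of l] by simp
  next
    fix k l assume "m = Neg k" "n = Pos l"
    then show "m = n" using \<open>iwt m Node1 = iwt n Node1\<close> \<open>iwt m Node2 = iwt n Node2\<close> pos[of k] pos[of l] by simp
  next
    fix k assume "m = Cartan" "n = Pos k"
    then show "m = n" using \<open>iwt m Node1 = iwt n Node1\<close> \<open>iwt m Node2 = iwt n Node2\<close> pos[of k] by simp
  next
    fix k assume "m = Cartan" "n = Neg k"
    then show "m = n" using \<open>iwt m Node1 = iwt n Node1\<close> \<open>iwt m Node2 = iwt n Node2\<close> pos[of k] by simp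
  next
    fix k assume "m = Pos k" "n = Cartan"
    then show "m = n" using \<open>iwt m Node1 = iwt n Node1\<close> \<open>iwt m Node2 = iwt n Node2\<close> pos[of k] by simp
  next
    fix k assume "m = Neg k" "n = Cartan"
    then show "m = n" using \<open>iwt m Node1 = iwt n Node1\<close> \<open>iwt m Node2 = iwt n Node2\<close> pos[of k] by simp
  qed (simp_all add: rht)
qed

text \<open>\<open>\<alpha>\<^sub>1\<close> and \<open>\<alpha>\<^sub>2\<close> take the values \<open>1\<close> and \<open>\<i>\<close> on \<open>Hc\<close>, which therefore separates all integral weights.\<close>

definition "Hc = scale_Ug (2 + \<i>) (Ug_coroot Node1) + scale_Ug (3 + 2 * \<i>) (Ug_coroot Node2)"

definition "lam \<beta> = of_int (\<beta> Node1) + \<i> * of_int (\<beta> Node2)"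

lemma inj_lam: "inj lam"
proof (rule injI)
  fix \<beta> \<gamma> :: "node \<Rightarrow> int" assume "lam \<beta> = lam \<gamma>"
  then have "\<beta> Node1 = \<gamma> Node1" "\<beta> Node2 = \<gamma> Node2" by (simp_all add: lam_def complex_eq_iff)
  then show "\<beta> = \<gamma>" by (intro ext) (case_tac x; simp)
qed

lemma Hc_comm:
  assumes "\<And>i. commutator (Ug_coroot i) x = scale_Ug (of_int (pairing i \<beta>)) x"
  shows "commutator Hc x = scale_Ug (lam \<beta>) x"
proof -
  have "commutator Hc x = scale_Ug ((2 + \<i>) * of_int (pairing Node1 \<beta>) + (3 + 2 * \<i>) * of_int (pairing Node2 \<beta>)) x"
    by (simp only: Hc_def comm_add comm_scale assms Ug.scale_scale Ug.scale_left_distrib[symmetric])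
  also have "(2 + \<i>) * of_int (pairing Node1 \<beta>) + (3 + 2 * \<i>) * of_int (pairing Node2 \<beta>) = lam \<beta>"
    by (simp add: pairing_def lam_def algebra_simps)
  finally show ?thesis .
qed

lemma comp_weight:
  assumes "x \<in> Ug.span (rcomp n)"
  shows "commutator (Ug_coroot i) x = scale_Ug (of_int (pairing i (iwt n))) x"
  using assms
proof (induction rule: Ug.span_induct_alt)
  case (step c s y)
  have "commutator (Ug_coroot i) s = scale_Ug (of_int (pairing i (iwt n))) s"
  proof (cases n)
    case Cartan
    then show ?thesis using step(1) by (auto simp: Ug_relations(1) pairing_def)
  next
    case (Pos k)
    then have "iwt n = rht k" by (simp add: fun_eq_iff)
    then show ?thesis using step(1) Pos by (simp add: coroot_comm)
  next
    case (Neg k)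
    then have "iwt n = (\<lambda>j. - rht k j)" by (simp add: fun_eq_iff)
    then show ?thesis using step(1) Neg by (simp add: coroot_comm)
  qed
  then show ?case using step by (simp add: comm_simps Ug.scale_right_distrib mult.commute)
qed (simp add: comm_0)

lemma weight_decomposition:
  assumes "x \<in> Ug.span Vb"
  shows "\<exists>v. (\<forall>n. v n \<in> Ug.span (rcomp n)) \<and> x = (\<Sum>n\<in>UNIV. v n)"
  using assms
proof (induction rule: Ug.span_induct_alt)
  case base
  show ?case by (rule exI[of _ "\<lambda>_. 0"]) (simp add: Ug.span_zero)
next
  case (step c s y)
  then obtain v where v: "\<And>n. v n \<in> Ug.span (rcomp n)" and y: "y = (\<Sum>n\<in>UNIV. v n)" by blast
  have "\<exists>n. s \<in> rcomp n"
    by (rule Vb_cases[OF step(1)]) (rule exI[of _ Cartan], simp, rule exI[of _ "Pos _"], simp, rule exI[of _ "Neg _"], simp)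
  then obtain n where n: "s \<in> rcomp n" by blast
  let ?v = "\<lambda>m. (if m = n then scale_Ug c s else 0) + v m"
  have "(if m = n then scale_Ug c s else 0) \<in> Ug.span (rcomp m)" for m
    using n by (simp add: Ug.span_scale Ug.span_base Ug.span_zero)
  then have "?v m \<in> Ug.span (rcomp m)" for m
    using v by (rule Ug.span_add)
  moreover have "scale_Ug c s + y = (\<Sum>m\<in>UNIV. ?v m)"
    by (simp add: sum.distrib y)
  ultimately show ?case by (intro exI[of _ ?v] conjI allI)
qed

lemma root_space_comp:
  assumes x: "x \<in> root_space \<beta>"
  shows "(\<forall>n. iwt n \<noteq> \<beta>) \<Longrightarrow> x = 0" and "iwt n = \<beta> \<Longrightarrow> x \<in> Ug.span (rcomp n)"
proof -
  have wx: "commutator (Ug_coroot i) x = scale_Ug (of_int (pairing i \<beta>)) x" for i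
    using x by (simp add: root_space_def pairing_def)
  have "x \<in> Ug.span Vb" using x gg_span by (simp add: root_space_def)
  then obtain v where v: "\<And>n. v n \<in> Ug.span (rcomp n)" and xv: "x = (\<Sum>n\<in>UNIV. v n)"
    using weight_decomposition by blast
  define A where "A = insert \<beta> (range iwt)"
  \<comment> \<open>The weight components of x, with x itself subtracted at \<beta>: eigenvectors of
    ad \<open>Hc\<close> for distinct eigenvalues whose sum is zero. Hence each vanishes, and x is
    its own component of weight \<beta>.\<close>
  define u where "u w = (\<Sum>n\<in>{n\<in>UNIV. iwt n = w}. v n) - (if w = \<beta> then x else 0)" for w
  have A: "finite A" by (simp add: A_def)
  have "(\<Sum>w\<in>A. \<Sum>n\<in>{n\<in>UNIV. iwt n = w}. v n) = (\<Sum>n\<in>UNIV. v n)"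
    using A by (intro sum.group) (auto simp: A_def)
  then have sum0: "(\<Sum>w\<in>A. u w) = 0"
    unfolding u_def sum_subtractf using A xv by (simp add: A_def)
  have "u \<beta> = 0"
  proof (rule eigenvectors_independent[OF A _ _ sum0, of Hc lam])
    fix w assume "w \<in> A"
    have "commutator Hc (v n) = scale_Ug (lam (iwt n)) (v n)" for n
      by (rule Hc_comm) (rule comp_weight[OF v])
    moreover have "commutator Hc (\<Sum>n\<in>B. f n) = (\<Sum>n\<in>B. commutator Hc (f n))" for f :: "idx \<Rightarrow> Ug" and B
      by (induction B rule: infinite_finite_induct) (simp_all add: comm_simps)
    ultimately have "commutator Hc (\<Sum>n\<in>{n\<in>UNIV. iwt n = w}. v n) = scale_Ug (lam w) (\<Sum>n\<in>{n\<in>UNIV. iwt n = w}. v n)"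
      by (simp add: Ug.scale_sum_right)
    then show "commutator Hc (u w) = scale_Ug (lam w) (u w)"
      using Hc_comm[OF wx] by (simp add: u_def comm_simps Ug.scale_right_diff_distrib)
  qed (use inj_lam in \<open>auto simp: A_def inj_on_def\<close>)
  then have x: "x = (\<Sum>n\<in>{n\<in>UNIV. iwt n = \<beta>}. v n)" by (simp add: u_def)
  show "x = 0" if "\<forall>n. iwt n \<noteq> \<beta>" using x that by simp
  show "x \<in> Ug.span (rcomp n)" if "iwt n = \<beta>"
  proof -
    have "{m\<in>UNIV. iwt m = \<beta>} = {n}" using that inj_iwt by (auto simp: inj_def)
    then show ?thesis using x v by simp
  qed
qed

lemma xr_root_space: "xr k \<in> root_space (rht k)" "yr k \<in> root_space (\<lambda>j. - rht k j)"
  using coroot_comm[of _ k] r_gg by (simp_all add: root_space_def pairing_def)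

lemma positive_roots_eq: "positive_roots = range rht"
proof
  show "positive_roots \<subseteq> range rht"
  proof
    fix \<beta> assume \<beta>: "\<beta> \<in> positive_roots"
    then obtain x where "x \<in> root_space \<beta>" "x \<noteq> 0" unfolding positive_roots_def by blast
    then obtain n where n: "iwt n = \<beta>" using root_space_comp(1) by blast
    show "\<beta> \<in> range rht"
    proof (cases n)
      case Cartan
      then have "\<beta> = (\<lambda>_. 0)" using n by (auto simp: fun_eq_iff)
      then show ?thesis using \<beta> by (simp add: positive_roots_def)
    next
      case (Pos k)
      then have "\<beta> = rht k" using n by (auto simp: fun_eq_iff)
      then show ?thesis by simp
    next
      case (Neg k)
      then have "0 \<le> - rht k Node1" "0 \<le> - rht k Node2"
        using n \<beta> by (auto simp: positive_roots_def)
      then show ?thesis by (cases k) simp_all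
    qed
  qed
  show "range rht \<subseteq> positive_roots"
  proof
    fix \<beta> assume "\<beta> \<in> range rht"
    then obtain k where k: "\<beta> = rht k" by blast
    have "rht k Node1 + rht k Node2 \<noteq> 0" by (cases k; simp)
    then have "\<beta> \<noteq> (\<lambda>_. 0)" unfolding k by auto
    moreover have "0 \<le> rht k i" for i by (cases k; cases i; simp)
    ultimately show "\<beta> \<in> positive_roots"
      using xr_root_space(1)[of k] r_nonzero(1)[of k] unfolding positive_roots_def k by blast
  qed
qed

text \<open>The chosen root vectors are known only up to nonzero scalars; these cancel later in the
  r-matrix.\<close>

lemma root_vector_eq:
  "\<exists>c. c \<noteq> 0 \<and> root_vector (rht k) = scale_Ug c (xr k)"
  "\<exists>c. c \<noteq> 0 \<and> root_vector (\<lambda>i. - rht k i) = scale_Ug c (yr k)"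
proof -
  have "root_vector (rht k) \<in> root_space (rht k) \<and> root_vector (rht k) \<noteq> 0"
    unfolding root_vector_def by (rule someI[of _ "xr k"]) (simp add: xr_root_space r_nonzero)
  moreover from this have "root_vector (rht k) \<in> Ug.span {xr k}"
    using root_space_comp(2)[of "root_vector (rht k)" "rht k" "Pos k"] by (simp add: fun_eq_iff)
  ultimately show "\<exists>c. c \<noteq> 0 \<and> root_vector (rht k) = scale_Ug c (xr k)"
    unfolding Ug.span_singleton by force
  have "root_vector (\<lambda>i. - rht k i) \<in> root_space (\<lambda>i. - rht k i) \<and> root_vector (\<lambda>i. - rht k i) \<noteq> 0"
    unfolding root_vector_def by (rule someI[of _ "yr k"]) (simp add: xr_root_space r_nonzero)
  moreover from this have "root_vector (\<lambda>i. - rht k i) \<in> Ug.span {yr k}"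
    using root_space_comp(2)[of "root_vector (\<lambda>i. - rht k i)" "\<lambda>i. - rht k i" "Neg k"] by (simp add: fun_eq_iff)
  ultimately show "\<exists>c. c \<noteq> 0 \<and> root_vector (\<lambda>i. - rht k i) = scale_Ug c (yr k)"
    unfolding Ug.span_singleton by force
qed

section \<open>Invariance of the Killing form\<close>

lemma gg_subspace: "Ug.subspace gg"
  unfolding Ug.subspace_def using gg.intros(4-6) by blast

text \<open>The basis picked inside \<open>trace_on gg\<close>, given a name so that traces can be
  expanded in it.\<close>

definition "Bg = (SOME B. Ug.independent B \<and> Ug.span B = gg)"

lemma Bg: "Ug.independent Bg" "Ug.span Bg = gg" "finite Bg"
proof -
  obtain B where "B \<subseteq> gg" "Ug.independent B" "gg \<subseteq> Ug.span B" by (rule Ug.basis_exists[of gg])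
  moreover from this have "Ug.span B = gg" using Ug.span_subspace[OF _ _ gg_subspace] by blast
  ultimately have "\<exists>B. Ug.independent B \<and> Ug.span B = gg" by blast
  then have "Ug.independent Bg \<and> Ug.span Bg = gg" unfolding Bg_def by (rule someI_ex)
  then show B: "Ug.independent Bg" "Ug.span Bg = gg" by auto
  have "Bg \<subseteq> gg" using Ug.span_superset[of Bg] B(2) by simp
  then have "Bg \<subseteq> Ug.span Vb" using gg_span by blast
  then show "finite Bg" using Ug.independent_span_bound[OF finite_Vb B(1)] by blast
qed

lemma Bg_gg: "b \<in> Bg \<Longrightarrow> b \<in> gg"
  using Ug.span_superset[of Bg] Bg(2) by blast

lemma trace_on_gg: "trace_on gg \<phi> = (\<Sum>b\<in>Bg. Ug.representation Bg (\<phi> b) b)"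
  by (simp add: trace_on_def Bg_def Let_def)

lemma trace_diff:
  assumes "\<And>x. x \<in> gg \<Longrightarrow> \<phi> x \<in> gg" "\<And>x. x \<in> gg \<Longrightarrow> \<psi> x \<in> gg"
  shows "trace_on gg (\<lambda>x. \<phi> x - \<psi> x) = trace_on gg \<phi> - trace_on gg \<psi>"
  unfolding trace_on_gg sum_subtractf[symmetric]
  using assms Bg Bg_gg by (intro sum.cong refl) (simp add: Ug.representation_diff)

lemma trace_cyclic:
  assumes \<phi>: "\<And>x. x \<in> gg \<Longrightarrow> \<phi> x \<in> gg" "\<And>x y. \<phi> (x + y) = \<phi> x + \<phi> y" "\<And>c x. \<phi> (scale_Ug c x) = scale_Ug c (\<phi> x)"
    and \<psi>: "\<And>x. x \<in> gg \<Longrightarrow> \<psi> x \<in> gg" "\<And>x y. \<psi> (x + y) = \<psi> x + \<psi> y" "\<And>c x. \<psi> (scale_Ug c x) = scale_Ug c (\<psi> x)"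
  shows "trace_on gg (\<lambda>x. \<phi> (\<psi> x)) = trace_on gg (\<lambda>x. \<psi> (\<phi> x))"
proof -
  let ?R = "Ug.representation Bg"
  have expand: "trace_on gg (\<lambda>x. f (g x)) = (\<Sum>b\<in>Bg. \<Sum>c\<in>Bg. ?R (g b) c * ?R (f c) b)"
    if f: "\<And>x. x \<in> gg \<Longrightarrow> f x \<in> gg" "\<And>x y. f (x + y) = f x + f y" "\<And>c x. f (scale_Ug c x) = scale_Ug c (f x)"
    and g: "\<And>x. x \<in> gg \<Longrightarrow> g x \<in> gg" for f g
    unfolding trace_on_gg
  proof (rule sum.cong[OF refl])
    fix b assume b: "b \<in> Bg"
    have f0: "f 0 = 0" using f(2)[of 0 0] by simp
    have fsum: "f (sum h A) = (\<Sum>c\<in>A. f (h c))" for h :: "Ug \<Rightarrow> Ug" and A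
      by (induction A rule: infinite_finite_induct) (simp_all add: f f0)
    have gb: "g b = (\<Sum>c\<in>Bg. scale_Ug (?R (g b) c) c)"
      using Ug.sum_representation_eq[OF Bg(1) _ Bg(3) order_refl, of "g b"] g[OF Bg_gg[OF b]] Bg(2) by simp
    have "f (g b) = (\<Sum>c\<in>Bg. scale_Ug (?R (g b) c) (f c))"
      using arg_cong[OF gb, of f] by (simp only: fsum f(3))
    moreover have fc: "f c \<in> Ug.span Bg" if "c \<in> Bg" for c
      unfolding Bg(2) by (rule f(1)) (rule Bg_gg[OF that])
    ultimately have "?R (f (g b)) b = (\<Sum>c\<in>Bg. ?R (scale_Ug (?R (g b) c) (f c)) b)"
      using Ug.representation_sum[OF Bg(1), of Bg "\<lambda>c. scale_Ug (?R (g b) c) (f c)"] by (simp only: Ug.span_scale)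
    then show "?R (f (g b)) b = (\<Sum>c\<in>Bg. ?R (g b) c * ?R (f c) b)"
      using Ug.representation_scale[OF Bg(1) fc] by simp
  qed
  have "trace_on gg (\<lambda>x. \<phi> (\<psi> x)) = (\<Sum>b\<in>Bg. \<Sum>c\<in>Bg. ?R (\<psi> b) c * ?R (\<phi> c) b)"
    by (rule expand) (rule \<phi> \<psi>, assumption?)+
  also have "\<dots> = (\<Sum>c\<in>Bg. \<Sum>b\<in>Bg. ?R (\<phi> c) b * ?R (\<psi> b) c)"
    by (subst sum.swap) (simp add: mult.commute)
  also have "\<dots> = trace_on gg (\<lambda>x. \<psi> (\<phi> x))"
    by (rule expand[symmetric]) (rule \<phi> \<psi>, assumption?)+
  finally show ?thesis .
qed

lemma killing_scale:
  assumes "x \<in> gg" "y \<in> gg"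
  shows "killing (scale_Ug c x) (scale_Ug d y) = c * d * killing x y"
  unfolding killing_def trace_on_gg sum_distrib_left
proof (rule sum.cong[OF refl])
  fix b assume "b \<in> Bg"
  then have "commutator x (commutator y b) \<in> Ug.span Bg" using assms Bg Bg_gg gg.intros(7) by blast
  then show "Ug.representation Bg (commutator (scale_Ug c x) (commutator (scale_Ug d y) b)) b
      = c * d * Ug.representation Bg (commutator x (commutator y b)) b"
    by (simp add: comm_simps Ug.representation_scale[OF Bg(1)])
qed

text \<open>Both sides are traces of products of adjoint maps, and tr(abc - bac) = tr(abc - acb)
  since bac and acb differ by a cyclic shift.\<close>

lemma killing_invariant:
  assumes "a \<in> gg" "b \<in> gg" "c \<in> gg"
  shows "killing (commutator a b) c = killing a (commutator b c)"
proof -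
  have ad: "commutator x y \<in> gg" if "x \<in> gg" "y \<in> gg" for x y using that by (rule gg.intros(7))
  have j: "commutator (commutator x y) z = commutator x (commutator y z) - commutator y (commutator x z)" for x y z
    by (simp add: jacobi[of x y z])
  have "killing (commutator a b) c
      = trace_on gg (\<lambda>z. commutator a (commutator b (commutator c z))) - trace_on gg (\<lambda>z. commutator b (commutator a (commutator c z)))"
    unfolding killing_def j by (rule trace_diff) (intro ad assms, assumption)+
  also have "trace_on gg (\<lambda>z. commutator b (commutator a (commutator c z))) = trace_on gg (\<lambda>z. commutator a (commutator c (commutator b z)))"
    by (rule trace_cyclic[of "commutator b" "\<lambda>z. commutator a (commutator c z)"]) (simp_all add: ad assms comm_simps)
  also have "trace_on gg (\<lambda>z. commutator a (commutator b (commutator c z))) - trace_on gg (\<lambda>z. commutator a (commutator c (commutator b z)))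
      = killing a (commutator b c)"
    unfolding killing_def j[of b c] comm_diff
    by (rule trace_diff[symmetric]) (intro ad assms, assumption)+
  finally show ?thesis .
qed

text \<open>The ratios K(x_1, y_1) / K(x_k, y_k). They are found by moving a Chevalley generator
  from one argument of the invariant form to the other along the bracket tables; the signs arise
  because x_k and y_k are nested in the same order.\<close>

fun kcoef :: "rt \<Rightarrow> complex" where
  "kcoef R1 = 1" | "kcoef R2 = 3" | "kcoef R3 = - 1" | "kcoef R4 = 1 / 4" | "kcoef R5 = - 1 / 12" | "kcoef R6 = 1 / 12"

lemma killing_roots: "killing (xr k) (yr k) = killing (xr R1) (yr R1) / kcoef k"
proof -
  let ?\<kappa> = "killing (xr R1) (yr R1)"
  have sc: "killing x (scale_Ug c y) = c * killing x y" if "x \<in> gg" "y \<in> gg" for x y c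
    using killing_scale[OF that, of 1 c] by simp
  have sc': "killing (- x) y = - killing x y" "killing x (- y) = - killing x y" if "x \<in> gg" "y \<in> gg" for x y
    using killing_scale[OF that, of "- 1" 1] killing_scale[OF that, of 1 "- 1"] by simp_all
  have E: "Ug_e i \<in> gg" for i by (rule gg.intros)
  have 3: "killing (xr R3) (yr R3) = - ?\<kappa>"
    using killing_invariant[OF E[of Node1] E[of Node2] r_gg(2)[of R3]] sc'(2)[OF E[of Node1] r_gg(2)[of R1]]
    by (simp add: gens_table g.e_table d.f_table)
  have 2: "killing (xr R2) (yr R2) = ?\<kappa> / 3"
  proof -
    have "killing (- xr R3) (yr R3) = 3 * killing (xr R2) (yr R2)"
      using killing_invariant[OF E[of Node2] E[of Node1] r_gg(2)[of R3]] sc[OF E[of Node2] r_gg(2)[of R2], of 3]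
      by (simp add: gens_table g.e_table d.f_table)
    then show ?thesis using 3 sc'(1)[OF r_gg(1)[of R3] r_gg(2)[of R3]] by (simp add: eq_divide_eq mult.commute)
  qed
  have step: "killing (commutator (Ug_e i) (xr k)) (yr l) = - c * killing (xr k) (yr m)"
    if "commutator (Ug_e i) (yr l) = scale_Ug c (yr m)" for i k l m c
  proof -
    have "killing (commutator (xr k) (Ug_e i)) (yr l) = c * killing (xr k) (yr m)"
      using killing_invariant[OF r_gg(1)[of k] E[of i] r_gg(2)[of l]] sc[OF r_gg] that by simp
    moreover have "commutator (Ug_e i) (xr k) = - commutator (xr k) (Ug_e i)" by (rule comm_anti)
    ultimately show ?thesis using sc'(1)[OF gg.intros(7)[OF r_gg(1)[of k] E[of i]] r_gg(2)[of l]] by simp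
  qed
  have 4: "killing (xr R4) (yr R4) = 4 * ?\<kappa>"
    using step[of Node1 R4 4 R3 R3] 3 by (simp add: gens_table g.e_table d.f_table)
  have 5: "killing (xr R5) (yr R5) = - 12 * ?\<kappa>"
    using step[of Node1 R5 3 R4 R4] 4 by (simp add: gens_table g.e_table d.f_table)
  have 6: "killing (xr R6) (yr R6) = 12 * ?\<kappa>"
    using step[of Node2 R6 1 R5 R5] 5 by (simp add: gens_table g.e_table d.f_table)
  show ?thesis using 2 3 4 5 6 by (cases k) simp_all
qed

section \<open>The cobracket\<close>

lemma tensor_Ug_mult: "tensor_Ug a b * tensor_Ug c d = tensor_Ug (a * c) (b * d)"
proof -
  obtain a' b' c' d' where "a = abs_Ug a'" "b = abs_Ug b'" "c = abs_Ug c'" "d = abs_Ug d'"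
    by (metis Quotient_abs_rep[OF Quotient_Ug])
  then show ?thesis by (simp add: tensor_Ug.abs_eq times_Ug2.abs_eq times_Ug.abs_eq tens_mult)
qed

lemma tensor_Ug_linear:
  "tensor_Ug (a + b) c = tensor_Ug a c + tensor_Ug b c" "tensor_Ug c (a + b) = tensor_Ug c a + tensor_Ug c b"
  "tensor_Ug (a - b) c = tensor_Ug a c - tensor_Ug b c" "tensor_Ug c (a - b) = tensor_Ug c a - tensor_Ug c b"
  "tensor_Ug (scale_Ug k a) c = scale_Ug2 k (tensor_Ug a c)" "tensor_Ug c (scale_Ug k a) = scale_Ug2 k (tensor_Ug c a)"
proof -
  obtain a' b' c' where "a = abs_Ug a'" "b = abs_Ug b'" "c = abs_Ug c'"
    by (metis Quotient_abs_rep[OF Quotient_Ug])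
  moreover have "tens (cst k * x) y = cst k * tens x y" "tens x (cst k * y) = cst k * tens x y" for x y
    using tens_mult[of "cst k" x 1 y] tens_mult[of 1 x "cst k" y] by (simp_all add: tens_cst)
  ultimately show "tensor_Ug (a + b) c = tensor_Ug a c + tensor_Ug b c" "tensor_Ug c (a + b) = tensor_Ug c a + tensor_Ug c b"
    "tensor_Ug (a - b) c = tensor_Ug a c - tensor_Ug b c" "tensor_Ug c (a - b) = tensor_Ug c a - tensor_Ug c b"
    "tensor_Ug (scale_Ug k a) c = scale_Ug2 k (tensor_Ug a c)" "tensor_Ug c (scale_Ug k a) = scale_Ug2 k (tensor_Ug c a)"
    by (simp_all add: tensor_Ug.abs_eq plus_Ug.abs_eq minus_Ug.abs_eq plus_Ug2.abs_eq minus_Ug2.abs_eq tens_simps tens_diff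
        scale_Ug_def scale_Ug2_def times_Ug.abs_eq times_Ug2.abs_eq)
qed

lemma wedge_linear:
  "wedge (a + b) c = wedge a c + wedge b c" "wedge c (a + b) = wedge c a + wedge c b"
  "wedge (scale_Ug k a) c = scale_Ug2 k (wedge a c)" "wedge c (scale_Ug k a) = scale_Ug2 k (wedge c a)"
  by (simp_all add: wedge_def tensor_Ug_linear Ug2.scale_right_diff_distrib)

lemma wedge_minus: "wedge (- a) c = - wedge a c" "wedge c (- a) = - wedge c a"
  using wedge_linear(3)[of "- 1" a c] wedge_linear(4)[of c "- 1" a] by (simp_all add: Ug.scale_minus_left Ug2.scale_minus_left)

lemma wedge_0: "wedge 0 c = 0" "wedge c 0 = 0"
  using wedge_linear(3)[of 0 0 c] wedge_linear(4)[of c 0 0] by simp_all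

lemma wedge_anti: "wedge a b = - wedge b a"
  by (simp add: wedge_def)

definition act :: "Ug \<Rightarrow> Ug2 \<Rightarrow> Ug2" where
  "act z u = commutator (tensor_Ug z 1 + tensor_Ug 1 z) u"

lemma scale_Ug2_mult: "scale_Ug2 c x * y = scale_Ug2 c (x * y)" "x * scale_Ug2 c y = scale_Ug2 c (x * y)"
proof -
  show "scale_Ug2 c x * y = scale_Ug2 c (x * y)" by (simp add: scale_Ug2_def mult.assoc)
  have "x * abs_Ug2 (cst c) = abs_Ug2 (cst c) * x"
    by (induct x rule: Ug2.abs_induct) (simp add: times_Ug2.abs_eq cst_free2.\<kappa>_central)
  then show "x * scale_Ug2 c y = scale_Ug2 c (x * y)" unfolding scale_Ug2_def by (simp flip: mult.assoc)
qed

lemma act_linear: "act z (u + v) = act z u + act z v" "act z (scale_Ug2 c u) = scale_Ug2 c (act z u)"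
  "act z 0 = 0" "act z (- u) = - act z u" "act z (u - v) = act z u - act z v"
  by (simp_all add: act_def commutator_def algebra_simps scale_Ug2_mult Ug2.scale_right_diff_distrib)

lemma act_linear_left: "act (y + z) u = act y u + act z u" "act (scale_Ug c z) u = scale_Ug2 c (act z u)"
  by (simp_all add: act_def commutator_def tensor_Ug_linear algebra_simps scale_Ug2_mult
      Ug2.scale_right_diff_distrib Ug2.scale_right_distrib)

lemma act_wedge: "act z (wedge a b) = wedge (commutator z a) b + wedge a (commutator z b)"
  by (simp add: act_def wedge_def commutator_def[of "tensor_Ug _ _ + _"] distrib_left distrib_right right_diff_distrib
      left_diff_distrib tensor_Ug_mult) (simp add: commutator_def tensor_Ug_linear)

lemma act_comm: "act (commutator a b) u = act a (act b u) - act b (act a u)"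
proof -
  have eq: "tensor_Ug (commutator a b) 1 + tensor_Ug 1 (commutator a b)
      = commutator (tensor_Ug a 1 + tensor_Ug 1 a) (tensor_Ug b 1 + tensor_Ug 1 b)"
    by (simp add: commutator_def tensor_Ug_linear distrib_left distrib_right tensor_Ug_mult)
  have "commutator (commutator v w) u = commutator v (commutator w u) - commutator w (commutator v u)" for v w
    by (simp add: commutator_def algebra_simps)
  then show ?thesis unfolding act_def eq .
qed

lemma cobracket_act: "cobracket x = act x r_matrix"
  by (simp add: cobracket_def act_def)

text \<open>All coefficients of the r-matrix are known multiples of this one scalar. Coisotropy is a
  linear condition, so its value does not matter.\<close>

definition "kinv = 1 / killing (xr R1) (yr R1)"

lemma r_matrix_eq: "r_matrix = scale_Ug2 kinv (\<Sum>k\<in>UNIV. scale_Ug2 (kcoef k) (wedge (xr k) (yr k)))"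
proof -
  have inj: "inj rht"
  proof (rule injI)
    fix k l assume "rht k = rht l"
    then have "iwt (Pos k) = iwt (Pos l)" by (simp add: fun_eq_iff)
    then show "k = l" using inj_iwt by (auto simp: inj_def)
  qed
  have "(let x = root_vector (rht k); y = root_vector (\<lambda>i. - rht k i) in scale_Ug2 (1 / killing x y) (wedge x y))
      = scale_Ug2 kinv (scale_Ug2 (kcoef k) (wedge (xr k) (yr k)))" for k
  proof -
    obtain c c' where c: "c \<noteq> 0" "root_vector (rht k) = scale_Ug c (xr k)"
      "c' \<noteq> 0" "root_vector (\<lambda>i. - rht k i) = scale_Ug c' (yr k)" using root_vector_eq by metis
    have "1 / killing (xr k) (yr k) = kinv * kcoef k"
      unfolding killing_roots[of k] kinv_def by simp
    \<comment> \<open>The scalars by which the chosen root vectors differ from x_k and y_k cancel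
      between the Killing form and the wedge.\<close>
    then have "1 / (c * (c' * killing (xr k) (yr k))) * (c' * c) = kinv * kcoef k" using c by simp
    then show ?thesis
      unfolding Let_def c(2,4) killing_scale[OF r_gg] wedge_linear by (simp only: Ug2.scale_scale mult.assoc)
  qed
  then show ?thesis
    unfolding r_matrix_def positive_roots_eq Ug2.scale_sum_right
    by (subst sum.reindex[OF inj]) (simp add: o_def)
qed

text \<open>For e_i the ratios in \<open>kcoef\<close> make all wedges of two root vectors cancel in
  pairs. What remains comes from [e_i, f_i], and its coefficient is the symmetrizer d_i, so it is 3
  for the long root.\<close>

lemma cobracket_gens:
  "cobracket (Ug_coroot i) = 0"
  "cobracket (Ug_e Node1) = scale_Ug2 kinv (wedge (Ug_e Node1) (Ug_coroot Node1))"
  "cobracket (Ug_e Node2) = scale_Ug2 kinv (scale_Ug2 3 (wedge (Ug_e Node2) (Ug_coroot Node2)))"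
proof -
  have act_sum: "act z (sum f A) = (\<Sum>k\<in>A. act z (f k))" for z and f :: "rt \<Rightarrow> Ug2" and A
    by (induction A rule: infinite_finite_induct) (simp_all add: act_linear)
  have exp: "cobracket z = scale_Ug2 kinv (\<Sum>k\<in>UNIV. scale_Ug2 (kcoef k)
      (wedge (commutator z (xr k)) (yr k) + wedge (xr k) (commutator z (yr k))))" for z
    by (simp add: cobracket_act r_matrix_eq act_linear act_sum act_wedge)
  have "wedge (commutator (Ug_coroot i) (xr k)) (yr k) + wedge (xr k) (commutator (Ug_coroot i) (yr k)) = 0" for k
    by (simp add: coroot_comm wedge_linear pairing_def flip: Ug2.scale_left_distrib)
  then show "cobracket (Ug_coroot i) = 0" unfolding exp by simp
  show "cobracket (Ug_e Node1) = scale_Ug2 kinv (wedge (Ug_e Node1) (Ug_coroot Node1))"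
    unfolding exp
    by (simp add: UNIV_rt gens_table wedge_linear wedge_minus wedge_0 Ug2.scale_minus_left Ug2.scale_right_distrib del: xr.simps(2-) yr.simps(2-))
  show "cobracket (Ug_e Node2) = scale_Ug2 kinv (scale_Ug2 3 (wedge (Ug_e Node2) (Ug_coroot Node2)))"
    unfolding exp
    by (simp add: UNIV_rt gens_table wedge_linear wedge_minus wedge_0 Ug2.scale_minus_left Ug2.scale_right_distrib)
qed

section \<open>The coisotropic subalgebra\<close>

definition "tcois = Ug_coroot Node1 + scale_Ug 3 (Ug_coroot Node2)"

lemma hcois_eq: "hcois = Ug.span {tcois, Ug_e Node1, g.x4, g.x5}"
  by (simp add: hcois_def tcois_def Ug_h_def g.x3_def g.x4_def g.x5_def)

lemma hcois_mem: "tcois \<in> hcois" "Ug_e Node1 \<in> hcois" "g.x4 \<in> hcois" "g.x5 \<in> hcois"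
  unfolding hcois_eq by (rule Ug.span_base, simp)+

lemma hcois_gg: "x \<in> hcois \<Longrightarrow> x \<in> gg"
proof -
  have "{tcois, Ug_e Node1, g.x4, g.x5} \<subseteq> gg"
    using r_gg(1)[of R4] r_gg(1)[of R5] gg.intros(1)[of Node1]
    by (simp add: tcois_def gg.intros(3,5,6))
  then have "hcois \<subseteq> gg" unfolding hcois_eq using gg_subspace by (rule Ug.span_minimal)
  then show "x \<in> hcois \<Longrightarrow> x \<in> gg" by blast
qed

lemma tcois_comm: "commutator tcois (xr k) = scale_Ug (of_int (pairing Node1 (rht k) + 3 * pairing Node2 (rht k))) (xr k)"
  by (simp add: tcois_def comm_simps coroot_comm Ug.scale_left_distrib)

lemma hcois_comm:
  assumes "x \<in> hcois" "y \<in> hcois"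
  shows "commutator x y \<in> hcois"
proof -
  let ?S = "{tcois, Ug_e Node1, g.x4, g.x5}"
  have T: "commutator tcois tcois = 0" "commutator tcois (Ug_e Node1) = scale_Ug (- 1) (Ug_e Node1)"
    "commutator tcois g.x4 = scale_Ug 1 g.x4" "commutator tcois g.x5 = scale_Ug 0 g.x5"
    using tcois_comm[of R1] tcois_comm[of R4] tcois_comm[of R5] by (simp_all add: comm_0 pairing_def)
  have E: "commutator (Ug_e Node1) (Ug_e Node1) = 0" "commutator (Ug_e Node1) g.x4 = g.x5"
    "commutator (Ug_e Node1) g.x5 = 0" "commutator g.x4 g.x4 = 0" "commutator g.x4 g.x5 = 0" "commutator g.x5 g.x5 = 0"
    by (simp_all add: comm_0 g.e_table)
  have anti: "commutator a b \<in> Ug.span ?S" if "commutator b a \<in> Ug.span ?S" for a b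
    using Ug.span_neg[OF that] comm_anti[of a b] by simp
  have base: "s \<in> Ug.span ?S" if "s \<in> ?S" for s using that by (rule Ug.span_base)
  have gens: "commutator s t \<in> Ug.span ?S" if "s \<in> ?S" "t \<in> ?S" for s t
  proof -
    have b: "tcois \<in> Ug.span ?S" "Ug_e Node1 \<in> Ug.span ?S" "g.x4 \<in> Ug.span ?S" "g.x5 \<in> Ug.span ?S"
      by (rule base, simp)+
    have c: "commutator tcois tcois \<in> Ug.span ?S" "commutator tcois (Ug_e Node1) \<in> Ug.span ?S"
      "commutator tcois g.x4 \<in> Ug.span ?S" "commutator tcois g.x5 \<in> Ug.span ?S"
      "commutator (Ug_e Node1) (Ug_e Node1) \<in> Ug.span ?S" "commutator (Ug_e Node1) g.x4 \<in> Ug.span ?S"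
      "commutator (Ug_e Node1) g.x5 \<in> Ug.span ?S" "commutator g.x4 g.x4 \<in> Ug.span ?S"
      "commutator g.x4 g.x5 \<in> Ug.span ?S" "commutator g.x5 g.x5 \<in> Ug.span ?S"
      unfolding T E by (intro Ug.span_zero Ug.span_scale b)+
    show ?thesis using that c anti[OF c(2)] anti[OF c(3)] anti[OF c(4)] anti[OF c(6)] anti[OF c(7)] anti[OF c(9)] by auto
  qed
  have 1: "commutator s y \<in> Ug.span ?S" if "s \<in> ?S" for s
    using gens that assms(2) unfolding hcois_eq by (intro comm_span[of ?S s ?S y])
  have "commutator y x \<in> Ug.span ?S"
    using assms(1) unfolding hcois_eq by (intro comm_span[of ?S y ?S x] anti[OF 1])
  then show ?thesis unfolding hcois_eq by (rule anti)
qed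

definition "Wcois = Ug2.span {wedge x y | x y. x \<in> hcois \<and> y \<in> gg}"

lemma Wcois_wedge: "x \<in> hcois \<Longrightarrow> y \<in> gg \<Longrightarrow> wedge x y \<in> Wcois" "y \<in> hcois \<Longrightarrow> x \<in> gg \<Longrightarrow> wedge x y \<in> Wcois"
proof -
  show *: "x \<in> hcois \<Longrightarrow> y \<in> gg \<Longrightarrow> wedge x y \<in> Wcois" for x y
    unfolding Wcois_def by (rule Ug2.span_base) blast
  show "y \<in> hcois \<Longrightarrow> x \<in> gg \<Longrightarrow> wedge x y \<in> Wcois"
    using Ug2.span_neg[of "wedge y x", folded Wcois_def] * wedge_anti[of x y] by (simp add: Wcois_def)
qed

lemma Wcois_span: "u \<in> Wcois \<Longrightarrow> v \<in> Wcois \<Longrightarrow> u + v \<in> Wcois" "u \<in> Wcois \<Longrightarrow> v \<in> Wcois \<Longrightarrow> u - v \<in> Wcois"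
  "u \<in> Wcois \<Longrightarrow> scale_Ug2 c u \<in> Wcois" "u \<in> Wcois \<Longrightarrow> - u \<in> Wcois" "0 \<in> Wcois"
  unfolding Wcois_def by (auto intro: Ug2.span_add Ug2.span_diff Ug2.span_scale Ug2.span_neg Ug2.span_zero)

text \<open>h acts on h \<and> g because it is a subalgebra. By the cocycle rule, brackets of
  elements of h with good cobrackets again have good cobrackets.\<close>

lemma act_Wcois: 
  assumes z: "z \<in> hcois" and "u \<in> Wcois"
  shows "act z u \<in> Wcois"
  using assms(2) unfolding Wcois_def
proof (induction rule: Ug2.span_induct_alt)
  case base
  show ?case by (simp add: act_linear Ug2.span_zero)
next
  case (step c s v)
  then obtain x y where s: "s = wedge x y" "x \<in> hcois" "y \<in> gg" by blast
  have "act z s \<in> Wcois"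
    unfolding s act_wedge using s z hcois_comm hcois_gg gg.intros(7) by (intro Wcois_span Wcois_wedge) blast+
  then show ?case using step by (simp add: act_linear Wcois_def Ug2.span_add Ug2.span_scale)
qed

lemma cobracket_comm: "cobracket (commutator a b) = act a (cobracket b) - act b (cobracket a)"
  by (simp add: cobracket_act act_comm)

text \<open>x_4 is not a bracket of the other listed generators of h, so its cobracket has to be
  computed through x_3, which lies outside h. x_5 = [e_1, x_4] then needs only the cocycle
  rule.\<close>

lemma cobracket_hcois: "x \<in> {tcois, Ug_e Node1, g.x4, g.x5} \<Longrightarrow> cobracket x \<in> Wcois"
proof -
  let ?e1 = "Ug_e Node1" and ?e2 = "Ug_e Node2" and ?h1 = "Ug_coroot Node1" and ?h2 = "Ug_coroot Node2"
  have gg: "?e1 \<in> gg" "?e2 \<in> gg" "?h1 \<in> gg" "?h2 \<in> gg" "g.x3 \<in> gg" "g.x4 \<in> gg"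
    using r_gg(1)[of R3] r_gg(1)[of R4] by (simp_all add: gg.intros)
  have T: "cobracket tcois \<in> Wcois"
    using cobracket_gens(1) by (simp add: tcois_def cobracket_act act_linear_left Wcois_span)
  have 1: "cobracket ?e1 \<in> Wcois"
    by (simp add: cobracket_gens Wcois_span Wcois_wedge hcois_mem gg)
  have eh: "commutator ?e1 ?h2 = scale_Ug 1 ?e1" "commutator ?e2 ?h1 = scale_Ug 3 ?e2" "commutator ?e1 ?h1 = scale_Ug (- 2) ?e1"
    "commutator g.x3 ?h1 = scale_Ug 1 g.x3" "commutator g.x3 ?e1 = - g.x4"
    using rev_comm(1)[of R1 Node2] rev_comm(1)[of R2 Node1] rev_comm(1)[of R1 Node1] rev_comm(1)[of R3 Node1]
      comm_anti[of g.x3 ?e1] by (simp_all add: pairing_def g.e_table)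
  \<comment> \<open>Expanded, this is x_3 \<and> T - 6 e_1 \<and> e_2 with T = H_1 + 3 H_2, the
    Cartan element dual to the root \<alpha>_1 + \<alpha>_2 of x_3. After e_1 acts, every wedge in
    it contains e_1 or x_4.\<close>
  let ?u = "scale_Ug2 3 (wedge g.x3 ?h2 + wedge ?e2 (scale_Ug 1 ?e1)) - (wedge (- g.x3) ?h1 + wedge ?e1 (scale_Ug 3 ?e2))"
  have "cobracket g.x3 = act ?e1 (cobracket ?e2) - act ?e2 (cobracket ?e1)"
    unfolding g.x3_def by (rule cobracket_comm)
  then have 3: "cobracket g.x3 = scale_Ug2 kinv ?u"
    unfolding cobracket_gens act_linear act_wedge eh g.e_table by (simp only: Ug2.scale_right_diff_distrib)
  have "act ?e1 ?u \<in> Wcois"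
    by (simp add: act_linear act_wedge comm_scale comm_minus eh g.e_table comm_0 wedge_0 wedge_minus wedge_linear
        Wcois_span Wcois_wedge hcois_mem gg)
  moreover have "act g.x3 (wedge ?e1 ?h1) \<in> Wcois"
    by (simp add: act_wedge eh wedge_minus wedge_linear Wcois_span Wcois_wedge hcois_mem gg)
  moreover have "cobracket g.x4 = scale_Ug2 kinv (act ?e1 ?u) - scale_Ug2 kinv (act g.x3 (wedge ?e1 ?h1))"
    unfolding g.x4_def cobracket_comm[of ?e1 g.x3] 3 cobracket_gens act_linear ..
  ultimately have 4: "cobracket g.x4 \<in> Wcois"
    by (simp only:) (intro Wcois_span)
  have 5: "cobracket g.x5 \<in> Wcois"
    unfolding g.x5_def cobracket_comm[of ?e1 g.x4] by (rule Wcois_span(2)[OF act_Wcois act_Wcois]) (rule hcois_mem 4 1)+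
  show "cobracket x \<in> Wcois" if "x \<in> {tcois, Ug_e Node1, g.x4, g.x5}" using that T 1 4 5 by auto
qed

lemma coisotropic_hcois: "coisotropic hcois"
  unfolding coisotropic_def lie_subalgebra_def Wcois_def[symmetric]
proof (intro conjI ballI subsetI)
  show "Ug.subspace hcois" unfolding hcois_eq by (rule Ug.subspace_span)
  show "x \<in> gg" if "x \<in> hcois" for x using that by (rule hcois_gg)
  show "commutator x y \<in> hcois" if "x \<in> hcois" "y \<in> hcois" for x y using that by (rule hcois_comm)
  fix u assume "u \<in> cobracket ` hcois"
  then obtain x where x: "x \<in> hcois" and u: "u = cobracket x" by blast
  have "cobracket x \<in> Wcois"
    using x unfolding hcois_eq
  proof (induction rule: Ug.span_induct_alt)
    case base
    have "cobracket 0 = 0" using act_linear_left(2)[of 0 0 r_matrix] by (simp add: cobracket_act)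
    then show ?case by (simp only: Wcois_span(5))
  next
    case (step c s y)
    from cobracket_hcois[OF step(1)] step(2) show ?case
      by (simp only: cobracket_act act_linear_left) (intro Wcois_span)
  qed
  then show "u \<in> Wcois" by (simp add: u)
qed

theorem theorem7p2:
  fixes x1 x3 x4 x5 :: Ug and \<hh> :: "Ug set" and X Y :: Uh and B :: "Uh set"
  assumes "x1 = Ug_e Node1"
    and "x3 = commutator (Ug_e Node1) (Ug_e Node2)"
    and "x4 = commutator (Ug_e Node1) x3"
    and "x5 = commutator (Ug_e Node1) x4"
    and "\<hh> = Ug.span {Ug_h Node1 + Ug_h Node2, x1, x4, x5}"
    and "X = qcomm (-1) (qcomm 3 (Uh_E Node1) (Uh_E Node2)) (Uh_E Node1)"
    and "Y = qcomm 1 (qcomm (-1) (qcomm 3 (Uh_E Node1) (Uh_E Node2)) (Uh_E Node1)) (Uh_E Node1)"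
    and "B = generated_Uh
           {Uh_K Node1 * Uh_K Node2, Uh_logK Node1 + Uh_logK Node2, Uh_E Node1, X, Y}"
  shows "is_quantization B \<hh>"
proof -
  have "\<hh> = hcois" using assms(1-5) by (simp add: hcois_def)
  moreover have "B = generated_Uh gens_B" using assms(6-8) by (simp add: gens_B_def Tq_def Xq_def Yq_def)
  ultimately show ?thesis using is_quantization_B[OF coisotropic_hcois] by simp
qed

end
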